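(* Let $d,k,n\in\mathbb{N}$ with $d\ge k$, let $\theta=\frac{k+1}{k+2}\in(0,1)$, and let $\delta\in[0,1]$. Assume there exists an efficient algorithm that, given $n$ samples from the sparse linear regression model with Gaussian design and noise variance $\sigma^2=1$, achieves prediction error $\frac1n\|A\hat x-Ax^*\|^2\le 0.01$ with probability $1-\delta$. Then there exists an efficient algorithm that solves $\mathrm{NegSPCA}_\theta$ with probability $1-\sqrt{2\delta}-\exp(-\Omega(n))$.
   Context: An algorithm is efficient if it runs in time polynomial in $d,n,k$. **Sparse linear regression model with Gaussian design.** $d,k,n\in\mathbb{N}$ and $\sigma\ge 0$ are known. $\Sigma$ is an unknown positive semidefinite $d\times d$ matrix and $x^*\in\mathbb{R}^d$ is an unknown $k$-sparse vector (at most $k$ non-zero entries). One observes $n$ i.i.d. samples $(a_i,y_i)\in\mathbb{R}^d\times\mathbb{R}$ with $y_i=\langle a_i,x^*\rangle+w_i$, where $a_i\sim N(0,\Sigma)$ and $w_i\sim N(0,\sigma^2)$ are independent. $A\in\mathbb{R}^{n\times d}$ is the matrix with rows $a_i$. The algorithm outputs a (possibly dense) vector $\hat x\in\mathbb{R}^d$; its prediction error is $\frac1n\|A\hat x-Ax^*\|^2$. The success guarantee is required for every $\Sigma$ and every $k$-sparse $x^*$, with probability over the samples and internal randomness. **The problem $\mathrm{NegSPCA}_\theta$** (parameters $d\ge k$, $n$, $\theta\in(0,1)$). Given $n$ i.i.d. samples in $\mathbb{R}^{d+1}$ from either $\mathcal P$ or $\mathcal Q$, decide which. - Planted $\mathcal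 P$: sample once a unit vector $x\in\mathbb{R}^{d+1}$ with first coordinate $x_1=-\frac1{\sqrt{k+1}}$ and remaining coordinates $x_{\setminus 1}$ uniform over the vectors in $\{\pm\frac1{\sqrt{k+1}},0\}^d$ with exactly $k$ non-zero entries; with this $x$ fixed, all samples are drawn i.i.d. from $N(0,\mathrm{Id}_{d+1}-\theta xx^\top)$. - Null $\mathcal Q$: samples are i.i.d. from $N(0,\mathrm{Id}_{d+1})$. An algorithm solves the problem with probability $p$ if under each of the two hypotheses it answers correctly with probability at least $p$ (over samples, including the draw of $x$, and internal randomness). *)

theory Defs
  imports "HOL-Probability.Probability" "HOL-Computational_Algebra.Polynomial"
begin

section \<open>Algorithms: a randomized real RAM\<close>

text \<open>
  A program is a uniform, finite text over named arrays: natural-number arrays with one index and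
  real arrays with two. Real arithmetic is exact and has unit cost, as in the real RAM and
  Blum-Shub-Smale models. Natural numbers serve for control and (indirect) addressing; they have
  addition and subtraction but no unit-cost multiplication, so that in polynomial time they keep
  polynomially many bits, and no operation rounds a real to a natural number. The only constants
  are natural numbers. The internal randomness is an infinite tape of independent N(0,1) numbers;
  fair coins (signs) and uniform numbers in the unit interval (ratios of sums of squares) are
  obtained from it in constant time.
\<close>

datatype nexp =
    NConst nat
  | NGet string nexp
  | NAdd nexp nexp
  | NSub nexp nexp

datatype rexp =
    ROf nexp
  | RGet string nexp nexp
  | RAdd rexp rexp
  | RSub rexp rexp
  | RMul rexp rexp
  | RDiv rexp rexp
  | RSqrt rexp

datatype bexp =
    NLess nexp nexp
  | RLess rexp rexp
  | BNot bexp
  | BAnd bexp bexp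

datatype com =
    Skip
  | NSet string nexp nexp
  | RSet string nexp nexp rexp
  | Draw string nexp nexp
  | Seq com com
  | Cond bexp com com
  | While bexp com

record state =
  nats :: "string \<Rightarrow> nat \<Rightarrow> nat"
  reals :: "string \<Rightarrow> nat \<Rightarrow> nat \<Rightarrow> real"
  tape :: "real stream"

primrec nval :: "nexp \<Rightarrow> state \<Rightarrow> nat" where
  "nval (NConst c) s = c"
| "nval (NGet v e) s = nats s v (nval e s)"
| "nval (NAdd e f) s = nval e s + nval f s"
| "nval (NSub e f) s = nval e s - nval f s"

primrec rval :: "rexp \<Rightarrow> state \<Rightarrow> real" where
  "rval (ROf e) s = real (nval e s)"
| "rval (RGet v e f) s = reals s v (nval e s) (nval f s)"
| "rval (RAdd a b) s = rval a s + rval b s"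
| "rval (RSub a b) s = rval a s - rval b s"
| "rval (RMul a b) s = rval a s * rval b s"
| "rval (RDiv a b) s = rval a s / rval b s"
| "rval (RSqrt a) s = sqrt (rval a s)"

primrec bval :: "bexp \<Rightarrow> state \<Rightarrow> bool" where
  "bval (NLess e f) s \<longleftrightarrow> nval e s < nval f s"
| "bval (RLess a b) s \<longleftrightarrow> rval a s < rval b s"
| "bval (BNot p) s \<longleftrightarrow> \<not> bval p s"
| "bval (BAnd p q) s \<longleftrightarrow> bval p s \<and> bval q s"

definition set_nat :: "string \<Rightarrow> nat \<Rightarrow> nat \<Rightarrow> state \<Rightarrow> state" where
  "set_nat v i c s = s\<lparr>nats := (nats s)(v := (nats s v)(i := c))\<rparr>"

definition set_real :: "string \<Rightarrow> nat \<Rightarrow> nat \<Rightarrow> real \<Rightarrow> state \<Rightarrow> state" where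
  "set_real v i j c s = s\<lparr>reals := (reals s)(v := (reals s v)(i := (reals s v i)(j := c)))\<rparr>"

text \<open>
  \<open>exec c s t s'\<close>: program \<open>c\<close> started in \<open>s\<close> halts in \<open>s'\<close> after exactly \<open>t\<close> steps. A step is one
  assignment, draw or test; the expressions in it have a size fixed by the program text, so this
  is the number of elementary operations up to a factor depending only on the program.
\<close>

inductive exec :: "com \<Rightarrow> state \<Rightarrow> nat \<Rightarrow> state \<Rightarrow> bool" where
  Skip: "exec Skip s 1 s"
| NSet: "exec (NSet v e f) s 1 (set_nat v (nval e s) (nval f s) s)"
| RSet: "exec (RSet v e f a) s 1 (set_real v (nval e s) (nval f s) (rval a s) s)"
| Draw: "exec (Draw v e f) s 1
    (set_real v (nval e s) (nval f s) (shd (tape s)) s\<lparr>tape := stl (tape s)\<rparr>)"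
| Seq: "exec c1 s t1 s1 \<Longrightarrow> exec c2 s1 t2 s2 \<Longrightarrow> exec (Seq c1 c2) s (t1 + t2) s2"
| CondTrue: "bval b s \<Longrightarrow> exec c1 s t s1 \<Longrightarrow> exec (Cond b c1 c2) s (1 + t) s1"
| CondFalse: "\<not> bval b s \<Longrightarrow> exec c2 s t s1 \<Longrightarrow> exec (Cond b c1 c2) s (1 + t) s1"
| WhileFalse: "\<not> bval b s \<Longrightarrow> exec (While b c) s 1 s"
| WhileTrue: "bval b s \<Longrightarrow> exec c s t1 s1 \<Longrightarrow> exec (While b c) s1 t2 s2
    \<Longrightarrow> exec (While b c) s (1 + t1 + t2) s2"

definition halts_with :: "com \<Rightarrow> state \<Rightarrow> (state \<Rightarrow> bool) \<Rightarrow> bool" where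
  "halts_with c s Q \<longleftrightarrow> (\<exists>t s'. exec c s t s' \<and> Q s')"

text \<open>A trivariate polynomial is represented as an element of the ring \<open>\<real>[k][n][d]\<close>.\<close>

definition poly3 :: "real poly poly poly \<Rightarrow> nat \<Rightarrow> nat \<Rightarrow> nat \<Rightarrow> real" where
  "poly3 P d n k = poly (poly (poly P [:[:real d:]:]) [:real n:]) (real k)"

text \<open>
  Polynomial running time only makes sense along a family of parameters: one program
  serves all \<open>(d, k, n)\<close> in \<open>params\<close>, and one polynomial bounds its running time for all of them,
  on every input \<open>S\<close> and every random tape \<open>r\<close>.
\<close>

definition efficient ::
  "(nat \<times> nat \<times> nat) set \<Rightarrow> (nat \<Rightarrow> nat \<Rightarrow> nat \<Rightarrow> 'a \<Rightarrow> real stream \<Rightarrow> state) \<Rightarrow> com \<Rightarrow> bool" where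
  "efficient params inp c \<longleftrightarrow> (\<exists>P. \<forall>(d, k, n) \<in> params. \<forall>S r. \<exists>t s'.
     exec c (inp d k n S r) t s' \<and> real t \<le> poly3 P d n k)"

definition param_nats :: "nat \<Rightarrow> nat \<Rightarrow> nat \<Rightarrow> string \<Rightarrow> nat \<Rightarrow> nat" where
  "param_nats d k n v i =
     (if i \<noteq> 0 then 0 else if v = ''d'' then d else if v = ''k'' then k
      else if v = ''n'' then n else 0)"


section \<open>Gaussian distributions\<close>

definition std_gaussian :: "real measure" where
  "std_gaussian = density lborel (\<lambda>x. ennreal (std_normal_density x))"

definition random_tape :: "real stream measure" where
  "random_tape = stream_space std_gaussian"

text \<open>Vectors and matrices of variable size are functions on \<open>nat\<close>, read at indices below the size.\<close>

definition psd_matrix :: "nat \<Rightarrow> (nat \<Rightarrow> nat \<Rightarrow> real) \<Rightarrow> bool" where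
  "psd_matrix d C \<longleftrightarrow> (\<forall>i<d. \<forall>j<d. C i j = C j i) \<and>
     (\<forall>u :: nat \<Rightarrow> real. 0 \<le> (\<Sum>i<d. \<Sum>j<d. u i * C i j * u j))"

text \<open>
  \<open>N(0, C)\<close>, for a possibly singular positive semidefinite \<open>C\<close>, is the law of \<open>B g\<close> with \<open>g\<close> standard
  Gaussian and \<open>B B\<^sup>T = C\<close>. Such a \<open>B\<close> exists, and the law is the same for all of them.
\<close>

definition gaussian_vec :: "nat \<Rightarrow> (nat \<Rightarrow> nat \<Rightarrow> real) \<Rightarrow> (nat \<Rightarrow> real) measure" where
  "gaussian_vec d C =
     (let B = (SOME B. \<forall>i<d. \<forall>j<d. (\<Sum>l<d. B i l * B j l) = C i j)
      in distr (PiM {..<d} (\<lambda>_. std_gaussian)) (PiM {..<d} (\<lambda>_. borel))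
           (\<lambda>g. \<lambda>i\<in>{..<d}. \<Sum>l<d. B i l * g l))"


section \<open>Sparse linear regression with Gaussian design\<close>

type_synonym slr_samples = "nat \<Rightarrow> (nat \<Rightarrow> real) \<times> real"

definition sparse :: "nat \<Rightarrow> nat \<Rightarrow> (nat \<Rightarrow> real) \<Rightarrow> bool" where
  "sparse d k x \<longleftrightarrow> card {j. j < d \<and> x j \<noteq> 0} \<le> k"

text \<open>Law of one sample \<open>(a, \<langle>a, x\<rangle> + w)\<close>; the noise \<open>w = \<sigma> g\<close> has law \<open>N(0, \<sigma>\<^sup>2)\<close>, also for \<open>\<sigma> = 0\<close>.\<close>

definition slr_sample ::
  "nat \<Rightarrow> real \<Rightarrow> (nat \<Rightarrow> nat \<Rightarrow> real) \<Rightarrow> (nat \<Rightarrow> real) \<Rightarrow> ((nat \<Rightarrow> real) \<times> real) measure" where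
  "slr_sample d \<sigma> C x =
     distr (gaussian_vec d C \<Otimes>\<^sub>M std_gaussian) (PiM {..<d} (\<lambda>_. borel) \<Otimes>\<^sub>M borel)
       (\<lambda>(a, g). (a, (\<Sum>j<d. a j * x j) + \<sigma> * g))"

definition slr_law ::
  "nat \<Rightarrow> nat \<Rightarrow> real \<Rightarrow> (nat \<Rightarrow> nat \<Rightarrow> real) \<Rightarrow> (nat \<Rightarrow> real) \<Rightarrow> slr_samples measure" where
  "slr_law d n \<sigma> C x = PiM {..<n} (\<lambda>_. slr_sample d \<sigma> C x)"

definition slr_input ::
  "real \<Rightarrow> nat \<Rightarrow> nat \<Rightarrow> nat \<Rightarrow> slr_samples \<Rightarrow> real stream \<Rightarrow> state" where
  "slr_input \<sigma> d k n S r =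
     \<lparr>nats = param_nats d k n,
      reals = (\<lambda>v i j. if v = ''A'' \<and> i < n \<and> j < d then fst (S i) j
                       else if v = ''y'' \<and> i < n \<and> j = 0 then snd (S i)
                       else if v = ''sigma'' \<and> i = 0 \<and> j = 0 then \<sigma> else 0),
      tape = r\<rparr>"

definition slr_output :: "state \<Rightarrow> nat \<Rightarrow> real" where
  "slr_output s j = reals s ''x'' j 0"

definition prediction_error ::
  "nat \<Rightarrow> nat \<Rightarrow> slr_samples \<Rightarrow> (nat \<Rightarrow> real) \<Rightarrow> (nat \<Rightarrow> real) \<Rightarrow> real" where
  "prediction_error d n S xhat x =
     (1 / real n) * (\<Sum>i<n. ((\<Sum>j<d. fst (S i) j * xhat j) - (\<Sum>j<d. fst (S i) j * x j))\<^sup>2)"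

definition solves_slr :: "nat \<Rightarrow> nat \<Rightarrow> nat \<Rightarrow> real \<Rightarrow> real \<Rightarrow> real \<Rightarrow> com \<Rightarrow> bool" where
  "solves_slr d k n \<sigma> \<epsilon> p c \<longleftrightarrow>
     (\<forall>C x. psd_matrix d C \<longrightarrow> sparse d k x \<longrightarrow>
        \<P>((S, r) in slr_law d n \<sigma> C x \<Otimes>\<^sub>M random_tape.
           halts_with c (slr_input \<sigma> d k n S r)
             (\<lambda>s. prediction_error d n S (slr_output s) x \<le> \<epsilon>)) \<ge> p)"


section \<open>Negatively spiked sparse PCA\<close>

type_synonym pca_samples = "nat \<Rightarrow> nat \<Rightarrow> real"

text \<open>The first coordinate of the paper's vectors in dimension \<open>d + 1\<close> has index \<open>0\<close> here.\<close>

definition spikes :: "nat \<Rightarrow> nat \<Rightarrow> (nat \<Rightarrow> real) set" where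
  "spikes d k =
     {x \<in> extensional {..<d + 1}.
        x 0 = - 1 / sqrt (real k + 1) \<and>
        (\<forall>i\<in>{1..d}. x i \<in> {1 / sqrt (real k + 1), - 1 / sqrt (real k + 1), 0}) \<and>
        card {i \<in> {1..d}. x i \<noteq> 0} = k}"

definition id_cov :: "nat \<Rightarrow> nat \<Rightarrow> real" where
  "id_cov i j = (if i = j then 1 else 0)"

definition spiked_cov :: "real \<Rightarrow> (nat \<Rightarrow> real) \<Rightarrow> nat \<Rightarrow> nat \<Rightarrow> real" where
  "spiked_cov \<theta> x i j = id_cov i j - \<theta> * x i * x j"

definition planted_law :: "nat \<Rightarrow> nat \<Rightarrow> nat \<Rightarrow> real \<Rightarrow> pca_samples measure" where
  "planted_law d k n \<theta> =
     measure_pmf (pmf_of_set (spikes d k)) \<bind>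
       (\<lambda>x. PiM {..<n} (\<lambda>_. gaussian_vec (d + 1) (spiked_cov \<theta> x)))"

definition null_law :: "nat \<Rightarrow> nat \<Rightarrow> pca_samples measure" where
  "null_law d n = PiM {..<n} (\<lambda>_. gaussian_vec (d + 1) id_cov)"

definition negspca_input ::
  "real \<Rightarrow> nat \<Rightarrow> nat \<Rightarrow> nat \<Rightarrow> pca_samples \<Rightarrow> real stream \<Rightarrow> state" where
  "negspca_input \<theta> d k n S r =
     \<lparr>nats = param_nats d k n,
      reals = (\<lambda>v i j. if v = ''Z'' \<and> i < n \<and> j < d + 1 then S i j
                       else if v = ''theta'' \<and> i = 0 \<and> j = 0 then \<theta> else 0),
      tape = r\<rparr>"

text \<open>The answer is the natural number \<open>out[0]\<close>: 1 stands for planted, 0 for null.\<close>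

definition negspca_answer :: "state \<Rightarrow> nat" where
  "negspca_answer s = nats s ''out'' 0"

definition solves_negspca :: "nat \<Rightarrow> nat \<Rightarrow> nat \<Rightarrow> real \<Rightarrow> real \<Rightarrow> com \<Rightarrow> bool" where
  "solves_negspca d k n \<theta> p c \<longleftrightarrow>
     \<P>((S, r) in planted_law d k n \<theta> \<Otimes>\<^sub>M random_tape.
        halts_with c (negspca_input \<theta> d k n S r) (\<lambda>s. negspca_answer s = 1)) \<ge> p \<and>
     \<P>((S, r) in null_law d n \<Otimes>\<^sub>M random_tape.
        halts_with c (negspca_input \<theta> d k n S r) (\<lambda>s. negspca_answer s = 0)) \<ge> p"

end

theory Submission
  imports Defs
begin

text \<open>
  A planted sample \<open>Z\<close> satisfies \<open>Z\<^sub>0 = \<langle>a, x\<rangle> + w\<close> with \<open>a = (Z\<^sub>1, \<dots>, Z\<^sub>d)\<close>, \<open>x\<close> \<open>k\<close>-sparse and \<open>w\<close>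
  independent of \<open>a\<close> with variance \<open>1 / 2\<close>. For a fresh standard Gaussian \<open>h\<close>, the two responses
  \<open>Z\<^sub>0 + h / sqrt 2\<close> and \<open>Z\<^sub>0 - h / sqrt 2\<close> then have independent noises of variance \<open>1\<close>. Run the regression
  algorithm on the first response and test its output \<open>xhat\<close> on the second one: answer planted iff the
  mean squared residual is at most \<open>5 / 4\<close>.

  In the planted case the residual is the fresh noise minus the prediction error, and
  \<open>(w - p)\<^sup>2 \<le> 11 / 10 * w\<^sup>2 + 11 * p\<^sup>2\<close> gives at most \<open>11 / 10 * 103 / 100 + 11 / 100 < 5 / 4\<close> up to an
  exponentially small probability. In the null case the second response is a third of the first one plus an
  independent noise of variance \<open>4 / 3 > 5 / 4\<close>, so no function of the first response and of \<open>a\<close> predicts it.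
\<close>

text \<open>The guarantee on the prediction error concerns the design rows that the algorithm has
  seen and says nothing about held-out rows. Its output therefore has to be tested at the same rows,
  against a response with independent noise, and the fresh \<open>h\<close> manufactures one. The
  two noises are uncorrelated exactly when the variance added by \<open>h / sqrt 2\<close> equals
  the one already present. The value of \<theta> is made for this: since
  \<open>\<theta> / (1 - \<theta>) = k + 1\<close>, the precision matrix
  \<open>Id + (k + 1) v v^T\<close> of a spike \<open>v\<close> has entry 2 at the first coordinate,
  hence conditional variance 1/2.

  Under the null hypothesis nothing is known about the regression algorithm except that it halts, so
  its output is treated as an arbitrary measurable function of its input. This is why execution has
  to be shown measurable.

  A Gaussian law is given as the law of \<open>B g\<close> with an unspecified root \<open>B\<close>
  of the covariance. That it depends on \<open>B B^T\<close> alone follows from the invariance of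
  standard Gaussian vectors under reflections; every change of variables then reduces to comparing
  Gram matrices.\<close>

section \<open>Measurability of program execution\<close>

text \<open>A total evaluator with bounded recursion depth; the flag says whether the program halted within it.\<close>

primrec run :: "nat \<Rightarrow> com \<Rightarrow> state \<Rightarrow> bool \<times> state" where
  "run 0 c s = (False, s)"
| "run (Suc f) c s = (case c of
     Skip \<Rightarrow> (True, s)
   | NSet v e g \<Rightarrow> (True, set_nat v (nval e s) (nval g s) s)
   | RSet v e g a \<Rightarrow> (True, set_real v (nval e s) (nval g s) (rval a s) s)
   | Draw v e g \<Rightarrow> (True, set_real v (nval e s) (nval g s) (shd (tape s)) s\<lparr>tape := stl (tape s)\<rparr>)
   | Seq c1 c2 \<Rightarrow> (fst (run f c1 s) \<and> fst (run f c2 (snd (run f c1 s))), snd (run f c2 (snd (run f c1 s))))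
   | Cond b c1 c2 \<Rightarrow> (if bval b s then run f c1 s else run f c2 s)
   | While b c1 \<Rightarrow> (if bval b s
       then (fst (run f c1 s) \<and> fst (run f (While b c1) (snd (run f c1 s))),
             snd (run f (While b c1) (snd (run f c1 s))))
       else (True, s)))"

lemma exec_of_run: "fst (run f c s) \<Longrightarrow> \<exists>t. exec c s t (snd (run f c s))"
proof (induction f arbitrary: c s)
  case 0
  then show ?case by simp
next
  case (Suc f)
  show ?case
  proof (cases c)
    case (Seq c1 c2)
    with Suc.prems have "fst (run f c1 s)" "fst (run f c2 (snd (run f c1 s)))" by auto
    then obtain t1 t2 where "exec c1 s t1 (snd (run f c1 s))"
      "exec c2 (snd (run f c1 s)) t2 (snd (run f c2 (snd (run f c1 s))))"
      using Suc.IH by blast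
    from exec.Seq[OF this] show ?thesis unfolding Seq by auto
  next
    case (Cond b c1 c2)
    show ?thesis
    proof (cases "bval b s")
      case True
      with Suc.prems Suc.IH[of c1 s] obtain t where "exec c1 s t (snd (run f c1 s))" unfolding Cond by auto
      from exec.CondTrue[OF True this] show ?thesis using True unfolding Cond by auto
    next
      case False
      with Suc.prems Suc.IH[of c2 s] obtain t where "exec c2 s t (snd (run f c2 s))" unfolding Cond by auto
      from exec.CondFalse[OF False this] show ?thesis using False unfolding Cond by auto
    qed
  next
    case (While b c1)
    show ?thesis
    proof (cases "bval b s")
      case True
      with While Suc.prems have "fst (run f c1 s)" "fst (run f (While b c1) (snd (run f c1 s)))" by auto
      then obtain t1 t2 where "exec c1 s t1 (snd (run f c1 s))"
        "exec (While b c1) (snd (run f c1 s)) t2 (snd (run f (While b c1) (snd (run f c1 s))))"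
        using Suc.IH by blast
      from exec.WhileTrue[OF True this] show ?thesis using True unfolding While by auto
    next
      case False
      from exec.WhileFalse[OF False] show ?thesis using False unfolding While by auto
    qed
  qed (auto intro: exec.intros)
qed

lemma run_Suc: "fst (run f c s) \<Longrightarrow> run (Suc f) c s = run f c s"
proof (induction f arbitrary: c s)
  case 0
  then show ?case by simp
next
  case (Suc f)
  show ?case
  proof (cases c)
    case (Seq c1 c2)
    with Suc.prems have "fst (run f c1 s)" "fst (run f c2 (snd (run f c1 s)))" by auto
    then have "run (Suc f) c1 s = run f c1 s" "run (Suc f) c2 (snd (run f c1 s)) = run f c2 (snd (run f c1 s))"
      using Suc.IH by blast+
    then show ?thesis unfolding Seq
      by (simp del: run.simps add: run.simps(2)[of "Suc f" "Seq c1 c2" s] run.simps(2)[of f "Seq c1 c2" s])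
  next
    case (Cond b c1 c2)
    have "run (Suc f) c1 s = run f c1 s" if "fst (run f c1 s)" using Suc.IH that by blast
    moreover have "run (Suc f) c2 s = run f c2 s" if "fst (run f c2 s)" using Suc.IH that by blast
    ultimately show ?thesis using Suc.prems unfolding Cond
      by (simp del: run.simps add: run.simps(2)[of "Suc f" "Cond b c1 c2" s] run.simps(2)[of f "Cond b c1 c2" s] split: if_splits)
  next
    case (While b c1)
    show ?thesis
    proof (cases "bval b s")
      case True
      with While Suc.prems have "fst (run f c1 s)" "fst (run f (While b c1) (snd (run f c1 s)))" by auto
      then have "run (Suc f) c1 s = run f c1 s"
        "run (Suc f) (While b c1) (snd (run f c1 s)) = run f (While b c1) (snd (run f c1 s))"
        using Suc.IH by blast+
      then show ?thesis using True unfolding While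
        by (simp del: run.simps add: run.simps(2)[of "Suc f" "While b c1" s] run.simps(2)[of f "While b c1" s])
    qed (simp add: While)
  qed auto
qed

lemma run_mono: "f \<le> g \<Longrightarrow> fst (run f c s) \<Longrightarrow> run g c s = run f c s"
proof (induction g rule: dec_induct)
  case (step g)
  then have "run g c s = run f c s" by blast
  with step.prems run_Suc[of g c s] show ?case by simp
qed simp

lemma run_of_exec: "exec c s t s' \<Longrightarrow> \<exists>f. run f c s = (True, s')"
proof (induction rule: exec.induct)
  case (Seq c1 s t1 s1 c2 t2 s2)
  then obtain f g where "run f c1 s = (True, s1)" "run g c2 s1 = (True, s2)" by auto
  then have "run (max f g) c1 s = (True, s1)" "run (max f g) c2 s1 = (True, s2)"
    by (metis fst_conv max.cobounded1 max.cobounded2 run_mono)+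
  then have "run (Suc (max f g)) (Seq c1 c2) s = (True, s2)" by simp
  then show ?case by blast
next
  case (CondTrue b s c1 t s1 c2)
  then obtain f where "run f c1 s = (True, s1)" by auto
  then have "run (Suc f) (Cond b c1 c2) s = (True, s1)" using CondTrue by simp
  then show ?case by blast
next
  case (CondFalse b s c2 t s1 c1)
  then obtain f where "run f c2 s = (True, s1)" by auto
  then have "run (Suc f) (Cond b c1 c2) s = (True, s1)" using CondFalse by simp
  then show ?case by blast
next
  case (WhileTrue b s c t1 s1 t2 s2)
  then obtain f g where "run f c s = (True, s1)" "run g (While b c) s1 = (True, s2)" by auto
  then have "run (max f g) c s = (True, s1)" "run (max f g) (While b c) s1 = (True, s2)"
    by (metis fst_conv max.cobounded1 max.cobounded2 run_mono)+
  then have "run (Suc (max f g)) (While b c) s = (True, s2)" using WhileTrue by simp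
  then show ?case by blast
qed (rule exI[of _ "Suc 0"], simp)+

text \<open>Existence of an execution becomes a countable union over recursion depths, the form in
  which the halting event can be measured.\<close>

lemma halts_with_iff_run: "halts_with c s Q \<longleftrightarrow> (\<exists>f. fst (run f c s) \<and> Q (snd (run f c s)))"
  unfolding halts_with_def by (metis exec_of_run fst_conv run_of_exec snd_conv)


section \<open>The sigma-algebra on machine states\<close>

text \<open>States are records, so the sigma-algebra generated by all cells and the tape is pulled
  back along the map that reads them off.\<close>

definition state_space :: "state measure" where
  "state_space = vimage_algebra UNIV
     (\<lambda>s. ((\<lambda>(v, i). nats s v i), (\<lambda>(v, i, j). reals s v i j), tape s))
     (PiM (UNIV :: (string \<times> nat) set) (\<lambda>_. count_space UNIV) \<Otimes>\<^sub>M
      PiM (UNIV :: (string \<times> nat \<times> nat) set) (\<lambda>_. borel) \<Otimes>\<^sub>M stream_space borel)"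

lemma space_state_space [simp]: "space state_space = UNIV"
  by (simp add: state_space_def)

lemma measurable_state_space:
  assumes "\<And>v i. (\<lambda>x. nats (F x) v i) \<in> measurable M (count_space UNIV)"
    and "\<And>v i j. (\<lambda>x. reals (F x) v i j) \<in> borel_measurable M"
    and "(\<lambda>x. tape (F x)) \<in> measurable M (stream_space borel)"
  shows "F \<in> measurable M state_space"
  unfolding state_space_def
proof (rule measurable_vimage_algebra2)
  show "(\<lambda>x. ((\<lambda>(v, i). nats (F x) v i), (\<lambda>(v, i, j). reals (F x) v i j), tape (F x))) \<in>
    measurable M (PiM (UNIV :: (string \<times> nat) set) (\<lambda>_. count_space UNIV) \<Otimes>\<^sub>M
      PiM (UNIV :: (string \<times> nat \<times> nat) set) (\<lambda>_. borel) \<Otimes>\<^sub>M stream_space borel)"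
    using assms by (intro measurable_Pair measurable_PiM_single') (auto simp: split_beta)
qed simp

lemma measurable_state_embed:
  "(\<lambda>s. ((\<lambda>(v, i). nats s v i), (\<lambda>(v, i, j). reals s v i j), tape s)) \<in> measurable state_space
     (PiM (UNIV :: (string \<times> nat) set) (\<lambda>_. count_space UNIV) \<Otimes>\<^sub>M
      PiM (UNIV :: (string \<times> nat \<times> nat) set) (\<lambda>_. borel) \<Otimes>\<^sub>M stream_space borel)"
  unfolding state_space_def
  by (rule measurable_vimage_algebra1) (auto simp: space_pair_measure space_PiM space_stream_space)

lemma measurable_nats [measurable]: "(\<lambda>s. nats s v i) \<in> measurable state_space (count_space UNIV)"
  using measurable_compose[OF measurable_compose[OF measurable_state_embed measurable_fst]
      measurable_component_singleton[of "(v, i)"]] by simp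

lemma measurable_reals [measurable]: "(\<lambda>s. reals s v i j) \<in> borel_measurable state_space"
  using measurable_compose[OF measurable_compose[OF measurable_compose[OF measurable_state_embed measurable_snd] measurable_fst]
      measurable_component_singleton[of "(v, i, j)"]] by simp

lemma measurable_tape [measurable]: "tape \<in> measurable state_space (stream_space borel)"
  using measurable_compose[OF measurable_compose[OF measurable_state_embed measurable_snd] measurable_snd] by simp

lemma measurable_nval [measurable]: "nval e \<in> measurable state_space (count_space UNIV)"
proof (induction e)
  case (NGet v e)
  note [measurable] = NGet
  show ?case by simp
qed (simp_all)

lemma measurable_rval [measurable]: "rval a \<in> borel_measurable state_space"
proof (induction a)
  case (RGet v e g)
  \<comment> \<open>Addresses are natural numbers, so a read at a computed address splits into
    countably many reads at fixed ones.\<close>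
  have "(\<lambda>s. reals s v (nval e s) j) \<in> borel_measurable state_space" for j
    by (rule measurable_compose_countable[OF measurable_reals measurable_nval])
  from measurable_compose_countable[OF this measurable_nval] show ?case by simp
qed (simp_all)

lemma measurable_bval [measurable]: "Measurable.pred state_space (bval b)"
proof (induction b)
  case (NLess e g)
  have "Measurable.pred state_space (\<lambda>s. i < nval g s)" for i
    by (rule measurable_compose[OF measurable_nval]) simp
  from measurable_compose_countable[OF this measurable_nval] show ?case by simp
qed simp_all

lemma nats_set_nat: "nats (set_nat v i c s) w j = (if w = v \<and> j = i then c else nats s w j)"
  by (simp add: set_nat_def)

lemma reals_set_real:
  "reals (set_real v i j c s) w a b = (if w = v \<and> a = i \<and> b = j then c else reals s w a b)"
  by (simp add: set_real_def)

lemma set_nat_simps [simp]: "reals (set_nat v i c s) = reals s" "tape (set_nat v i c s) = tape s"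
  by (simp_all add: set_nat_def)

lemma set_real_simps [simp]: "nats (set_real v i j c s) = nats s" "tape (set_real v i j c s) = tape s"
  by (simp_all add: set_real_def)

text \<open>Induction on the depth rather than on the program: a loop then unfolds into a test and
  runs of smaller depth.\<close>

lemma measurable_run [measurable]:
  "run f c \<in> measurable state_space (count_space UNIV \<Otimes>\<^sub>M state_space)"
proof (induction f arbitrary: c)
  case 0
  then show ?case by simp
next
  case (Suc f)
  note IH [measurable] = Suc
  show ?case
  proof (cases c)
    case (NSet v e g)
    have "(\<lambda>s. set_nat v (nval e s) (nval g s) s) \<in> measurable state_space state_space"
      by (rule measurable_state_space) (simp_all add: nats_set_nat)
    then show ?thesis by (simp add: NSet)
  next
    case (RSet v e g a)
    have "(\<lambda>s. set_real v (nval e s) (nval g s) (rval a s) s) \<in> measurable state_space state_space"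
      by (rule measurable_state_space) (simp_all add: reals_set_real)
    then show ?thesis by (simp add: RSet)
  next
    case (Draw v e g)
    have "(\<lambda>s. set_real v (nval e s) (nval g s) (shd (tape s)) s\<lparr>tape := stl (tape s)\<rparr>) \<in> measurable state_space state_space"
      by (rule measurable_state_space) (simp_all add: reals_set_real)
    then show ?thesis by (simp add: Draw)
  qed (simp_all)
qed

text \<open>Taking the least sufficient depth makes the end state a total measurable function of the
  start state; where the program does not halt, its value carries no information.\<close>

definition final :: "com \<Rightarrow> state \<Rightarrow> state" where
  "final c s = snd (run (LEAST f. fst (run f c s)) c s)"

lemma measurable_final [measurable]: "final c \<in> measurable state_space state_space"
proof -
  have "(\<lambda>s. (LEAST f. fst (run f c s))) \<in> measurable state_space (count_space UNIV)"
    by measurable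
  from measurable_compose_countable[OF _ this, of "\<lambda>f s. snd (run f c s)"] show ?thesis
    unfolding final_def[abs_def] by simp
qed

lemma exec_final:
  assumes "exec c s t s'"
  shows "\<exists>t. exec c s t (final c s)"
proof -
  obtain f where "run f c s = (True, s')" using run_of_exec[OF assms] by blast
  then have "fst (run f c s)" by simp
  then have "fst (run (LEAST f. fst (run f c s)) c s)" by (rule LeastI)
  then show ?thesis unfolding final_def by (rule exec_of_run)
qed

lemma measurable_halts_with [measurable]:
  assumes [measurable]: "F \<in> measurable M state_space" "Measurable.pred (M \<Otimes>\<^sub>M state_space) (\<lambda>(x, s). Q x s)"
  shows "Measurable.pred M (\<lambda>x. halts_with c (F x) (Q x))"
  unfolding halts_with_iff_run by measurable

section \<open>The reduction as a program\<close>

text \<open>The regression program is run with all its arrays renamed, so that it neither sees nor destroys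
  the data of the surrounding program.\<close>

abbreviation hash :: "string \<Rightarrow> string" where
  "hash v \<equiv> CHR ''#'' # v"

primrec nexp_rename :: "nexp \<Rightarrow> nexp" where
  "nexp_rename (NConst c) = NConst c"
| "nexp_rename (NGet v e) = NGet (hash v) (nexp_rename e)"
| "nexp_rename (NAdd e f) = NAdd (nexp_rename e) (nexp_rename f)"
| "nexp_rename (NSub e f) = NSub (nexp_rename e) (nexp_rename f)"

primrec rexp_rename :: "rexp \<Rightarrow> rexp" where
  "rexp_rename (ROf e) = ROf (nexp_rename e)"
| "rexp_rename (RGet v e f) = RGet (hash v) (nexp_rename e) (nexp_rename f)"
| "rexp_rename (RAdd a b) = RAdd (rexp_rename a) (rexp_rename b)"
| "rexp_rename (RSub a b) = RSub (rexp_rename a) (rexp_rename b)"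
| "rexp_rename (RMul a b) = RMul (rexp_rename a) (rexp_rename b)"
| "rexp_rename (RDiv a b) = RDiv (rexp_rename a) (rexp_rename b)"
| "rexp_rename (RSqrt a) = RSqrt (rexp_rename a)"

primrec bexp_rename :: "bexp \<Rightarrow> bexp" where
  "bexp_rename (NLess e f) = NLess (nexp_rename e) (nexp_rename f)"
| "bexp_rename (RLess a b) = RLess (rexp_rename a) (rexp_rename b)"
| "bexp_rename (BNot p) = BNot (bexp_rename p)"
| "bexp_rename (BAnd p q) = BAnd (bexp_rename p) (bexp_rename q)"

primrec com_rename :: "com \<Rightarrow> com" where
  "com_rename Skip = Skip"
| "com_rename (NSet v e f) = NSet (hash v) (nexp_rename e) (nexp_rename f)"
| "com_rename (RSet v e f a) = RSet (hash v) (nexp_rename e) (nexp_rename f) (rexp_rename a)"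
| "com_rename (Draw v e f) = Draw (hash v) (nexp_rename e) (nexp_rename f)"
| "com_rename (Seq c1 c2) = Seq (com_rename c1) (com_rename c2)"
| "com_rename (Cond b c1 c2) = Cond (bexp_rename b) (com_rename c1) (com_rename c2)"
| "com_rename (While b c) = While (bexp_rename b) (com_rename c)"

text \<open>Only the memory is separated. The tape is shared: the inner program goes on reading
  where the surrounding one has stopped.\<close>

definition embedded :: "state \<Rightarrow> state \<Rightarrow> bool" where
  "embedded s s' \<longleftrightarrow> (\<forall>v. nats s' (hash v) = nats s v) \<and> (\<forall>v. reals s' (hash v) = reals s v) \<and> tape s' = tape s"

definition same_outside :: "state \<Rightarrow> state \<Rightarrow> bool" where
  "same_outside s s' \<longleftrightarrow> (\<forall>v. (\<forall>w. v \<noteq> hash w) \<longrightarrow> nats s' v = nats s v \<and> reals s' v = reals s v)"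

lemma nval_rename: "embedded s s' \<Longrightarrow> nval (nexp_rename e) s' = nval e s"
  by (induction e) (simp_all add: embedded_def)

lemma rval_rename: "embedded s s' \<Longrightarrow> rval (rexp_rename a) s' = rval a s"
  by (induction a) (simp_all add: nval_rename, simp add: embedded_def)

lemma bval_rename: "embedded s s' \<Longrightarrow> bval (bexp_rename b) s' = bval b s"
  by (induction b) (simp_all add: nval_rename rval_rename)

lemma same_outside_refl: "same_outside s s"
  by (simp add: same_outside_def)

lemma same_outside_trans: "same_outside s s1 \<Longrightarrow> same_outside s1 s2 \<Longrightarrow> same_outside s s2"
  by (simp add: same_outside_def)

text \<open>A lockstep simulation: all expressions and tests have the same values in the hashed
  memory, so even the step counts agree and the inner running time enters the total
  unchanged.\<close>

lemma exec_rename: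
  "exec c s t u \<Longrightarrow> embedded s s' \<Longrightarrow> \<exists>u'. exec (com_rename c) s' t u' \<and> embedded u u' \<and> same_outside s' u'"
proof (induction arbitrary: s' rule: exec.induct)
  case (Skip s)
  then show ?case using exec.Skip same_outside_refl by auto
next
  case (NSet v e f s)
  have "embedded (set_nat v (nval e s) (nval f s) s) (set_nat (hash v) (nval e s) (nval f s) s')"
    "same_outside s' (set_nat (hash v) (nval e s) (nval f s) s')"
    using NSet by (auto simp: embedded_def same_outside_def set_nat_def)
  then show ?case using exec.NSet[of "hash v" "nexp_rename e" "nexp_rename f" s'] NSet by (auto simp: nval_rename)
next
  case (RSet v e f a s)
  have "embedded (set_real v (nval e s) (nval f s) (rval a s) s) (set_real (hash v) (nval e s) (nval f s) (rval a s) s')"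
    "same_outside s' (set_real (hash v) (nval e s) (nval f s) (rval a s) s')"
    using RSet by (auto simp: embedded_def same_outside_def set_real_def)
  then show ?case using exec.RSet[of "hash v" "nexp_rename e" "nexp_rename f" "rexp_rename a" s'] RSet
    by (auto simp: nval_rename rval_rename)
next
  case (Draw v e f s)
  have t: "tape s' = tape s" using Draw by (simp add: embedded_def)
  have "embedded (set_real v (nval e s) (nval f s) (shd (tape s)) s\<lparr>tape := stl (tape s)\<rparr>)
      (set_real (hash v) (nval e s) (nval f s) (shd (tape s')) s'\<lparr>tape := stl (tape s')\<rparr>)"
    "same_outside s' (set_real (hash v) (nval e s) (nval f s) (shd (tape s')) s'\<lparr>tape := stl (tape s')\<rparr>)"
    using Draw by (auto simp: embedded_def same_outside_def set_real_def)
  then show ?case using exec.Draw[of "hash v" "nexp_rename e" "nexp_rename f" s'] Draw by (auto simp: nval_rename)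
next
  case (Seq c1 s t1 s1 c2 t2 s2)
  then obtain u1 where u1: "exec (com_rename c1) s' t1 u1" "embedded s1 u1" "same_outside s' u1" by blast
  with Seq obtain u2 where "exec (com_rename c2) u1 t2 u2" "embedded s2 u2" "same_outside u1 u2" by blast
  with u1 show ?case by (auto intro!: exI[of _ u2] exec.Seq intro: same_outside_trans)
next
  case (CondTrue b s c1 t s1 c2)
  then obtain u1 where u1: "exec (com_rename c1) s' t u1" "embedded s1 u1" "same_outside s' u1" by blast
  with exec.CondTrue[OF _ u1(1), of "bexp_rename b" "com_rename c2"] CondTrue show ?case by (auto simp: bval_rename)
next
  case (CondFalse b s c2 t s1 c1)
  then obtain u1 where u1: "exec (com_rename c2) s' t u1" "embedded s1 u1" "same_outside s' u1" by blast
  with exec.CondFalse[OF _ u1(1), of "bexp_rename b" "com_rename c1"] CondFalse show ?case by (auto simp: bval_rename)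
next
  case (WhileFalse b s c)
  then show ?case using exec.WhileFalse[of "bexp_rename b" s'] same_outside_refl by (auto simp: bval_rename)
next
  case (WhileTrue b s c t1 s1 t2 s2)
  then obtain u1 where u1: "exec (com_rename c) s' t1 u1" "embedded s1 u1" "same_outside s' u1" by blast
  with WhileTrue obtain u2 where u2: "exec (com_rename (While b c)) u1 t2 u2" "embedded s2 u2" "same_outside u1 u2" by blast
  have "bval (bexp_rename b) s'" using WhileTrue by (simp add: bval_rename)
  from exec.WhileTrue[OF this u1(1) u2(1)[unfolded com_rename.simps]] u1 u2 show ?case
    by (auto intro!: exI[of _ u2] intro: same_outside_trans)
qed

section \<open>Total correctness with a time bound\<close>

text \<open>The bound \<open>T\<close> is part of the judgement, so one derivation yields both the
  result and the running time.\<close>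

definition triple :: "(state \<Rightarrow> bool) \<Rightarrow> com \<Rightarrow> nat \<Rightarrow> (state \<Rightarrow> bool) \<Rightarrow> bool" where
  "triple P c T Q \<longleftrightarrow> (\<forall>s. P s \<longrightarrow> (\<exists>t s'. exec c s t s' \<and> t \<le> T \<and> Q s'))"

lemma triple_NSet: "(\<And>s. P s \<Longrightarrow> Q (set_nat v (nval e s) (nval f s) s)) \<Longrightarrow> triple P (NSet v e f) 1 Q"
  unfolding triple_def using exec.NSet by blast

lemma triple_RSet:
  "(\<And>s. P s \<Longrightarrow> Q (set_real v (nval e s) (nval f s) (rval a s) s)) \<Longrightarrow> triple P (RSet v e f a) 1 Q"
  unfolding triple_def using exec.RSet by blast

lemma triple_Draw:
  "(\<And>s. P s \<Longrightarrow> Q (set_real v (nval e s) (nval f s) (shd (tape s)) s\<lparr>tape := stl (tape s)\<rparr>)) \<Longrightarrow>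
    triple P (Draw v e f) 1 Q"
  unfolding triple_def using exec.Draw by blast

lemma triple_Seq: "triple P c1 T1 R \<Longrightarrow> triple R c2 T2 Q \<Longrightarrow> triple P (Seq c1 c2) (T1 + T2) Q"
  unfolding triple_def using exec.Seq by (meson add_mono)

lemma triple_conseq:
  assumes "triple P c T Q" "\<And>s. P' s \<Longrightarrow> P s" "T \<le> T'" "\<And>s. Q s \<Longrightarrow> Q' s"
  shows "triple P' c T' Q'"
  using assms unfolding triple_def by (meson order_trans)

definition for_loop :: "string \<Rightarrow> nexp \<Rightarrow> com \<Rightarrow> com" where
  "for_loop v e c = Seq (NSet v (NConst 0) (NConst 0))
     (While (NLess (NGet v (NConst 0)) e)
       (Seq c (NSet v (NConst 0) (NAdd (NGet v (NConst 0)) (NConst 1)))))"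

text \<open>The invariant has to determine the counter, so that the guard fails exactly at
  \<open>N\<close>. A round costs the body, one test and one increment; the summand 2 pays for the
  initialisation and the last, failing test.\<close>

lemma triple_for_loop:
  assumes init: "\<And>s. P s \<Longrightarrow> I 0 (set_nat v 0 0 s)"
    and bound: "\<And>i s. I i s \<Longrightarrow> nats s v 0 = i \<and> nval e s = N \<and> i \<le> N"
    and body: "\<And>i. i < N \<Longrightarrow> triple (I i) c T (\<lambda>s. nats s v 0 = i \<and> I (Suc i) (set_nat v 0 (Suc i) s))"
  shows "triple P (for_loop v e c) (2 + N * (T + 2)) (I N)"
proof -
  let ?b = "NLess (NGet v (NConst 0)) e"
  let ?c = "Seq c (NSet v (NConst 0) (NAdd (NGet v (NConst 0)) (NConst 1)))"
  have loop: "\<exists>t s'. exec (While ?b ?c) s t s' \<and> t \<le> 1 + (N - i) * (T + 2) \<and> I N s'" if "I i s" for i s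
    using that
  proof (induction "N - i" arbitrary: i s)
    case 0
    then have "i = N" using bound by (metis diff_is_0_eq le_antisym)
    then have "\<not> bval ?b s" using 0 bound by auto
    from exec.WhileFalse[OF this] show ?case using 0 \<open>i = N\<close> by (intro exI[of _ 1] exI[of _ s]) simp
  next
    case (Suc m)
    then have i: "i < N" by simp
    then have b: "bval ?b s" using bound[OF Suc.prems] by simp
    obtain t1 s1 where s1: "exec c s t1 s1" "t1 \<le> T" "nats s1 v 0 = i" "I (Suc i) (set_nat v 0 (Suc i) s1)"
      using body[OF i] Suc.prems unfolding triple_def by blast
    have "exec ?c s (t1 + 1) (set_nat v 0 (Suc i) s1)"
      using exec.Seq[OF s1(1) exec.NSet[of v "NConst 0" "NAdd (NGet v (NConst 0)) (NConst 1)" s1]] s1(3) by simp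
    moreover obtain t2 s2 where s2: "exec (While ?b ?c) (set_nat v 0 (Suc i) s1) t2 s2"
      "t2 \<le> 1 + (N - Suc i) * (T + 2)" "I N s2"
    proof -
      have "m = N - Suc i" using Suc.hyps(2) by simp
      from Suc.hyps(1)[OF this s1(4)] show ?thesis using that by blast
    qed
    ultimately have "exec (While ?b ?c) s (1 + (t1 + 1) + t2) s2" using b exec.WhileTrue by blast
    moreover have "1 + (t1 + 1) + t2 \<le> 1 + (N - i) * (T + 2)"
    proof -
      have "N - i = Suc (N - Suc i)" using i by simp
      then show ?thesis using s1(2) s2(2) by simp
    qed
    ultimately show ?case using s2(3) by blast
  qed
  show ?thesis unfolding triple_def
  proof (intro allI impI)
    fix s assume "P s"
    from loop[OF init[OF this]] obtain t s' where
      "exec (While ?b ?c) (set_nat v 0 0 s) t s'" "t \<le> 1 + N * (T + 2)" "I N s'" by auto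
    then show "\<exists>t s'. exec (for_loop v e c) s t s' \<and> t \<le> 2 + N * (T + 2) \<and> I N s'"
      using exec.Seq[OF exec.NSet[of v "NConst 0" "NConst 0" s], of "While ?b ?c" t s'] unfolding for_loop_def
      by (intro exI[of _ "1 + t"] exI[of _ s']) simp
  qed
qed

section \<open>The program text and its invariants\<close>

abbreviation "nvar v \<equiv> NGet v (NConst 0)"

text \<open>Each draw is kept in the array \<open>h\<close>, because the test needs the same number
  with the opposite sign. Tape entry \<open>i\<close> thus belongs to sample \<open>i\<close>, and
  the regression program finds the tape from entry \<open>n\<close> on.\<close>

definition setup_code :: com where
  "setup_code =
     Seq (NSet (hash ''d'') (NConst 0) (nvar ''d''))
    (Seq (NSet (hash ''k'') (NConst 0) (nvar ''k''))
    (Seq (NSet (hash ''n'') (NConst 0) (nvar ''n''))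
    (Seq (RSet (hash ''sigma'') (NConst 0) (NConst 0) (ROf (NConst 1)))
    (for_loop ''i'' (nvar ''n'')
      (Seq (Draw ''h'' (nvar ''i'') (NConst 0))
      (Seq (RSet (hash ''y'') (nvar ''i'') (NConst 0)
             (RAdd (RGet ''Z'' (nvar ''i'') (NConst 0))
               (RDiv (RGet ''h'' (nvar ''i'') (NConst 0)) (RSqrt (ROf (NConst 2))))))
      (for_loop ''j'' (nvar ''d'')
        (RSet (hash ''A'') (nvar ''i'') (nvar ''j'')
          (RGet ''Z'' (nvar ''i'') (NAdd (nvar ''j'') (NConst 1)))))))))))"

text \<open>The comparison of the mean squared residual with 5/4 is cleared of denominators and made
  between reals, since natural numbers have no multiplication. The accumulator \<open>f\<close>
  starts from the zero of the initial memory.\<close>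

definition decide_code :: com where
  "decide_code =
     Seq (for_loop ''i'' (nvar ''n'')
      (Seq (RSet ''e'' (NConst 0) (NConst 0)
             (RSub (RGet ''Z'' (nvar ''i'') (NConst 0))
               (RDiv (RGet ''h'' (nvar ''i'') (NConst 0)) (RSqrt (ROf (NConst 2))))))
      (Seq (for_loop ''j'' (nvar ''d'')
             (RSet ''e'' (NConst 0) (NConst 0)
               (RSub (RGet ''e'' (NConst 0) (NConst 0))
                 (RMul (RGet ''Z'' (nvar ''i'') (NAdd (nvar ''j'') (NConst 1)))
                   (RGet (hash ''x'') (nvar ''j'') (NConst 0))))))
        (RSet ''f'' (NConst 0) (NConst 0)
          (RAdd (RGet ''f'' (NConst 0) (NConst 0))
            (RMul (RGet ''e'' (NConst 0) (NConst 0)) (RGet ''e'' (NConst 0) (NConst 0))))))))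
    (Seq (NSet ''out'' (NConst 0) (NConst 1))
      (Cond (RLess (RMul (ROf (NConst 5)) (ROf (nvar ''n''))) (RMul (ROf (NConst 4)) (RGet ''f'' (NConst 0) (NConst 0))))
        (NSet ''out'' (NConst 0) (NConst 0)) Skip))"

definition reduction :: "com \<Rightarrow> com" where
  "reduction alg = Seq setup_code (Seq (com_rename alg) decide_code)"

definition regression_samples :: "pca_samples \<Rightarrow> real stream \<Rightarrow> slr_samples" where
  "regression_samples S r i = (\<lambda>j. S i (Suc j), S i 0 + r !! i / sqrt 2)"

definition residual :: "nat \<Rightarrow> pca_samples \<Rightarrow> real stream \<Rightarrow> (nat \<Rightarrow> real) \<Rightarrow> nat \<Rightarrow> real" where
  "residual d S r x i = S i 0 - r !! i / sqrt 2 - (\<Sum>j<d. S i (Suc j) * x j)"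

definition kept :: "nat \<Rightarrow> nat \<Rightarrow> pca_samples \<Rightarrow> state \<Rightarrow> bool" where
  "kept d n S s \<longleftrightarrow> nats s ''d'' 0 = d \<and> nats s ''n'' 0 = n \<and> reals s ''f'' 0 0 = 0 \<and>
     (\<forall>i<n. \<forall>j\<le>d. reals s ''Z'' i j = S i j)"

text \<open>Here \<open>p\<close> random numbers have been drawn, and the rows of the design below \<open>q\<close> and the first \<open>j\<close> entries
  of row \<open>q\<close> have been copied.\<close>

definition setup_inv :: "nat \<Rightarrow> nat \<Rightarrow> nat \<Rightarrow> pca_samples \<Rightarrow> real stream \<Rightarrow> nat \<Rightarrow> nat \<Rightarrow> nat \<Rightarrow> state \<Rightarrow> bool" where
  "setup_inv d k n S r p q j s \<longleftrightarrow> kept d n S s \<and> (\<forall>v. nats s (hash v) = param_nats d k n v) \<and>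
     tape s = sdrop p r \<and> (\<forall>i<p. reals s ''h'' i 0 = r !! i) \<and>
     (\<forall>v a b. reals s (hash v) a b =
       (if v = ''A'' \<and> (a < q \<and> b < d \<or> a = q \<and> b < j) then S a (Suc b)
        else if v = ''y'' \<and> a < p \<and> b = 0 then S a 0 + r !! a / sqrt 2
        else if v = ''sigma'' \<and> a = 0 \<and> b = 0 then 1 else 0))"

lemma triple_setup:
  "triple (\<lambda>s. s = negspca_input \<theta> d k n S r) setup_code (6 + n * (8 + 3 * d)) (setup_inv d k n S r n n 0)"
proof -
  let ?P = "\<lambda>s. kept d n S s \<and> tape s = r \<and> nats s ''k'' 0 = k"
  let ?Q = "\<lambda>N x s. ?P s \<and> (\<forall>v i. nats s (hash v) i = (if v \<in> N then param_nats d k n v i else 0)) \<and>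
     (\<forall>v a b. reals s (hash v) a b = (if v = ''sigma'' \<and> a = 0 \<and> b = 0 then x else 0))"
  have c1: "triple (\<lambda>s. s = negspca_input \<theta> d k n S r) (NSet (hash ''d'') (NConst 0) (nvar ''d'')) 1 (?Q {''d''} 0)"
    by (rule triple_NSet) (auto simp: negspca_input_def kept_def param_nats_def nats_set_nat)
  have c2: "triple (?Q {''d''} 0) (NSet (hash ''k'') (NConst 0) (nvar ''k'')) 1 (?Q {''d'', ''k''} 0)"
    by (rule triple_NSet) (auto simp: kept_def param_nats_def nats_set_nat)
  have c3: "triple (?Q {''d'', ''k''} 0) (NSet (hash ''n'') (NConst 0) (nvar ''n'')) 1 (?Q {''d'', ''k'', ''n''} 0)"
    by (rule triple_NSet) (auto simp: kept_def param_nats_def nats_set_nat)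
  have c4: "triple (?Q {''d'', ''k'', ''n''} 0) (RSet (hash ''sigma'') (NConst 0) (NConst 0) (ROf (NConst 1))) 1 (setup_inv d k n S r 0 0 0)"
    by (rule triple_RSet) (auto simp: kept_def param_nats_def reals_set_real setup_inv_def fun_eq_iff)
  have inner: "triple (\<lambda>s. i < n \<and> nats s ''i'' 0 = i \<and> setup_inv d k n S r (Suc i) i 0 s)
    (for_loop ''j'' (nvar ''d'') (RSet (hash ''A'') (nvar ''i'') (nvar ''j'') (RGet ''Z'' (nvar ''i'') (NAdd (nvar ''j'') (NConst 1)))))
    (2 + d * (1 + 2)) (\<lambda>s. i < n \<and> nats s ''j'' 0 = d \<and> d \<le> d \<and> nats s ''i'' 0 = i \<and> setup_inv d k n S r (Suc i) i d s)" for i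
  proof (rule triple_for_loop[where I = "\<lambda>j s. i < n \<and> nats s ''j'' 0 = j \<and> j \<le> d \<and> nats s ''i'' 0 = i \<and> setup_inv d k n S r (Suc i) i j s"])
    fix j assume "j < d"
    then show "triple (\<lambda>s. i < n \<and> nats s ''j'' 0 = j \<and> j \<le> d \<and> nats s ''i'' 0 = i \<and> setup_inv d k n S r (Suc i) i j s)
      (RSet (hash ''A'') (nvar ''i'') (nvar ''j'') (RGet ''Z'' (nvar ''i'') (NAdd (nvar ''j'') (NConst 1)))) 1
      (\<lambda>s. nats s ''j'' 0 = j \<and> i < n \<and> nats (set_nat ''j'' 0 (Suc j) s) ''j'' 0 = Suc j \<and> Suc j \<le> d \<and>
        nats (set_nat ''j'' 0 (Suc j) s) ''i'' 0 = i \<and> setup_inv d k n S r (Suc i) i (Suc j) (set_nat ''j'' 0 (Suc j) s))"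
      by (intro triple_RSet) (auto simp: setup_inv_def kept_def nats_set_nat reals_set_real fun_eq_iff less_Suc_eq)
  qed (auto simp: setup_inv_def kept_def nats_set_nat fun_eq_iff)
  have outer: "triple (setup_inv d k n S r 0 0 0)
    (for_loop ''i'' (nvar ''n'')
      (Seq (Draw ''h'' (nvar ''i'') (NConst 0))
      (Seq (RSet (hash ''y'') (nvar ''i'') (NConst 0)
             (RAdd (RGet ''Z'' (nvar ''i'') (NConst 0))
               (RDiv (RGet ''h'' (nvar ''i'') (NConst 0)) (RSqrt (ROf (NConst 2))))))
      (for_loop ''j'' (nvar ''d'')
        (RSet (hash ''A'') (nvar ''i'') (nvar ''j'')
          (RGet ''Z'' (nvar ''i'') (NAdd (nvar ''j'') (NConst 1))))))))
    (2 + n * (1 + (1 + (2 + d * (1 + 2))) + 2))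
    (\<lambda>s. nats s ''i'' 0 = n \<and> n \<le> n \<and> setup_inv d k n S r n n 0 s)"
  proof (rule triple_for_loop[where I = "\<lambda>i s. nats s ''i'' 0 = i \<and> i \<le> n \<and> setup_inv d k n S r i i 0 s"])
    fix i assume i: "i < n"
    \<comment> \<open>Between the draw and the response, the tape and \<open>h\<close> are one entry
      ahead of \<open>y\<close>; no instance of \<open>setup_inv\<close> describes this
      state.\<close>
    let ?R = "\<lambda>s. i < n \<and> nats s ''i'' 0 = i \<and> kept d n S s \<and> (\<forall>v. nats s (hash v) = param_nats d k n v) \<and>
     tape s = sdrop (Suc i) r \<and> (\<forall>a<Suc i. reals s ''h'' a 0 = r !! a) \<and>
     (\<forall>v a b. reals s (hash v) a b =
       (if v = ''A'' \<and> a < i \<and> b < d then S a (Suc b)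
        else if v = ''y'' \<and> a < i \<and> b = 0 then S a 0 + r !! a / sqrt 2
        else if v = ''sigma'' \<and> a = 0 \<and> b = 0 then 1 else 0))"
    have d1: "triple (\<lambda>s. nats s ''i'' 0 = i \<and> i \<le> n \<and> setup_inv d k n S r i i 0 s) (Draw ''h'' (nvar ''i'') (NConst 0)) 1 ?R"
      using i by (intro triple_Draw) (auto simp: setup_inv_def kept_def reals_set_real less_Suc_eq)
    have d2: "triple ?R (RSet (hash ''y'') (nvar ''i'') (NConst 0)
             (RAdd (RGet ''Z'' (nvar ''i'') (NConst 0))
               (RDiv (RGet ''h'' (nvar ''i'') (NConst 0)) (RSqrt (ROf (NConst 2)))))) 1
       (\<lambda>s. i < n \<and> nats s ''i'' 0 = i \<and> setup_inv d k n S r (Suc i) i 0 s)"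
      by (intro triple_RSet) (auto simp: setup_inv_def kept_def reals_set_real less_Suc_eq)
    have "triple (\<lambda>s. i < n \<and> nats s ''i'' 0 = i \<and> setup_inv d k n S r (Suc i) i 0 s)
      (for_loop ''j'' (nvar ''d'') (RSet (hash ''A'') (nvar ''i'') (nvar ''j'') (RGet ''Z'' (nvar ''i'') (NAdd (nvar ''j'') (NConst 1)))))
      (2 + d * (1 + 2))
      (\<lambda>s. nats s ''i'' 0 = i \<and> nats (set_nat ''i'' 0 (Suc i) s) ''i'' 0 = Suc i \<and> Suc i \<le> n \<and>
        setup_inv d k n S r (Suc i) (Suc i) 0 (set_nat ''i'' 0 (Suc i) s))"
    proof -
      \<comment> \<open>A row \<open>i\<close> with all its \<open>d\<close> entries copied is the
        same as \<open>Suc i\<close> full rows and an empty row \<open>Suc i\<close>.\<close>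
      have "setup_inv d k n S r (Suc i) (Suc i) 0 (set_nat ''i'' 0 (Suc i) s)"
        if "setup_inv d k n S r (Suc i) i d s" for s
        using that by (auto simp: setup_inv_def kept_def nats_set_nat fun_eq_iff less_Suc_eq)
      then show ?thesis by (intro triple_conseq[OF inner[of i]]) (auto simp: nats_set_nat)
    qed
    from triple_Seq[OF d1 triple_Seq[OF d2 this]]
    show "triple (\<lambda>s. nats s ''i'' 0 = i \<and> i \<le> n \<and> setup_inv d k n S r i i 0 s)
      (Seq (Draw ''h'' (nvar ''i'') (NConst 0))
      (Seq (RSet (hash ''y'') (nvar ''i'') (NConst 0)
             (RAdd (RGet ''Z'' (nvar ''i'') (NConst 0))
               (RDiv (RGet ''h'' (nvar ''i'') (NConst 0)) (RSqrt (ROf (NConst 2))))))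
      (for_loop ''j'' (nvar ''d'')
        (RSet (hash ''A'') (nvar ''i'') (nvar ''j'')
          (RGet ''Z'' (nvar ''i'') (NAdd (nvar ''j'') (NConst 1)))))))
      (1 + (1 + (2 + d * (1 + 2))))
      (\<lambda>s. nats s ''i'' 0 = i \<and> nats (set_nat ''i'' 0 (Suc i) s) ''i'' 0 = Suc i \<and> Suc i \<le> n \<and>
        setup_inv d k n S r (Suc i) (Suc i) 0 (set_nat ''i'' 0 (Suc i) s))" .
  qed (auto simp: setup_inv_def kept_def nats_set_nat fun_eq_iff)
  from triple_Seq[OF c1 triple_Seq[OF c2 triple_Seq[OF c3 triple_Seq[OF c4 outer]]]]
  show ?thesis unfolding setup_code_def[symmetric] by (rule triple_conseq) (auto simp: algebra_simps)
qed

lemma triple_decide: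
  "triple (\<lambda>s. kept d n S s \<and> (\<forall>i<n. reals s ''h'' i 0 = r !! i) \<and> (\<forall>j. reals s (hash ''x'') j 0 = x j))
    decide_code (5 + n * (6 + 3 * d))
    (\<lambda>s. negspca_answer s = (if 5 * real n < 4 * (\<Sum>i<n. (residual d S r x i)\<^sup>2) then 0 else 1))"
proof -
  let ?K = "\<lambda>s :: state. nats s ''d'' 0 = d \<and> nats s ''n'' 0 = n \<and> (\<forall>i<n. \<forall>j\<le>d. reals s ''Z'' i j = S i j) \<and>
    (\<forall>i<n. reals s ''h'' i 0 = r !! i) \<and> (\<forall>j. reals s (hash ''x'') j 0 = x j)"
  let ?I = "\<lambda>i s. nats s ''i'' 0 = i \<and> i \<le> n \<and> ?K s \<and> reals s ''f'' 0 0 = (\<Sum>a<i. (residual d S r x a)\<^sup>2)"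
  let ?J = "\<lambda>i j s. nats s ''j'' 0 = j \<and> j \<le> d \<and> i < n \<and> ?I i s \<and>
    reals s ''e'' 0 0 = S i 0 - r !! i / sqrt 2 - (\<Sum>b<j. S i (Suc b) * x b)"
  have inner: "triple (\<lambda>s. i < n \<and> ?I i s \<and> reals s ''e'' 0 0 = S i 0 - r !! i / sqrt 2)
    (for_loop ''j'' (nvar ''d'')
             (RSet ''e'' (NConst 0) (NConst 0)
               (RSub (RGet ''e'' (NConst 0) (NConst 0))
                 (RMul (RGet ''Z'' (nvar ''i'') (NAdd (nvar ''j'') (NConst 1)))
                   (RGet (hash ''x'') (nvar ''j'') (NConst 0))))))
    (2 + d * (1 + 2)) (?J i d)" for i
  proof (rule triple_for_loop[where I = "?J i"])
    fix j assume "j < d"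
    then show "triple (?J i j) (RSet ''e'' (NConst 0) (NConst 0)
               (RSub (RGet ''e'' (NConst 0) (NConst 0))
                 (RMul (RGet ''Z'' (nvar ''i'') (NAdd (nvar ''j'') (NConst 1)))
                   (RGet (hash ''x'') (nvar ''j'') (NConst 0))))) 1
      (\<lambda>s. nats s ''j'' 0 = j \<and> ?J i (Suc j) (set_nat ''j'' 0 (Suc j) s))"
      by (intro triple_RSet) (auto simp: nats_set_nat reals_set_real)
  qed (auto simp: nats_set_nat)
  have outer: "triple (\<lambda>s. ?K s \<and> reals s ''f'' 0 0 = 0) (for_loop ''i'' (nvar ''n'')
      (Seq (RSet ''e'' (NConst 0) (NConst 0)
             (RSub (RGet ''Z'' (nvar ''i'') (NConst 0))
               (RDiv (RGet ''h'' (nvar ''i'') (NConst 0)) (RSqrt (ROf (NConst 2))))))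
      (Seq (for_loop ''j'' (nvar ''d'')
             (RSet ''e'' (NConst 0) (NConst 0)
               (RSub (RGet ''e'' (NConst 0) (NConst 0))
                 (RMul (RGet ''Z'' (nvar ''i'') (NAdd (nvar ''j'') (NConst 1)))
                   (RGet (hash ''x'') (nvar ''j'') (NConst 0))))))
        (RSet ''f'' (NConst 0) (NConst 0)
          (RAdd (RGet ''f'' (NConst 0) (NConst 0))
            (RMul (RGet ''e'' (NConst 0) (NConst 0)) (RGet ''e'' (NConst 0) (NConst 0))))))))
      (2 + n * (1 + (2 + d * (1 + 2) + 1) + 2)) (?I n)"
  proof (rule triple_for_loop[where I = ?I])
    fix i assume i: "i < n"
    have d1: "triple (?I i) (RSet ''e'' (NConst 0) (NConst 0)
             (RSub (RGet ''Z'' (nvar ''i'') (NConst 0))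
               (RDiv (RGet ''h'' (nvar ''i'') (NConst 0)) (RSqrt (ROf (NConst 2)))))) 1
      (\<lambda>s. i < n \<and> ?I i s \<and> reals s ''e'' 0 0 = S i 0 - r !! i / sqrt 2)"
      using i by (intro triple_RSet) (auto simp: reals_set_real)
    have d3: "triple (?J i d) (RSet ''f'' (NConst 0) (NConst 0)
          (RAdd (RGet ''f'' (NConst 0) (NConst 0))
            (RMul (RGet ''e'' (NConst 0) (NConst 0)) (RGet ''e'' (NConst 0) (NConst 0))))) 1
      (\<lambda>s. nats s ''i'' 0 = i \<and> ?I (Suc i) (set_nat ''i'' 0 (Suc i) s))"
      by (intro triple_RSet) (auto simp: nats_set_nat reals_set_real residual_def power2_eq_square)
    from triple_Seq[OF d1 triple_Seq[OF inner d3]]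
    show "triple (?I i) (Seq (RSet ''e'' (NConst 0) (NConst 0)
             (RSub (RGet ''Z'' (nvar ''i'') (NConst 0))
               (RDiv (RGet ''h'' (nvar ''i'') (NConst 0)) (RSqrt (ROf (NConst 2))))))
      (Seq (for_loop ''j'' (nvar ''d'')
             (RSet ''e'' (NConst 0) (NConst 0)
               (RSub (RGet ''e'' (NConst 0) (NConst 0))
                 (RMul (RGet ''Z'' (nvar ''i'') (NAdd (nvar ''j'') (NConst 1)))
                   (RGet (hash ''x'') (nvar ''j'') (NConst 0))))))
        (RSet ''f'' (NConst 0) (NConst 0)
          (RAdd (RGet ''f'' (NConst 0) (NConst 0))
            (RMul (RGet ''e'' (NConst 0) (NConst 0)) (RGet ''e'' (NConst 0) (NConst 0)))))))
      (1 + (2 + d * (1 + 2) + 1)) (\<lambda>s. nats s ''i'' 0 = i \<and> ?I (Suc i) (set_nat ''i'' 0 (Suc i) s))" .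
  qed (auto simp: nats_set_nat)
  let ?b = "RLess (RMul (ROf (NConst 5)) (ROf (nvar ''n''))) (RMul (ROf (NConst 4)) (RGet ''f'' (NConst 0) (NConst 0)))"
  have o1: "triple (?I n) (NSet ''out'' (NConst 0) (NConst 1)) 1
    (\<lambda>s. nats s ''n'' 0 = n \<and> nats s ''out'' 0 = 1 \<and> reals s ''f'' 0 0 = (\<Sum>a<n. (residual d S r x a)\<^sup>2))"
    by (intro triple_NSet) (auto simp: nats_set_nat)
  have o2: "triple (\<lambda>s. nats s ''n'' 0 = n \<and> nats s ''out'' 0 = 1 \<and> reals s ''f'' 0 0 = (\<Sum>a<n. (residual d S r x a)\<^sup>2))
    (Cond ?b (NSet ''out'' (NConst 0) (NConst 0)) Skip) 2
    (\<lambda>s. negspca_answer s = (if 5 * real n < 4 * (\<Sum>i<n. (residual d S r x i)\<^sup>2) then 0 else 1))"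
    unfolding triple_def
  proof (intro allI impI)
    fix s :: state assume s: "nats s ''n'' 0 = n \<and> nats s ''out'' 0 = 1 \<and> reals s ''f'' 0 0 = (\<Sum>a<n. (residual d S r x a)\<^sup>2)"
    show "\<exists>t s'. exec (Cond ?b (NSet ''out'' (NConst 0) (NConst 0)) Skip) s t s' \<and> t \<le> 2 \<and>
      negspca_answer s' = (if 5 * real n < 4 * (\<Sum>i<n. (residual d S r x i)\<^sup>2) then 0 else 1)"
    proof (cases "bval ?b s")
      case True
      from exec.CondTrue[OF this exec.NSet[of "''out''" "NConst 0" "NConst 0"]] True s show ?thesis
        by (intro exI conjI) (assumption, auto simp: negspca_answer_def nats_set_nat)
    next
      case False
      from exec.CondFalse[OF this exec.Skip] False s show ?thesis
        by (intro exI conjI) (assumption, auto simp: negspca_answer_def)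
    qed
  qed
  from triple_Seq[OF outer triple_Seq[OF o1 o2]] show ?thesis
    unfolding decide_code_def[symmetric] by (rule triple_conseq) (auto simp: kept_def algebra_simps)
qed

text \<open>The only interface to the program that the probabilistic part uses: the regression run
  may be any halting one, and the answer is a function of its output. The inner tape is
  \<open>sdrop n r\<close>, as \<open>n\<close> entries have been spent on the noise.\<close>

lemma exec_reduction:
  assumes "exec alg (slr_input 1 d k n (regression_samples S r) (sdrop n r)) t u"
  shows "\<exists>t' s'. exec (reduction alg) (negspca_input \<theta> d k n S r) t' s' \<and> t' \<le> 11 + n * (14 + 6 * d) + t \<and>
    negspca_answer s' = (if 5 * real n < 4 * (\<Sum>i<n. (residual d S r (slr_output u) i)\<^sup>2) then 0 else 1)"
proof -
  obtain t1 s1 where 1: "exec setup_code (negspca_input \<theta> d k n S r) t1 s1" "t1 \<le> 6 + n * (8 + 3 * d)"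
    "setup_inv d k n S r n n 0 s1"
    using triple_setup unfolding triple_def by blast
  \<comment> \<open>Hashed cells that were not filled on purpose are still zero, so the hashed
    memory is exactly an initial regression state.\<close>
  have "embedded (slr_input 1 d k n (regression_samples S r) (sdrop n r)) s1"
    using 1(3) by (auto simp: embedded_def setup_inv_def slr_input_def regression_samples_def fun_eq_iff)
  from exec_rename[OF assms this] obtain s2 where
    2: "exec (com_rename alg) s1 t s2" "embedded u s2" "same_outside s1 s2" by blast
  have "kept d n S s2 \<and> (\<forall>i<n. reals s2 ''h'' i 0 = r !! i) \<and> (\<forall>j. reals s2 (hash ''x'') j 0 = slr_output u j)"
    using 1(3) 2(2,3) by (auto simp: setup_inv_def kept_def same_outside_def embedded_def slr_output_def)
  then obtain t3 s3 where 3: "exec decide_code s2 t3 s3" "t3 \<le> 5 + n * (6 + 3 * d)"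
    "negspca_answer s3 = (if 5 * real n < 4 * (\<Sum>i<n. (residual d S r (slr_output u) i)\<^sup>2) then 0 else 1)"
    using triple_decide[of d n S r "slr_output u"] unfolding triple_def by blast
  have "exec (reduction alg) (negspca_input \<theta> d k n S r) (t1 + (t + t3)) s3"
    unfolding reduction_def by (rule exec.Seq[OF 1(1) exec.Seq[OF 2(1) 3(1)]])
  moreover have "t1 + (t + t3) \<le> 11 + n * (14 + 6 * d) + t"
    using 1(2) 3(2) by (simp add: algebra_simps)
  ultimately show ?thesis using 3(3) by blast
qed

section \<open>The polynomial time bound\<close>

lemma poly3_simps:
  "poly3 (P + Q) d n k = poly3 P d n k + poly3 Q d n k"
  "poly3 (P * Q) d n k = poly3 P d n k * poly3 Q d n k"
  "poly3 [:[:[:c:]:]:] d n k = c"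
  "poly3 [:[:0, 1:]:] d n k = real n"
  "poly3 [:0, 1:] d n k = real d"
  by (simp_all add: poly3_def)

lemma efficient_reduction:
  assumes "efficient params (slr_input 1) alg"
  shows "efficient params (\<lambda>d k. negspca_input (\<theta> k) d k) (reduction alg)"
proof -
  obtain P where P: "\<forall>(d, k, n) \<in> params. \<forall>S r. \<exists>t s'. exec alg (slr_input 1 d k n S r) t s' \<and> real t \<le> poly3 P d n k"
    using assms unfolding efficient_def by blast
  \<comment> \<open>The overhead \<open>11 + n * (14 + 6 * d)\<close> of
    \<open>exec_reduction\<close>, written in the nested ring: \<open>[:0, 1:]\<close> is the outer
    variable \<open>d\<close> and \<open>[:[:0, 1:]:]\<close> is \<open>n\<close>.\<close>
  define P' where "P' = [:[:[:11:]:]:] + [:[:0, 1:]:] * ([:[:[:14:]:]:] + [:[:[:6:]:]:] * [:0, 1:]) + P"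
  have P': "poly3 P' d n k = 11 + real n * (14 + 6 * real d) + poly3 P d n k" for d n k
    unfolding P'_def poly3_simps ..
  show ?thesis unfolding efficient_def
  proof (rule exI[of _ P'], clarify)
    fix d k n S r assume "(d, k, n) \<in> params"
    \<comment> \<open>Efficiency bounds the time on every sample and tape, in particular on those
      that the setup produces, whatever their law.\<close>
    then obtain t s' where t: "exec alg (slr_input 1 d k n (regression_samples S r) (sdrop n r)) t s'" "real t \<le> poly3 P d n k"
      using P by blast
    from exec_reduction[OF t(1), of "\<theta> k"] obtain t' s'' where
      "exec (reduction alg) (negspca_input (\<theta> k) d k n S r) t' s''" "t' \<le> 11 + n * (14 + 6 * d) + t" by blast
    moreover from this(2) have "real t' \<le> 11 + real n * (14 + 6 * real d) + real t"
      by (simp only: of_nat_le_iff[where 'a = real, symmetric] of_nat_add of_nat_mult of_nat_numeral)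
    ultimately show "\<exists>t s'. exec (reduction alg) (negspca_input (\<theta> k) d k n S r) t s' \<and> real t \<le> poly3 P' d n k"
      using t(2) unfolding P' by (meson add_left_mono order_trans)
  qed
qed

section \<open>Orthogonal invariance of Gaussian laws\<close>

lemma prob_space_std_gaussian: "prob_space std_gaussian"
  unfolding std_gaussian_def using prob_space_normal_density[of 1 0] by simp

lemma sets_std_gaussian [measurable_cong, simp]: "sets std_gaussian = sets borel"
  by (simp add: std_gaussian_def)

lemma space_std_gaussian [simp]: "space std_gaussian = UNIV"
  by (simp add: std_gaussian_def)

interpretation std_gaussian: prob_space std_gaussian
  by (rule prob_space_std_gaussian)

interpretation std_gaussian_pair: pair_prob_space std_gaussian std_gaussian
  by standard

interpretation std_gaussian_prod: product_prob_space "\<lambda>_. std_gaussian" I for I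
  by standard

lemma nn_integral_std_gaussian:
  assumes "f \<in> borel_measurable borel"
  shows "(\<integral>\<^sup>+x. f x \<partial>std_gaussian) = (\<integral>\<^sup>+x. ennreal (std_normal_density x) * f x \<partial>lborel)"
  unfolding std_gaussian_def using assms by (subst nn_integral_density) auto

section \<open>Rotations of the plane\<close>

text \<open>Two one-dimensional affine substitutions replace a planar change of variables: first
  \<open>u = c * x - s * y\<close> for fixed \<open>y\<close>, then
  \<open>y = - s * u + c * v\<close> for fixed \<open>u\<close>. Their factors \<open>1 / c\<close>
  and \<open>c\<close> cancel in absolute value, and the density depends on \<open>x^2 + y^2\<close>
  only. The first substitution is what needs \<open>c\<close> to be nonzero.\<close>

lemma std_gaussian_rotation_aux:
  fixes c s :: real and F :: "real \<Rightarrow> real \<Rightarrow> ennreal"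
  assumes cs: "c\<^sup>2 + s\<^sup>2 = 1" and c0: "c \<noteq> 0"
    and F [measurable]: "case_prod F \<in> borel_measurable (borel \<Otimes>\<^sub>M borel)"
  shows "(\<integral>\<^sup>+y. \<integral>\<^sup>+x. F (c * x - s * y) (s * x + c * y) \<partial>std_gaussian \<partial>std_gaussian) =
    (\<integral>\<^sup>+y. \<integral>\<^sup>+x. F x y \<partial>std_gaussian \<partial>std_gaussian)"
proof -
  let ?\<phi> = "\<lambda>x. ennreal (std_normal_density x)"
  have ss: "s * s = 1 - c * c" using cs by (simp add: power2_eq_square)
  have ident: "s * (s * y / c + 1 / c * u) + c * y = (s * u + y) / c" for u y
  proof -
    have "s * (s * y / c + 1 / c * u) + c * y = (s * s * y + s * u + c * c * y) / c"
      using c0 by (simp add: field_simps)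
    also have "s * s * y + s * u + c * c * y = s * u + y" unfolding ss by (simp add: algebra_simps)
    finally show ?thesis .
  qed
  have "(\<integral>\<^sup>+y. \<integral>\<^sup>+x. F (c * x - s * y) (s * x + c * y) \<partial>std_gaussian \<partial>std_gaussian) =
    (\<integral>\<^sup>+y. \<integral>\<^sup>+x. ?\<phi> y * (?\<phi> x * F (c * x - s * y) (s * x + c * y)) \<partial>lborel \<partial>lborel)"
    by (simp add: nn_integral_std_gaussian nn_integral_cmult)
  also have "\<dots> = (\<integral>\<^sup>+y. ennreal \<bar>1 / c\<bar> * (\<integral>\<^sup>+u. ?\<phi> y * (?\<phi> (s * y / c + 1 / c * u) * F u ((s * u + y) / c)) \<partial>lborel) \<partial>lborel)"
  proof (rule nn_integral_cong)
    fix y :: real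
    show "(\<integral>\<^sup>+x. ?\<phi> y * (?\<phi> x * F (c * x - s * y) (s * x + c * y)) \<partial>lborel) =
      ennreal \<bar>1 / c\<bar> * (\<integral>\<^sup>+u. ?\<phi> y * (?\<phi> (s * y / c + 1 / c * u) * F u ((s * u + y) / c)) \<partial>lborel)"
      using c0 by (subst nn_integral_real_affine[where c = "1 / c" and t = "s * y / c"])
        (simp_all only: ident, simp_all add: field_simps)
  qed
  also have "\<dots> = (\<integral>\<^sup>+y. \<integral>\<^sup>+u. ennreal \<bar>1 / c\<bar> * (?\<phi> y * (?\<phi> (s * y / c + 1 / c * u) * F u ((s * u + y) / c))) \<partial>lborel \<partial>lborel)"
    by (simp add: nn_integral_cmult)
  also have "\<dots> = (\<integral>\<^sup>+u. \<integral>\<^sup>+y. ennreal \<bar>1 / c\<bar> * (?\<phi> y * (?\<phi> (s * y / c + 1 / c * u) * F u ((s * u + y) / c))) \<partial>lborel \<partial>lborel)"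
    by (rule lborel_pair.Fubini') measurable
  also have "\<dots> = (\<integral>\<^sup>+u. \<integral>\<^sup>+v. ?\<phi> u * (?\<phi> v * F u v) \<partial>lborel \<partial>lborel)"
  proof (rule nn_integral_cong)
    fix u :: real
    have x: "s * (- (s * u) + c * v) / c + 1 / c * u = c * u + s * v" for v
    proof -
      have "s * (- (s * u) + c * v) / c + 1 / c * u = (u - s * s * u + s * c * v) / c"
        using c0 by (simp add: field_simps)
      also have "u - s * s * u + s * c * v = c * (c * u + s * v)" unfolding ss by (simp add: algebra_simps)
      finally show ?thesis using c0 by simp
    qed
    have dens: "?\<phi> (- (s * u) + c * v) * ?\<phi> (c * u + s * v) = ?\<phi> u * ?\<phi> v" for v
    proof -
      have "(- (s * u) + c * v)\<^sup>2 + (c * u + s * v)\<^sup>2 = (c\<^sup>2 + s\<^sup>2) * (u\<^sup>2 + v\<^sup>2)"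
        by (simp add: power2_eq_square algebra_simps)
      then have "(- (s * u) + c * v)\<^sup>2 + (c * u + s * v)\<^sup>2 = u\<^sup>2 + v\<^sup>2" using cs by simp
      moreover have "std_normal_density x * std_normal_density y = exp (- (x\<^sup>2 + y\<^sup>2) / 2) / (2 * pi)" for x y
        unfolding std_normal_density_def by (simp add: exp_add[symmetric] add_divide_distrib diff_divide_distrib)
      ultimately have "std_normal_density (- (s * u) + c * v) * std_normal_density (c * u + s * v) =
        std_normal_density u * std_normal_density v" by simp
      then show ?thesis
        by (subst (1 2) ennreal_mult'[OF normal_density_nonneg, symmetric]) (rule arg_cong)
    qed
    have "(\<integral>\<^sup>+y. ennreal \<bar>1 / c\<bar> * (?\<phi> y * (?\<phi> (s * y / c + 1 / c * u) * F u ((s * u + y) / c))) \<partial>lborel) =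
      ennreal \<bar>c\<bar> * (\<integral>\<^sup>+v. ennreal \<bar>1 / c\<bar> * (?\<phi> (- (s * u) + c * v) * (?\<phi> (c * u + s * v) * F u v)) \<partial>lborel)"
      using c0 by (subst nn_integral_real_affine[where c = c and t = "- (s * u)"]) (simp_all only: x, simp_all)
    also have "\<dots> = (\<integral>\<^sup>+v. (ennreal \<bar>c\<bar> * ennreal \<bar>1 / c\<bar>) * (?\<phi> (- (s * u) + c * v) * ?\<phi> (c * u + s * v) * F u v) \<partial>lborel)"
      by (subst nn_integral_cmult[symmetric]) (simp_all add: mult.assoc)
    also have "ennreal \<bar>c\<bar> * ennreal \<bar>1 / c\<bar> = 1"
      using c0 by (subst ennreal_mult'[symmetric]) (simp_all add: abs_mult[symmetric])
    finally show "(\<integral>\<^sup>+y. ennreal \<bar>1 / c\<bar> * (?\<phi> y * (?\<phi> (s * y / c + 1 / c * u) * F u ((s * u + y) / c))) \<partial>lborel) =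
      (\<integral>\<^sup>+v. ?\<phi> u * (?\<phi> v * F u v) \<partial>lborel)"
      unfolding dens by (simp add: mult.assoc)
  qed
  also have "\<dots> = (\<integral>\<^sup>+u. \<integral>\<^sup>+v. F u v \<partial>std_gaussian \<partial>std_gaussian)"
    by (simp add: nn_integral_std_gaussian nn_integral_cmult)
  also have "\<dots> = (\<integral>\<^sup>+y. \<integral>\<^sup>+x. F x y \<partial>std_gaussian \<partial>std_gaussian)"
    by (rule std_gaussian_pair.Fubini') measurable
  finally show ?thesis .
qed

lemma std_gaussian_rotation:
  fixes c s :: real and F :: "real \<Rightarrow> real \<Rightarrow> ennreal"
  assumes cs: "c\<^sup>2 + s\<^sup>2 = 1"
    and F [measurable]: "case_prod F \<in> borel_measurable (borel \<Otimes>\<^sub>M borel)"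
  shows "(\<integral>\<^sup>+y. \<integral>\<^sup>+x. F (c * x - s * y) (s * x + c * y) \<partial>std_gaussian \<partial>std_gaussian) =
    (\<integral>\<^sup>+y. \<integral>\<^sup>+x. F x y \<partial>std_gaussian \<partial>std_gaussian)"
proof (cases "c = 0")
  case False
  then show ?thesis by (rule std_gaussian_rotation_aux[OF cs _ F])
next
  case True
  \<comment> \<open>a quarter turn is two eighth turns\<close>
  define a b where "a = 1 / sqrt 2" and "b = s / sqrt 2"
  have s2: "s\<^sup>2 = 1" using cs True by simp
  have ab: "a\<^sup>2 + b\<^sup>2 = 1" "a \<noteq> 0" using s2 by (simp_all add: a_def b_def power_divide)
  have aa: "a * a = 1 / 2" "a * b = s / 2" "b * a = s / 2" "b * b = 1 / 2"
    using s2 by (simp_all add: a_def b_def power2_eq_square)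
  let ?G = "\<lambda>x y. F (a * x - b * y) (b * x + a * y)"
  have e1: "a * (a * x - b * y) - b * (b * x + a * y) = - (s * y)" for x y
  proof -
    have "a * (a * x - b * y) - b * (b * x + a * y) = (a * a - b * b) * x - (a * b + b * a) * y"
      by (simp add: algebra_simps)
    then show ?thesis unfolding aa by simp
  qed
  have e2: "b * (a * x - b * y) + a * (b * x + a * y) = s * x" for x y
  proof -
    have "b * (a * x - b * y) + a * (b * x + a * y) = (a * b + b * a) * x + (a * a - b * b) * y"
      by (simp add: algebra_simps)
    then show ?thesis unfolding aa by simp
  qed
  have "(\<integral>\<^sup>+y. \<integral>\<^sup>+x. ?G (a * x - b * y) (b * x + a * y) \<partial>std_gaussian \<partial>std_gaussian) =
    (\<integral>\<^sup>+y. \<integral>\<^sup>+x. ?G x y \<partial>std_gaussian \<partial>std_gaussian)"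
    by (rule std_gaussian_rotation_aux[OF ab]) measurable
  also have "\<dots> = (\<integral>\<^sup>+y. \<integral>\<^sup>+x. F x y \<partial>std_gaussian \<partial>std_gaussian)"
    by (rule std_gaussian_rotation_aux[OF ab]) measurable
  finally show ?thesis unfolding e1 e2 True by simp
qed

section \<open>Rotations and reflections in higher dimension\<close>

abbreviation gauss :: "nat \<Rightarrow> (nat \<Rightarrow> real) measure" where
  "gauss m \<equiv> PiM {..<m} (\<lambda>_. std_gaussian)"

definition gauss_invariant :: "nat \<Rightarrow> ((nat \<Rightarrow> real) \<Rightarrow> nat \<Rightarrow> real) \<Rightarrow> bool" where
  "gauss_invariant m T \<longleftrightarrow> T \<in> measurable (gauss m) (gauss m) \<and> distr (gauss m) (gauss m) T = gauss m"

lemma gauss_invariant_comp: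
  assumes "gauss_invariant m S" "gauss_invariant m T"
  shows "gauss_invariant m (\<lambda>x. S (T x))"
  using assms distr_distr[of S "gauss m" "gauss m" T "gauss m"]
  by (auto simp: gauss_invariant_def comp_def intro: measurable_compose)

lemma gauss_invariant_cong:
  assumes "gauss_invariant m S" "\<And>x. x \<in> space (gauss m) \<Longrightarrow> S x = T x"
  shows "gauss_invariant m T"
  using assms measurable_cong[of "gauss m" S T "gauss m"] distr_cong[of "gauss m" "gauss m" "gauss m" "gauss m" S T]
  by (auto simp: gauss_invariant_def)

lemma gauss_invariantI:
  assumes T: "T \<in> measurable (gauss m) (gauss m)"
    and eq: "\<And>f. f \<in> borel_measurable (gauss m) \<Longrightarrow> (\<integral>\<^sup>+x. f (T x) \<partial>gauss m) = (\<integral>\<^sup>+x. f x \<partial>gauss m)"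
  shows "gauss_invariant m T"
  unfolding gauss_invariant_def
proof (intro conjI T measure_eqI)
  fix A assume "A \<in> sets (distr (gauss m) (gauss m) T)"
  then have A: "A \<in> sets (gauss m)" by simp
  have "emeasure (distr (gauss m) (gauss m) T) A = (\<integral>\<^sup>+x. indicator A x \<partial>distr (gauss m) (gauss m) T)"
    using A by simp
  also have "\<dots> = (\<integral>\<^sup>+x. indicator A (T x) \<partial>gauss m)"
    using A by (intro nn_integral_distr T) simp
  also have "\<dots> = (\<integral>\<^sup>+x. indicator A x \<partial>gauss m)" using A by (intro eq) simp
  finally show "emeasure (distr (gauss m) (gauss m) T) A = emeasure (gauss m) A" using A by simp
qed simp

definition givens :: "nat \<Rightarrow> nat \<Rightarrow> real \<Rightarrow> real \<Rightarrow> (nat \<Rightarrow> real) \<Rightarrow> nat \<Rightarrow> real" where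
  "givens i j c s x = x(i := c * x i - s * x j, j := s * x i + c * x j)"

lemma measurable_givens [measurable]:
  assumes "i < m" "j < m"
  shows "givens i j c s \<in> measurable (gauss m) (gauss m)"
proof (rule measurable_PiM_single')
  fix l assume "l \<in> {..<m}"
  have [measurable]: "(\<lambda>x. x k) \<in> borel_measurable (gauss m)" if "k < m" for k
    using measurable_component_singleton[of k "{..<m}" "\<lambda>_. std_gaussian"] that by simp
  show "(\<lambda>x. givens i j c s x l) \<in> measurable (gauss m) std_gaussian"
    using assms \<open>l \<in> {..<m}\<close>
    by (cases "l = j"; cases "l = i") (simp_all add: givens_def measurable_cong_sets[OF refl sets_std_gaussian])
next
  show "givens i j c s \<in> space (gauss m) \<rightarrow> (\<Pi>\<^sub>E i\<in>{..<m}. space std_gaussian)"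
    using assms by (auto simp: givens_def space_PiM PiE_def extensional_def)
qed

text \<open>Fubini moves the coordinates \<open>i\<close> and \<open>j\<close> innermost; with all
  others frozen, only the planar rotation is left.\<close>

lemma givens_gauss_invariant:
  assumes "i < m" "j < m" "i \<noteq> j" and cs: "c\<^sup>2 + s\<^sup>2 = 1"
  shows "gauss_invariant m (givens i j c s)"
proof (rule gauss_invariantI)
  show G: "givens i j c s \<in> measurable (gauss m) (gauss m)" using assms by simp
  fix f :: "(nat \<Rightarrow> real) \<Rightarrow> ennreal" assume f: "f \<in> borel_measurable (gauss m)"
  define K where "K = {..<m} - {i, j}"
  have m: "{..<m} = insert i (insert j K)" using assms by (auto simp: K_def)
  have fin: "finite K" "finite (insert j K)" "i \<notin> insert j K" "j \<notin> K" using assms by (auto simp: K_def)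
  have expand: "(\<integral>\<^sup>+x. g x \<partial>gauss m) =
      (\<integral>\<^sup>+z. \<integral>\<^sup>+y. \<integral>\<^sup>+x. g (z(j := y, i := x)) \<partial>std_gaussian \<partial>std_gaussian \<partial>PiM K (\<lambda>_. std_gaussian))"
    if g: "g \<in> borel_measurable (gauss m)" for g :: "(nat \<Rightarrow> real) \<Rightarrow> ennreal"
  proof -
    note [measurable] = g[unfolded m]
    have "(\<integral>\<^sup>+x. g x \<partial>gauss m) =
      (\<integral>\<^sup>+z. \<integral>\<^sup>+x. g (z(i := x)) \<partial>std_gaussian \<partial>PiM (insert j K) (\<lambda>_. std_gaussian))"
      unfolding m by (rule std_gaussian_prod.product_nn_integral_insert) (use fin in simp_all)
    also have "\<dots> = (\<integral>\<^sup>+z. \<integral>\<^sup>+y. \<integral>\<^sup>+x. g (z(j := y, i := x)) \<partial>std_gaussian \<partial>std_gaussian \<partial>PiM K (\<lambda>_. std_gaussian))"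
      using fin by (subst std_gaussian_prod.product_nn_integral_insert) simp_all
    finally show ?thesis .
  qed
  have "(\<integral>\<^sup>+x. f (givens i j c s x) \<partial>gauss m) =
    (\<integral>\<^sup>+z. \<integral>\<^sup>+y. \<integral>\<^sup>+x. f (givens i j c s (z(j := y, i := x))) \<partial>std_gaussian \<partial>std_gaussian \<partial>PiM K (\<lambda>_. std_gaussian))"
    by (rule expand) (use f G in \<open>rule measurable_compose[rotated]\<close>)
  also have "\<dots> = (\<integral>\<^sup>+z. \<integral>\<^sup>+y. \<integral>\<^sup>+x. f (z(j := y, i := x)) \<partial>std_gaussian \<partial>std_gaussian \<partial>PiM K (\<lambda>_. std_gaussian))"
  proof (rule nn_integral_cong)
    fix z assume z: "z \<in> space (PiM K (\<lambda>_. std_gaussian))"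
    have "(\<lambda>(x, y). z(j := y, i := x)) \<in> measurable (borel \<Otimes>\<^sub>M borel) (gauss m)"
    proof (rule measurable_PiM_single')
      fix l assume "l \<in> {..<m}"
      show "(\<lambda>p. (case p of (x, y) \<Rightarrow> z(j := y, i := x)) l) \<in> measurable (borel \<Otimes>\<^sub>M borel) std_gaussian"
        by (cases "l = i"; cases "l = j") (simp_all add: split_beta measurable_cong_sets[OF refl sets_std_gaussian])
    qed (use z assms in \<open>auto simp: space_PiM PiE_def extensional_def m\<close>)
    then have "case_prod (\<lambda>x y. f (z(j := y, i := x))) \<in> borel_measurable (borel \<Otimes>\<^sub>M borel)"
      by (rule measurable_compose[OF _ f, THEN measurable_cong[THEN iffD1, rotated]]) auto
    from std_gaussian_rotation[OF cs this]
    show "(\<integral>\<^sup>+y. \<integral>\<^sup>+x. f (givens i j c s (z(j := y, i := x))) \<partial>std_gaussian \<partial>std_gaussian) =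
      (\<integral>\<^sup>+y. \<integral>\<^sup>+x. f (z(j := y, i := x)) \<partial>std_gaussian \<partial>std_gaussian)"
      using \<open>i \<noteq> j\<close> by (simp add: givens_def fun_upd_twist)
  qed
  also have "\<dots> = (\<integral>\<^sup>+x. f x \<partial>gauss m)" by (rule expand[OF f, symmetric])
  finally show "(\<integral>\<^sup>+x. f (givens i j c s x) \<partial>gauss m) = (\<integral>\<^sup>+x. f x \<partial>gauss m)" .
qed


definition inner_upto :: "nat \<Rightarrow> (nat \<Rightarrow> real) \<Rightarrow> (nat \<Rightarrow> real) \<Rightarrow> real" where
  "inner_upto m u v = (\<Sum>l<m. u l * v l)"

lemma inner_upto_commute: "inner_upto m u v = inner_upto m v u"
  by (simp add: inner_upto_def mult.commute)

lemma inner_upto_cong: "(\<And>l. l < m \<Longrightarrow> u l = u' l) \<Longrightarrow> (\<And>l. l < m \<Longrightarrow> v l = v' l) \<Longrightarrow>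
    inner_upto m u v = inner_upto m u' v'"
  by (simp add: inner_upto_def)

lemma inner_upto_diff_left: "inner_upto m (\<lambda>l. u l - t * v l) w = inner_upto m u w - t * inner_upto m v w"
  by (simp add: inner_upto_def sum_subtractf sum_distrib_left left_diff_distrib mult.assoc)

lemma inner_upto_diff_right: "inner_upto m w (\<lambda>l. u l - t * v l) = inner_upto m w u - t * inner_upto m w v"
  using inner_upto_diff_left by (simp add: inner_upto_commute)

lemma inner_upto_self_eq_0: "inner_upto m v v = 0 \<longleftrightarrow> (\<forall>l<m. v l = 0)"
  unfolding inner_upto_def by (subst sum_nonneg_eq_0_iff) auto

lemma inner_upto_givens:
  assumes "i < m" "j < m" "i \<noteq> j" and cs: "c\<^sup>2 + s\<^sup>2 = 1"
  shows "inner_upto m (givens i j c s u) (givens i j c s v) = inner_upto m u v"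
proof -
  have split: "sum f {..<m} = f i + f j + sum f ({..<m} - {i, j})" for f :: "nat \<Rightarrow> real"
  proof -
    have "{..<m} - {i} - {j} = {..<m} - {i, j}" by auto
    then show ?thesis using assms sum.remove[of "{..<m}" i f] sum.remove[of "{..<m} - {i}" j f] by simp
  qed
  have "(c * u i - s * u j) * (c * v i - s * v j) + (s * u i + c * u j) * (s * v i + c * v j) =
    (c\<^sup>2 + s\<^sup>2) * (u i * v i + u j * v j)"
    by (simp add: power2_eq_square algebra_simps)
  then show ?thesis
    using assms by (simp add: inner_upto_def split givens_def)
qed

text \<open>The Householder reflection along \<open>v\<close>. For \<open>v = 0\<close> division by
  zero makes it the identity on the first \<open>m\<close> coordinates; the restriction keeps the
  result in the space of the product measure.\<close>

definition reflect :: "nat \<Rightarrow> (nat \<Rightarrow> real) \<Rightarrow> (nat \<Rightarrow> real) \<Rightarrow> nat \<Rightarrow> real" where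
  "reflect m v x = (\<lambda>l\<in>{..<m}. x l - 2 * inner_upto m v x / inner_upto m v v * v l)"

lemma gauss_invariant_id: "gauss_invariant m (\<lambda>x. x)"
  by (simp add: gauss_invariant_def distr_id)

lemma negate_gauss_invariant:
  assumes "0 < m"
  shows "gauss_invariant m (\<lambda>x. x(0 := - x 0))"
proof (rule gauss_invariantI)
  have [measurable]: "(\<lambda>x. x k) \<in> borel_measurable (gauss m)" if "k < m" for k
    using measurable_component_singleton[of k "{..<m}" "\<lambda>_. std_gaussian"] that by simp
  show T: "(\<lambda>x. x(0 := - x 0)) \<in> measurable (gauss m) (gauss m)"
  proof (rule measurable_PiM_single')
    fix l assume "l \<in> {..<m}"
    then show "(\<lambda>x. (x(0 := - x 0)) l) \<in> measurable (gauss m) std_gaussian"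
      using assms by (cases "l = 0") (simp_all add: measurable_cong_sets[OF refl sets_std_gaussian])
  qed (use assms in \<open>auto simp: space_PiM PiE_def extensional_def\<close>)
  fix f :: "(nat \<Rightarrow> real) \<Rightarrow> ennreal" assume f: "f \<in> borel_measurable (gauss m)"
  have m: "{..<m} = insert 0 {1..<m}" using assms by auto
  have expand: "(\<integral>\<^sup>+x. g x \<partial>gauss m) = (\<integral>\<^sup>+z. \<integral>\<^sup>+x. g (z(0 := x)) \<partial>std_gaussian \<partial>PiM {1..<m} (\<lambda>_. std_gaussian))"
    if g: "g \<in> borel_measurable (gauss m)" for g :: "(nat \<Rightarrow> real) \<Rightarrow> ennreal"
    unfolding m using g[unfolded m] by (intro std_gaussian_prod.product_nn_integral_insert) simp_all
  have "(\<integral>\<^sup>+x. f (x(0 := - x 0)) \<partial>gauss m) =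
      (\<integral>\<^sup>+z. \<integral>\<^sup>+x. f (z(0 := - x)) \<partial>std_gaussian \<partial>PiM {1..<m} (\<lambda>_. std_gaussian))"
    using expand[OF measurable_compose[OF T f]] by simp
  also have "\<dots> = (\<integral>\<^sup>+z. \<integral>\<^sup>+x. f (z(0 := x)) \<partial>std_gaussian \<partial>PiM {1..<m} (\<lambda>_. std_gaussian))"
  proof (rule nn_integral_cong)
    fix z assume z: "z \<in> space (PiM {1..<m} (\<lambda>_. std_gaussian))"
    have "(\<lambda>x. z(0 := x)) \<in> measurable borel (gauss m)"
    proof (rule measurable_PiM_single')
      fix l assume "l \<in> {..<m}"
      show "(\<lambda>x. (z(0 := x)) l) \<in> measurable borel std_gaussian"
        by (cases "l = 0") (simp_all add: measurable_cong_sets[OF refl sets_std_gaussian])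
    qed (use z assms in \<open>auto simp: space_PiM PiE_def extensional_def\<close>)
    from measurable_compose[OF this f]
    have [measurable]: "(\<lambda>x. f (z(0 := x))) \<in> borel_measurable borel" .
    have "(\<integral>\<^sup>+x. f (z(0 := - x)) \<partial>std_gaussian) =
      (\<integral>\<^sup>+x. ennreal (std_normal_density x) * f (z(0 := - x)) \<partial>lborel)"
      by (rule nn_integral_std_gaussian) measurable
    also have "\<dots> = (\<integral>\<^sup>+x. ennreal (std_normal_density x) * f (z(0 := x)) \<partial>lborel)"
      by (subst nn_integral_real_affine[where c = "-1" and t = 0]) (simp_all add: normal_density_def)
    also have "\<dots> = (\<integral>\<^sup>+x. f (z(0 := x)) \<partial>std_gaussian)"
      by (rule nn_integral_std_gaussian[symmetric]) measurable
    finally show "(\<integral>\<^sup>+x. f (z(0 := - x)) \<partial>std_gaussian) = (\<integral>\<^sup>+x. f (z(0 := x)) \<partial>std_gaussian)" .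
  qed
  also have "\<dots> = (\<integral>\<^sup>+x. f x \<partial>gauss m)" by (rule expand[OF f, symmetric])
  finally show "(\<integral>\<^sup>+x. f (x(0 := - x 0)) \<partial>gauss m) = (\<integral>\<^sup>+x. f x \<partial>gauss m)" .
qed

text \<open>Induction on the last index at which \<open>v\<close> may be nonzero. A rotation of the
  plane of \<open>r\<close> and \<open>Suc r\<close> shortens the support of \<open>v\<close>, and
  conjugating with it turns the reflection along the rotated vector into the one along
  \<open>v\<close>. At the end a sign change of one coordinate remains.\<close>

lemma reflect_gauss_invariant_aux:
  assumes "r < m" "\<And>l. r < l \<Longrightarrow> v l = 0"
  shows "gauss_invariant m (reflect m v)"
  using assms
proof (induction r arbitrary: v)
  case 0
  have ip: "inner_upto m v x = v 0 * x 0" for x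
  proof -
    have "inner_upto m v x = (\<Sum>l\<in>{0}. v l * x l)"
      unfolding inner_upto_def using 0 by (intro sum.mono_neutral_right) auto
    then show ?thesis by simp
  qed
  show ?case
  proof (cases "v 0 = 0")
    case True
    show ?thesis
      by (rule gauss_invariant_cong[OF gauss_invariant_id])
        (auto simp: reflect_def ip True space_PiM PiE_def extensional_def)
  next
    case False
    show ?thesis
    proof (rule gauss_invariant_cong[OF negate_gauss_invariant[OF \<open>0 < m\<close>]])
      fix x assume "x \<in> space (gauss m)"
      then show "x(0 := - x 0) = reflect m v x"
        using False 0 by (intro ext) (auto simp: reflect_def ip space_PiM PiE_def extensional_def)
    qed
  qed
next
  case (Suc r)
  show ?case
  proof (cases "v (Suc r) = 0")
    case True
    then have "v l = 0" if "r < l" for l using Suc.prems(2)[of l] that by (cases "l = Suc r") auto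
    then show ?thesis using Suc.IH Suc.prems by simp
  next
    case False
    define R where "R = sqrt ((v r)\<^sup>2 + (v (Suc r))\<^sup>2)"
    have R2: "R\<^sup>2 = (v r)\<^sup>2 + (v (Suc r))\<^sup>2" by (simp add: R_def)
    have R0: "R \<noteq> 0" using R2 False by (auto simp: sum_power2_eq_zero_iff)
    \<comment> \<open>The angle for which \<open>s * v r + c * v (Suc r) = 0\<close>, so that entry
      \<open>Suc r\<close> of the rotated vector vanishes.\<close>
    define c s where "c = v r / R" and "s = - v (Suc r) / R"
    have cs: "c\<^sup>2 + s\<^sup>2 = 1" "c\<^sup>2 + (- s)\<^sup>2 = 1"
      using R0 by (simp_all add: c_def s_def power_divide add_divide_distrib[symmetric] R2[symmetric])
    let ?G = "givens r (Suc r) c s" and ?G' = "givens r (Suc r) c (- s)"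
    have inv: "?G' (?G x) = x" for x
    proof
      fix l
      have "c * (c * a - s * b) + s * (s * a + c * b) = (c\<^sup>2 + s\<^sup>2) * a"
        "c * (s * a + c * b) - s * (c * a - s * b) = (c\<^sup>2 + s\<^sup>2) * b" for a b
        by (simp_all add: power2_eq_square algebra_simps)
      then show "?G' (?G x) l = x l" using cs by (simp add: givens_def)
    qed
    have "?G v l = 0" if "r < l" for l
      using that Suc.prems(2)[of l] by (cases "l = Suc r") (auto simp: givens_def c_def s_def)
    then have H: "gauss_invariant m (reflect m (?G v))" using Suc.IH Suc.prems by simp
    have G: "gauss_invariant m ?G" "gauss_invariant m ?G'"
      using Suc.prems cs by (auto intro!: givens_gauss_invariant)
    have ip: "inner_upto m (?G u) (?G w) = inner_upto m u w" for u w
      using Suc.prems cs by (intro inner_upto_givens) auto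
    show ?thesis
    proof (rule gauss_invariant_cong[OF gauss_invariant_comp[OF G(2) gauss_invariant_comp[OF H G(1)]]])
      fix x assume "x \<in> space (gauss m)"
      define t where "t = 2 * inner_upto m v x / inner_upto m v v"
      have R: "reflect m (?G v) (?G x) = restrict (\<lambda>l. ?G x l - t * ?G v l) {..<m}"
        by (simp add: reflect_def ip t_def)
      \<comment> \<open>Both rotated coordinates lie below \<open>m\<close>, so restriction and
        rotation commute; linearity then brings the inverse rotation inside the difference.\<close>
      have "givens r (Suc r) c s' (restrict y {..<m}) l = (if l < m then givens r (Suc r) c s' y l else undefined)" for s' y l
        using Suc.prems by (simp add: givens_def)
      then have "?G' (reflect m (?G v) (?G x)) l = (if l < m then ?G' (\<lambda>l. ?G x l - t * ?G v l) l else undefined)" for l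
        unfolding R by blast
      moreover have "givens r (Suc r) c s' (\<lambda>l. y l - t * z l) l = givens r (Suc r) c s' y l - t * givens r (Suc r) c s' z l" for y z s' l
        by (simp add: givens_def algebra_simps)
      ultimately show "?G' (reflect m (?G v) (?G x)) = reflect m v x"
        by (simp add: inv reflect_def t_def fun_eq_iff)
    qed
  qed
qed

lemma reflect_gauss_invariant: "gauss_invariant m (reflect m v)"
proof (cases m)
  case 0
  show ?thesis
    by (rule gauss_invariant_cong[OF gauss_invariant_id]) (auto simp: 0 reflect_def space_PiM)
next
  case (Suc r)
  have "gauss_invariant m (reflect m (\<lambda>l. if l < m then v l else 0))"
    by (rule reflect_gauss_invariant_aux[of r]) (auto simp: Suc)
  moreover have "reflect m (\<lambda>l. if l < m then v l else 0) = reflect m v"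
    unfolding reflect_def
    by (intro ext restrict_ext) (simp add: inner_upto_def)
  ultimately show ?thesis by simp
qed

lemma inner_upto_reflect: "inner_upto m (reflect m v u) w = inner_upto m u (reflect m v w)"
proof -
  have "inner_upto m (reflect m v u) w = inner_upto m u w - 2 * inner_upto m v u / inner_upto m v v * inner_upto m v w" for u w
    unfolding inner_upto_diff_left[symmetric] by (rule inner_upto_cong) (simp_all add: reflect_def)
  from this[of u w] this[of w u] show ?thesis by (simp add: inner_upto_commute algebra_simps)
qed

lemma reflect_reflect:
  assumes "l < m"
  shows "reflect m v (reflect m v u) l = u l"
proof (cases "inner_upto m v v = 0")
  case True
  then show ?thesis using assms by (simp add: reflect_def)
next
  case False
  have "inner_upto m v (reflect m v u) = - inner_upto m v u"
  proof -
    have "inner_upto m v (reflect m v u) = inner_upto m v u - 2 * inner_upto m v u / inner_upto m v v * inner_upto m v v"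
      unfolding inner_upto_diff_right[symmetric] by (rule inner_upto_cong) (simp_all add: reflect_def)
    then show ?thesis using False by simp
  qed
  then show ?thesis using assms by (simp add: reflect_def)
qed

lemma inner_upto_reflect_reflect: "inner_upto m (reflect m v u) (reflect m v w) = inner_upto m u w"
  unfolding inner_upto_reflect by (simp add: inner_upto_def reflect_reflect)

section \<open>Linear images and Gram matrices\<close>

definition linear_image :: "nat \<Rightarrow> nat \<Rightarrow> (nat \<Rightarrow> nat \<Rightarrow> real) \<Rightarrow> (nat \<Rightarrow> real) \<Rightarrow> nat \<Rightarrow> real" where
  "linear_image N m B g = (\<lambda>i\<in>{..<N}. \<Sum>l<m. B i l * g l)"

lemma measurable_linear_image [measurable]:
  "linear_image N m B \<in> measurable (gauss m) (PiM {..<N} (\<lambda>_. borel))"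
proof -
  have [measurable]: "(\<lambda>x. x k) \<in> borel_measurable (gauss m)" if "k \<in> {..<m}" for k
    using measurable_component_singleton[of k "{..<m}" "\<lambda>_. std_gaussian"] that by simp
  show ?thesis unfolding linear_image_def[abs_def] by measurable
qed

text \<open>A reflection that moves one row of \<open>B\<close> to the corresponding row of \<open>B'\<close> fixes all rows on which
  the two matrices already agree, since the Gram matrices coincide.\<close>

lemma distr_linear_image_eq_aux:
  assumes "r \<le> N"
    and "\<And>i j. i < N \<Longrightarrow> j < N \<Longrightarrow> inner_upto m (B i) (B j) = inner_upto m (B' i) (B' j)"
    and "\<And>i l. i < r \<Longrightarrow> l < m \<Longrightarrow> B i l = B' i l"
  shows "distr (gauss m) (PiM {..<N} (\<lambda>_. borel)) (linear_image N m B) =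
    distr (gauss m) (PiM {..<N} (\<lambda>_. borel)) (linear_image N m B')"
  using assms
proof (induction r arbitrary: B rule: inc_induct)
  case base
  then have "linear_image N m B = linear_image N m B'"
    by (auto simp: linear_image_def fun_eq_iff restrict_def)
  then show ?case by simp
next
  case (step r)
  define v where "v l = B r l - B' r l" for l
  define B2 where "B2 i = reflect m v (B i)" for i
  have ipv: "inner_upto m v w = inner_upto m (B r) w - inner_upto m (B' r) w" for w
    using inner_upto_diff_left[of m "B r" 1 "B' r" w] by (simp add: v_def[abs_def])
  have cong: "inner_upto m u w = inner_upto m u' w" if "\<And>l. l < m \<Longrightarrow> u l = u' l" for u u' w
    using that by (simp add: inner_upto_def)
  \<comment> \<open>The rows \<open>B r\<close> and \<open>B' r\<close> have equal norm and differ
    by \<open>v\<close>. Hence the coefficient of \<open>v\<close> in the reflection of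
    \<open>B r\<close> is 1, and the image is \<open>B r - v\<close>, which is
    \<open>B' r\<close>.\<close>
  have vv: "inner_upto m v v = 2 * inner_upto m v (B r)"
  proof -
    have "inner_upto m v v = inner_upto m v (B r) - inner_upto m v (B' r)"
      using inner_upto_diff_right[of m v "B r" 1 "B' r"] by (simp add: v_def[abs_def])
    also have "inner_upto m v (B' r) = - inner_upto m v (B r)"
      using step.prems(1)[of r r] step.hyps by (simp add: ipv inner_upto_commute)
    finally show ?thesis by simp
  qed
  have row_r: "B2 r l = B' r l" if "l < m" for l
  proof (cases "inner_upto m v v = 0")
    case True
    then show ?thesis using that vv by (simp add: B2_def reflect_def inner_upto_self_eq_0 v_def)
  next
    case False
    then show ?thesis using that vv by (simp add: B2_def reflect_def v_def)
  qed
  have row_i: "B2 i l = B' i l" if "i < r" "l < m" for i l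
  proof -
    have "inner_upto m v (B i) = inner_upto m (B r) (B i) - inner_upto m (B' r) (B' i)"
      using cong[of "B i" "B' i" "B' r"] step.prems(2) that by (simp add: ipv inner_upto_commute)
    then have "inner_upto m v (B i) = 0" using step.prems(1)[of r i] step.hyps that by simp
    then show ?thesis using step.prems(2) that by (simp add: B2_def reflect_def)
  qed
  have "distr (gauss m) (PiM {..<N} (\<lambda>_. borel)) (linear_image N m B2) =
    distr (gauss m) (PiM {..<N} (\<lambda>_. borel)) (linear_image N m B')"
  proof (rule step.IH)
    show "inner_upto m (B2 i) (B2 j) = inner_upto m (B' i) (B' j)" if "i < N" "j < N" for i j
      using step.prems(1)[OF that] by (simp add: B2_def inner_upto_reflect_reflect)
    show "B2 i l = B' i l" if "i < Suc r" "l < m" for i l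
      using row_r row_i that by (cases "i = r") auto
  qed
  moreover have "distr (gauss m) (PiM {..<N} (\<lambda>_. borel)) (linear_image N m B2) =
    distr (gauss m) (PiM {..<N} (\<lambda>_. borel)) (linear_image N m B)"
  proof -
    have inv: "reflect m v \<in> measurable (gauss m) (gauss m)" "distr (gauss m) (gauss m) (reflect m v) = gauss m"
      using reflect_gauss_invariant[of m v] by (simp_all add: gauss_invariant_def)
    \<comment> \<open>Self-adjointness moves the reflection from the rows to the Gaussian vector,
      where invariance absorbs it.\<close>
    have "linear_image N m B2 = linear_image N m B \<circ> reflect m v"
      using inner_upto_reflect[of m v] by (simp add: linear_image_def B2_def inner_upto_def fun_eq_iff restrict_def)
    then have "distr (gauss m) (PiM {..<N} (\<lambda>_. borel)) (linear_image N m B2) =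
      distr (distr (gauss m) (gauss m) (reflect m v)) (PiM {..<N} (\<lambda>_. borel)) (linear_image N m B)"
      using distr_distr[OF measurable_linear_image inv(1)] by simp
    then show ?thesis using inv by simp
  qed
  ultimately show ?case by simp
qed

lemma distr_linear_image_eq:
  assumes "\<And>i j. i < N \<Longrightarrow> j < N \<Longrightarrow> inner_upto m (B i) (B j) = inner_upto m (B' i) (B' j)"
  shows "distr (gauss m) (PiM {..<N} (\<lambda>_. borel)) (linear_image N m B) =
    distr (gauss m) (PiM {..<N} (\<lambda>_. borel)) (linear_image N m B')"
  by (rule distr_linear_image_eq_aux[of 0]) (use assms in auto)

section \<open>Laws of the transformed samples\<close>

lemma measure_eqI_nn_integral:
  assumes "sets M = sets N"
    and "\<And>f. f \<in> borel_measurable N \<Longrightarrow> (\<integral>\<^sup>+x. f x \<partial>M) = (\<integral>\<^sup>+x. f x \<partial>N)"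
  shows "M = N"
proof (rule measure_eqI)
  fix A assume "A \<in> sets M"
  then show "emeasure M A = emeasure N A"
    using assms(2)[of "indicator A"] by (simp add: assms(1))
qed fact

text \<open>Unzips i.i.d. pairs into two independent families. It is needed because the law identity
  concerns a sample together with its draw, whereas the program receives all samples on one side and
  the tape on the other.\<close>

lemma nn_integral_PiM_pair:
  fixes I :: "'i set" and X :: "'a measure" and Y :: "'b measure"
  assumes "finite I" and X: "prob_space X" and Y: "prob_space Y"
    and "F \<in> borel_measurable (PiM I (\<lambda>_. X \<Otimes>\<^sub>M Y))"
  shows "(\<integral>\<^sup>+h. F h \<partial>PiM I (\<lambda>_. X \<Otimes>\<^sub>M Y)) =
    (\<integral>\<^sup>+f. \<integral>\<^sup>+g. F (\<lambda>i\<in>I. (f i, g i)) \<partial>PiM I (\<lambda>_. Y) \<partial>PiM I (\<lambda>_. X))"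
  using assms(1,4)
proof (induction I arbitrary: F rule: finite_induct)
  case empty
  show ?case by (simp add: PiM_empty nn_integral_count_space_finite restrict_def)
next
  case (insert i K)
  interpret Xp: prob_space X by (rule X)
  interpret Yp: prob_space Y by (rule Y)
  interpret XY: pair_prob_space X Y ..
  interpret X: product_prob_space "\<lambda>_. X" I for I :: "'i set" ..
  interpret Y: product_prob_space "\<lambda>_. Y" I for I :: "'i set" ..
  interpret XYp: product_prob_space "\<lambda>_. X \<Otimes>\<^sub>M Y" I for I :: "'i set" ..
  interpret Yi: prob_space "PiM K (\<lambda>_. Y)" by (rule prob_space_PiM) (rule Y)
  interpret P: pair_sigma_finite X "PiM K (\<lambda>_. Y)" ..
  note F [measurable] = insert.prems
  have upd [measurable]: "(\<lambda>(h, p). h(i := p)) \<in> measurable (PiM K (\<lambda>_. X \<Otimes>\<^sub>M Y) \<Otimes>\<^sub>M (X \<Otimes>\<^sub>M Y)) (PiM (insert i K) (\<lambda>_. X \<Otimes>\<^sub>M Y))"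
    by (rule measurable_add_dim)
  have F1 [measurable]: "(\<lambda>(h, a, b). F (h(i := (a, b)))) \<in> borel_measurable (PiM K (\<lambda>_. X \<Otimes>\<^sub>M Y) \<Otimes>\<^sub>M (X \<Otimes>\<^sub>M Y))"
    using measurable_compose[OF upd F] by (simp add: split_beta)
  have zip [measurable]: "(\<lambda>(f, g). \<lambda>j\<in>K. (f j, g j)) \<in> measurable (PiM K (\<lambda>_. X) \<Otimes>\<^sub>M PiM K (\<lambda>_. Y)) (PiM K (\<lambda>_. X \<Otimes>\<^sub>M Y))"
    by measurable
  have H [measurable]: "(\<lambda>(f, a, g, b). F ((\<lambda>j\<in>K. (f j, g j))(i := (a, b)))) \<in>
    borel_measurable (PiM K (\<lambda>_. X) \<Otimes>\<^sub>M X \<Otimes>\<^sub>M PiM K (\<lambda>_. Y) \<Otimes>\<^sub>M Y)"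
    using measurable_compose[OF _ F1, of "\<lambda>(f, a, g, b). (\<lambda>j\<in>K. (f j, g j), a, b)"] by (simp add: split_beta)
  have "(\<integral>\<^sup>+h. F h \<partial>PiM (insert i K) (\<lambda>_. X \<Otimes>\<^sub>M Y)) =
    (\<integral>\<^sup>+h. \<integral>\<^sup>+p. F (h(i := p)) \<partial>(X \<Otimes>\<^sub>M Y) \<partial>PiM K (\<lambda>_. X \<Otimes>\<^sub>M Y))"
    using insert by (intro XYp.product_nn_integral_insert) auto
  also have "\<dots> = (\<integral>\<^sup>+h. \<integral>\<^sup>+a. \<integral>\<^sup>+b. F (h(i := (a, b))) \<partial>Y \<partial>X \<partial>PiM K (\<lambda>_. X \<Otimes>\<^sub>M Y))"
  proof (rule nn_integral_cong)
    fix h assume "h \<in> space (PiM K (\<lambda>_. X \<Otimes>\<^sub>M Y))"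
    then have "(\<lambda>p. F (h(i := p))) \<in> borel_measurable (X \<Otimes>\<^sub>M Y)"
      using measurable_compose[OF measurable_compose[OF measurable_Pair1' upd] F] by simp
    from Yp.nn_integral_fst[OF this, symmetric]
    show "(\<integral>\<^sup>+p. F (h(i := p)) \<partial>(X \<Otimes>\<^sub>M Y)) = (\<integral>\<^sup>+a. \<integral>\<^sup>+b. F (h(i := (a, b))) \<partial>Y \<partial>X)" .
  qed
  also have "\<dots> = (\<integral>\<^sup>+f. \<integral>\<^sup>+g. \<integral>\<^sup>+a. \<integral>\<^sup>+b. F ((\<lambda>j\<in>K. (f j, g j))(i := (a, b))) \<partial>Y \<partial>X \<partial>PiM K (\<lambda>_. Y) \<partial>PiM K (\<lambda>_. X))"
    by (rule insert.IH) measurable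
  \<comment> \<open>The one exchange of integrals: the new first component \<open>a\<close> has to
    pass the old second components \<open>g\<close>, so that each family can be completed to
    \<open>insert i K\<close>.\<close>
  also have "\<dots> = (\<integral>\<^sup>+f. \<integral>\<^sup>+a. \<integral>\<^sup>+g. \<integral>\<^sup>+b. F ((\<lambda>j\<in>K. (f j, g j))(i := (a, b))) \<partial>Y \<partial>PiM K (\<lambda>_. Y) \<partial>X \<partial>PiM K (\<lambda>_. X))"
    by (intro nn_integral_cong P.Fubini') measurable
  also have "\<dots> = (\<integral>\<^sup>+f. \<integral>\<^sup>+a. \<integral>\<^sup>+g. F (\<lambda>j\<in>insert i K. ((f(i := a)) j, g j)) \<partial>PiM (insert i K) (\<lambda>_. Y) \<partial>X \<partial>PiM K (\<lambda>_. X))"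
  proof (intro nn_integral_cong)
    fix f a assume f: "f \<in> space (PiM K (\<lambda>_. X))" and a: "a \<in> space X"
    have eq: "(\<lambda>j\<in>insert i K. ((f(i := a)) j, (g(i := b)) j)) = (\<lambda>j\<in>K. (f j, g j))(i := (a, b))" for g b
      using insert.hyps by (auto simp: fun_eq_iff)
    have meas: "(\<lambda>g. F (\<lambda>j\<in>insert i K. ((f(i := a)) j, g j))) \<in> borel_measurable (PiM (insert i K) (\<lambda>_. Y))"
    proof -
      have "f(i := a) \<in> space (PiM (insert i K) (\<lambda>_. X))" using f a by (auto simp: space_PiM intro!: PiE_fun_upd)
      then have "(\<lambda>g. \<lambda>j\<in>insert i K. ((f(i := a)) j, g j)) \<in> measurable (PiM (insert i K) (\<lambda>_. Y)) (PiM (insert i K) (\<lambda>_. X \<Otimes>\<^sub>M Y))"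
        by (intro measurable_restrict measurable_Pair measurable_const measurable_component_singleton)
          (use a in \<open>auto simp: space_PiM\<close>)
      from measurable_compose[OF this F] show ?thesis .
    qed
    show "(\<integral>\<^sup>+g. \<integral>\<^sup>+b. F ((\<lambda>j\<in>K. (f j, g j))(i := (a, b))) \<partial>Y \<partial>PiM K (\<lambda>_. Y)) =
      (\<integral>\<^sup>+g. F (\<lambda>j\<in>insert i K. ((f(i := a)) j, g j)) \<partial>PiM (insert i K) (\<lambda>_. Y))"
      by (subst Y.product_nn_integral_insert) (rule insert.hyps meas | simp only: eq)+
  qed
  also have "\<dots> = (\<integral>\<^sup>+f. \<integral>\<^sup>+g. F (\<lambda>j\<in>insert i K. (f j, g j)) \<partial>PiM (insert i K) (\<lambda>_. Y) \<partial>PiM (insert i K) (\<lambda>_. X))"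
  proof (rule X.product_nn_integral_insert[symmetric])
    interpret Yii: prob_space "PiM (insert i K) (\<lambda>_. Y)" by (rule prob_space_PiM) (rule Y)
    show "(\<lambda>f. \<integral>\<^sup>+g. F (\<lambda>j\<in>insert i K. (f j, g j)) \<partial>PiM (insert i K) (\<lambda>_. Y)) \<in> borel_measurable (PiM (insert i K) (\<lambda>_. X))"
      by measurable
  qed (use insert in auto)
  finally show ?case .
qed

text \<open>The first \<open>n\<close> entries of the tape are independent of the rest, and the rest
  is again a fresh tape. This lets the regression program run with honest randomness after the noise
  has been drawn.\<close>

lemma nn_integral_stream_space_sdrop:
  assumes M: "prob_space M" and "F \<in> borel_measurable (PiM {..<n} (\<lambda>_. M) \<Otimes>\<^sub>M stream_space M)"
  shows "(\<integral>\<^sup>+r. F (\<lambda>i\<in>{..<n}. r !! i, sdrop n r) \<partial>stream_space M) =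
    (\<integral>\<^sup>+g. \<integral>\<^sup>+r. F (g, r) \<partial>stream_space M \<partial>PiM {..<n} (\<lambda>_. M))"
  using assms(2)
proof (induction n arbitrary: F)
  case 0
  show ?case by (simp add: PiM_empty nn_integral_count_space_finite restrict_def)
next
  case (Suc n)
  interpret M: prob_space M by (rule M)
  interpret S: prob_space "stream_space M" by (rule M.prob_space_stream_space)
  interpret P: product_prob_space "\<lambda>_. M" I for I :: "nat set" ..
  have ins: "{..<Suc n} = insert n {..<n}" by auto
  note F [measurable] = Suc.prems
  have upd: "(\<lambda>(g, x). g(n := x)) \<in> measurable (PiM {..<n} (\<lambda>_. M) \<Otimes>\<^sub>M M) (PiM {..<Suc n} (\<lambda>_. M))"
    unfolding ins by (rule measurable_add_dim)
  have [measurable]: "(\<lambda>(g, x, r). F (g(n := x), r)) \<in> borel_measurable (PiM {..<n} (\<lambda>_. M) \<Otimes>\<^sub>M M \<Otimes>\<^sub>M stream_space M)"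
    using measurable_compose[OF measurable_Pair[OF measurable_compose[OF _ upd, of "\<lambda>(g, x, r). (g, x)"]] F,
      of "PiM {..<n} (\<lambda>_. M) \<Otimes>\<^sub>M M \<Otimes>\<^sub>M stream_space M" "\<lambda>(g, x, r). r"] by (simp add: split_beta)
  have G [measurable]: "(\<lambda>(g, r). F (g(n := shd r), stl r)) \<in> borel_measurable (PiM {..<n} (\<lambda>_. M) \<Otimes>\<^sub>M stream_space M)"
    using measurable_compose[OF measurable_Pair[OF measurable_compose[OF _ upd, of "\<lambda>(g, r). (g, shd r)"]] F,
      of "PiM {..<n} (\<lambda>_. M) \<Otimes>\<^sub>M stream_space M" "\<lambda>(g, r). stl r"] by (simp add: split_beta)
  \<comment> \<open>Entry \<open>n\<close> is the head of \<open>sdrop n r\<close>, so the induction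
    hypothesis applies to an integrand that first peels this head off the rest.\<close>
  have "(\<lambda>i\<in>{..<Suc n}. r !! i) = (\<lambda>i\<in>{..<n}. r !! i)(n := shd (sdrop n r))"
    for r :: "'a stream"
    by (auto simp: fun_eq_iff sdrop_simps)
  moreover have "sdrop (Suc n) r = stl (sdrop n r)" for r :: "'a stream"
    by (simp only: sdrop.simps sdrop_stl)
  ultimately have "(\<integral>\<^sup>+r. F (\<lambda>i\<in>{..<Suc n}. r !! i, sdrop (Suc n) r) \<partial>stream_space M) =
    (\<integral>\<^sup>+r. F ((\<lambda>i\<in>{..<n}. r !! i)(n := shd (sdrop n r)), stl (sdrop n r)) \<partial>stream_space M)"
    by (simp only:)
  also have "\<dots> = (\<integral>\<^sup>+g. \<integral>\<^sup>+r. F (g(n := shd r), stl r) \<partial>stream_space M \<partial>PiM {..<n} (\<lambda>_. M))"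
    using Suc.IH[OF G] by (simp only: split_conv)
  also have "\<dots> = (\<integral>\<^sup>+g. \<integral>\<^sup>+x. \<integral>\<^sup>+r. F (g(n := x), r) \<partial>stream_space M \<partial>M \<partial>PiM {..<n} (\<lambda>_. M))"
    by (rule nn_integral_cong, subst M.nn_integral_stream_space) simp_all
  also have "\<dots> = (\<integral>\<^sup>+g. \<integral>\<^sup>+r. F (g, r) \<partial>stream_space M \<partial>PiM {..<Suc n} (\<lambda>_. M))"
    unfolding ins using F[unfolded ins] by (subst P.product_nn_integral_insert) (simp_all, measurable)
  finally show ?case .
qed

lemma measurable_gauss_Suc:
  assumes f: "f \<in> measurable (gauss m) N"
  shows "(\<lambda>g. (f (restrict g {..<m}), g m)) \<in> measurable (gauss (Suc m)) (N \<Otimes>\<^sub>M borel)"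
proof (rule measurable_Pair)
  show "(\<lambda>g. f (restrict g {..<m})) \<in> measurable (gauss (Suc m)) N"
    by (rule measurable_compose[OF measurable_restrict_subset f]) auto
  show "(\<lambda>g. g m) \<in> borel_measurable (gauss (Suc m))"
    using measurable_component_singleton[of m "{..<Suc m}" "\<lambda>_. std_gaussian"] by simp
qed

text \<open>An independent Gaussian is one more coordinate of a standard vector. Used repeatedly,
  this writes every law in play as a linear image of a single \<open>gauss\<close>, where only Gram
  matrices matter.\<close>

lemma distr_gauss_Suc:
  fixes N :: "'a measure"
  assumes f: "f \<in> measurable (gauss m) N"
  shows "distr (gauss m) N f \<Otimes>\<^sub>M std_gaussian =
    distr (gauss (Suc m)) (N \<Otimes>\<^sub>M borel) (\<lambda>g. (f (restrict g {..<m}), g m))" (is "?L = ?R")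
proof (rule measure_eqI_nn_integral)
  have ins: "{..<Suc m} = insert m {..<m}" by auto
  interpret G: prob_space "gauss m" by (rule prob_space_PiM) (rule prob_space_std_gaussian)
  note m1 [measurable] = measurable_gauss_Suc[OF f]
  show "sets ?L = sets ?R" by (simp cong: sets_pair_measure_cong)
  fix F :: "'a \<times> real \<Rightarrow> ennreal" assume "F \<in> borel_measurable ?R"
  then have F: "F \<in> borel_measurable (N \<Otimes>\<^sub>M borel)" by simp
  then have F': "F \<in> borel_measurable (distr (gauss m) N f \<Otimes>\<^sub>M std_gaussian)"
    by (simp cong: measurable_cong_sets sets_pair_measure_cong)
  have "(\<integral>\<^sup>+p. F p \<partial>?L) = (\<integral>\<^sup>+a. \<integral>\<^sup>+x. F (a, x) \<partial>std_gaussian \<partial>distr (gauss m) N f)"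
    using std_gaussian.nn_integral_fst[OF F'] by simp
  also have "\<dots> = (\<integral>\<^sup>+g. \<integral>\<^sup>+x. F (f g, x) \<partial>std_gaussian \<partial>gauss m)"
  proof -
    have "F \<in> borel_measurable (N \<Otimes>\<^sub>M std_gaussian)"
      using F by (simp cong: measurable_cong_sets sets_pair_measure_cong)
    then have "(\<lambda>a. \<integral>\<^sup>+x. F (a, x) \<partial>std_gaussian) \<in> borel_measurable N"
      by (rule std_gaussian.borel_measurable_nn_integral_fst)
    then show ?thesis by (intro nn_integral_distr[OF f]) simp
  qed
  also have "\<dots> = (\<integral>\<^sup>+g. \<integral>\<^sup>+x. F (f (restrict (g(m := x)) {..<m}), (g(m := x)) m) \<partial>std_gaussian \<partial>gauss m)"
  proof (rule nn_integral_cong)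
    fix g assume "g \<in> space (gauss m)"
    then have "restrict (g(m := x)) {..<m} = g" for x
      by (auto simp: space_PiM PiE_def extensional_def fun_eq_iff)
    then show "(\<integral>\<^sup>+x. F (f g, x) \<partial>std_gaussian) =
      (\<integral>\<^sup>+x. F (f (restrict (g(m := x)) {..<m}), (g(m := x)) m) \<partial>std_gaussian)" by simp
  qed
  also have "\<dots> = (\<integral>\<^sup>+g. F (f (restrict g {..<m}), g m) \<partial>gauss (Suc m))"
    using measurable_compose[OF m1 F] unfolding ins
    by (subst std_gaussian_prod.product_nn_integral_insert) simp_all
  also have "\<dots> = (\<integral>\<^sup>+p. F p \<partial>?R)" using F by (intro nn_integral_distr[OF m1, symmetric]) simp
  finally show "(\<integral>\<^sup>+p. F p \<partial>?L) = (\<integral>\<^sup>+p. F p \<partial>?R)" .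
qed


section \<open>Roots of covariance matrices\<close>

lemma inner_upto_sum_right:
  "inner_upto m u (\<lambda>l. \<Sum>j<d. b j * V j l) = (\<Sum>j<d. b j * inner_upto m u (V j))"
proof -
  have "inner_upto m u (\<lambda>l. \<Sum>j<d. b j * V j l) = (\<Sum>l<m. \<Sum>j<d. b j * (u l * V j l))"
    by (simp add: inner_upto_def sum_distrib_left algebra_simps)
  also have "\<dots> = (\<Sum>j<d. b j * inner_upto m u (V j))"
    by (subst sum.swap) (simp add: inner_upto_def sum_distrib_left)
  finally show ?thesis .
qed

definition root_of :: "nat \<Rightarrow> (nat \<Rightarrow> nat \<Rightarrow> real) \<Rightarrow> (nat \<Rightarrow> nat \<Rightarrow> real) \<Rightarrow> bool" where
  "root_of d C B \<longleftrightarrow> (\<forall>i<d. \<forall>j<d. inner_upto d (B i) (B j) = C i j)"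

text \<open>The chosen root in the definition and the root at hand have the same Gram matrix, so any
  explicit root may replace the chosen one.\<close>

lemma gaussian_vec_eq_linear_image:
  assumes "root_of d C B"
  shows "gaussian_vec d C = distr (gauss d) (PiM {..<d} (\<lambda>_. borel)) (linear_image d d B)"
proof -
  define B' where "B' = (SOME B. \<forall>i<d. \<forall>j<d. (\<Sum>l<d. B i l * B j l) = C i j)"
  have "\<forall>i<d. \<forall>j<d. (\<Sum>l<d. B' i l * B' j l) = C i j"
    unfolding B'_def by (rule someI[of _ B]) (use assms in \<open>simp add: root_of_def inner_upto_def\<close>)
  then have "distr (gauss d) (PiM {..<d} (\<lambda>_. borel)) (linear_image d d B') =
    distr (gauss d) (PiM {..<d} (\<lambda>_. borel)) (linear_image d d B)"
    using assms by (intro distr_linear_image_eq) (simp add: root_of_def inner_upto_def)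
  then show ?thesis
    unfolding gaussian_vec_def B'_def[symmetric] Let_def linear_image_def[abs_def] by simp
qed

lemma psd_matrix_of_root:
  assumes "root_of d C B"
  shows "psd_matrix d C"
  unfolding psd_matrix_def
proof (intro conjI allI impI)
  fix i j assume "i < d" "j < d"
  then show "C i j = C j i" using assms inner_upto_commute unfolding root_of_def by metis
next
  fix u :: "nat \<Rightarrow> real"
  let ?w = "\<lambda>l. \<Sum>i<d. u i * B i l"
  have "(\<Sum>i<d. \<Sum>j<d. u i * C i j * u j) = (\<Sum>i<d. u i * (\<Sum>j<d. u j * inner_upto d (B i) (B j)))"
    using assms by (simp add: root_of_def sum_distrib_left algebra_simps)
  also have "\<dots> = (\<Sum>i<d. u i * inner_upto d ?w (B i))"
    by (rule sum.cong[OF refl]) (simp add: inner_upto_sum_right[symmetric] inner_upto_commute)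
  also have "\<dots> = inner_upto d ?w ?w" by (rule inner_upto_sum_right[symmetric])
  also have "\<dots> \<ge> 0" by (simp add: inner_upto_def sum_nonneg)
  finally show "0 \<le> (\<Sum>i<d. \<Sum>j<d. u i * C i j * u j)" .
qed

lemma inner_upto_id_cov: "i < d \<Longrightarrow> inner_upto d (id_cov i) w = w i"
proof -
  have "id_cov i l * w l = (if i = l then w l else 0)" for l by (simp add: id_cov_def)
  then show "i < d \<Longrightarrow> ?thesis" by (simp add: inner_upto_def)
qed

text \<open>With \<open>q\<close> the squared norm of \<open>v\<close>, the symmetric matrix
  \<open>Id - c v v^T\<close> has square \<open>Id - (2 * c - c * c * q) v v^T\<close>, so a
  quadratic equation for \<open>c\<close> is all there is to solve.\<close>

lemma ex_root_spiked_cov: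
  assumes "0 \<le> \<theta>" and le1: "\<theta> * inner_upto d v v \<le> 1"
  shows "\<exists>B. root_of d (spiked_cov \<theta> v) B"
proof -
  define t where "t = sqrt (1 - \<theta> * inner_upto d v v)"
  \<comment> \<open>A root of \<open>2 * c - c * c * q = \<theta>\<close>. In the form
    \<open>\<theta> / (1 + t)\<close> it also covers \<open>q = 0\<close>, where
    \<open>(1 - t) / q\<close> would break down; this happens for \<open>k = 0\<close>.\<close>
  define c where "c = \<theta> / (1 + t)"
  define q where "q = inner_upto d v v"
  have t0: "0 \<le> t" and t2: "t * t = 1 - \<theta> * q" using le1 by (simp_all add: t_def q_def)
  have c: "2 * c - c * c * q = \<theta>"
  proof -
    define p where "p = 1 + t"
    have p: "p \<noteq> 0" "c = \<theta> / p" using t0 by (simp_all add: p_def c_def)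
    have "2 * c - c * c * q = \<theta> * (2 * p - \<theta> * q) / (p * p)"
      unfolding p(2) using p(1) by (simp add: field_simps)
    also have "2 * p - \<theta> * q = p * p" using t2 by (simp add: p_def algebra_simps)
    finally show ?thesis using p by simp
  qed
  have id: "inner_upto d (id_cov i) w = w i" "inner_upto d w (id_cov i) = w i" if "i < d" for i w
    using inner_upto_id_cov[OF that] inner_upto_commute[of d w "id_cov i"] by simp_all
  have "inner_upto d (\<lambda>l. id_cov i l - c * v i * v l) (\<lambda>l. id_cov j l - c * v j * v l) = spiked_cov \<theta> v i j"
    if "i < d" "j < d" for i j
  proof -
    have "inner_upto d (\<lambda>l. id_cov i l - c * v i * v l) (\<lambda>l. id_cov j l - c * v j * v l) =
      id_cov i j - (2 * c - c * c * q) * v i * v j"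
      unfolding inner_upto_diff_left inner_upto_diff_right
      using that by (simp add: id q_def[symmetric]) (simp add: id_cov_def algebra_simps)
    then show ?thesis using c by (simp add: spiked_cov_def)
  qed
  then show ?thesis
    by (intro exI[of _ "\<lambda>i l. id_cov i l - c * v i * v l"]) (simp add: root_of_def)
qed

lemma root_of_id_cov: "root_of d id_cov id_cov"
  by (auto simp: root_of_def inner_upto_id_cov id_cov_def[of _ _])


section \<open>Splitting a sample into regression data and an independent remainder\<close>

definition snoc :: "nat \<Rightarrow> (nat \<Rightarrow> real) \<Rightarrow> real \<Rightarrow> nat \<Rightarrow> real" where
  "snoc m u c l = (if l < m then u l else c)"

lemma inner_upto_snoc: "inner_upto (Suc m) (snoc m u c) g = inner_upto m u g + c * g m"
  by (simp add: inner_upto_def snoc_def)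

lemma inner_upto_snoc_snoc: "inner_upto (Suc m) (snoc m u c) (snoc m v c') = inner_upto m u v + c * c'"
  by (simp add: inner_upto_def snoc_def)

lemma inner_upto_zero [simp]: "inner_upto m (\<lambda>_. 0) g = 0" "inner_upto m g (\<lambda>_. 0) = 0"
  by (simp_all add: inner_upto_def)

lemma inner_upto_divide_right: "inner_upto m u (\<lambda>l. v l / s) = inner_upto m u v / s"
  by (simp add: inner_upto_def sum_divide_distrib)

lemma inner_upto_diff_scale_right:
  "inner_upto m w (\<lambda>l. t * u l - v l) = t * inner_upto m w u - inner_upto m w v"
  by (simp add: inner_upto_def sum_subtractf sum_distrib_left algebra_simps)

lemma linear_image_eq_inner_upto: "linear_image N m B g = (\<lambda>i\<in>{..<N}. inner_upto m (B i) g)"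
  by (simp add: linear_image_def inner_upto_def)

lemma inner_upto_restrict: "m \<le> k \<Longrightarrow> inner_upto m u (restrict g {..<k}) = inner_upto m u g"
  by (simp add: inner_upto_def)

text \<open>The last component is what remains of the second response after subtracting its
  prediction from the design (coefficients \<open>b\<close>) and from the first response
  (coefficient \<open>e\<close>), scaled to unit variance. The planted case has \<open>e = 0\<close>
  and \<open>b\<close> the sparse signal, the null case \<open>e = 1 / 3\<close> and
  \<open>b = 0\<close>.\<close>

definition split_sample ::
  "nat \<Rightarrow> real \<Rightarrow> (nat \<Rightarrow> real) \<Rightarrow> (nat \<Rightarrow> real) \<times> real \<Rightarrow> ((nat \<Rightarrow> real) \<times> real) \<times> real" where
  "split_sample d e b = (\<lambda>(Z, h).
     ((\<lambda>j\<in>{..<d}. Z (Suc j), Z 0 + h / sqrt 2),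
      (Z 0 - h / sqrt 2 - (\<Sum>j<d. b j * Z (Suc j)) - e * (Z 0 + h / sqrt 2)) / sqrt (1 + e)))"

lemma measurable_split_sample [measurable]:
  "split_sample d e b \<in> measurable (PiM {..<Suc d} (\<lambda>_. borel) \<Otimes>\<^sub>M borel)
     ((PiM {..<d} (\<lambda>_. borel) \<Otimes>\<^sub>M borel) \<Otimes>\<^sub>M borel)"
proof -
  have [measurable]: "(\<lambda>p. fst p k) \<in> borel_measurable (PiM {..<Suc d} (\<lambda>_. borel :: real measure) \<Otimes>\<^sub>M (borel :: real measure))"
    if "k < Suc d" for k
    using measurable_compose[OF measurable_fst measurable_component_singleton[of k "{..<Suc d}" "\<lambda>_. borel"]] that by simp
  show ?thesis unfolding split_sample_def split_beta'
    by (intro measurable_Pair measurable_restrict) measurable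
qed

text \<open>Both sides are linear images of a standard vector of dimension \<open>d + 2\<close>, so
  the assumptions are just entries of two Gram matrices: \<open>c1\<close> to \<open>c3\<close> give
  the covariance of design and first response, \<open>c4\<close> and \<open>c5\<close> say that the
  remainder is uncorrelated with the design and with the first response. Its variance
  \<open>1 + e\<close> before scaling is a consequence.\<close>

lemma split_sample_law:
  assumes B0: "root_of (Suc d) C0 B0" and B: "root_of d C B" and e: "0 \<le> e"
    and c1: "\<And>i j. i < d \<Longrightarrow> j < d \<Longrightarrow> C0 (Suc i) (Suc j) = C i j"
    and c2: "\<And>i. i < d \<Longrightarrow> C0 (Suc i) 0 = (\<Sum>j<d. x j * C i j)"
    and c3: "C0 0 0 + 1 / 2 = (\<Sum>i<d. x i * (\<Sum>j<d. x j * C i j)) + \<sigma>\<^sup>2"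
    and c4: "\<And>i. i < d \<Longrightarrow> (1 - e) * C0 (Suc i) 0 = (\<Sum>j<d. b j * C i j)"
    and c5: "(1 - e) * C0 0 0 - (\<Sum>j<d. b j * C0 0 (Suc j)) = (1 + e) / 2"
  shows "distr (gaussian_vec (Suc d) C0 \<Otimes>\<^sub>M std_gaussian)
      ((PiM {..<d} (\<lambda>_. borel) \<Otimes>\<^sub>M borel) \<Otimes>\<^sub>M borel) (split_sample d e b) =
    slr_sample d \<sigma> C x \<Otimes>\<^sub>M std_gaussian"
proof -
  define s where "s = sqrt (1 + e)"
  have s: "s > 0" "s * s = 1 + e" using e by (simp_all add: s_def)
  define W where "W l = ((1 - e) * B0 0 l - (\<Sum>j<d. b j * B0 (Suc j) l)) / s" for l
  define X where "X l = (\<Sum>j<d. x j * B j l)" for l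
  \<comment> \<open>Rows below \<open>d\<close> are the design, row \<open>d\<close> the first
    response, row \<open>Suc d\<close> the remainder. In \<open>L\<close> the last column carries
    \<open>h\<close>; in \<open>R\<close> the columns \<open>d\<close> and \<open>Suc d\<close>
    carry the regression noise and the independent Gaussian. \<open>J\<close> regroups the flat
    vector into nested pairs.\<close>
  define L where "L i = (if i < d then snoc (Suc d) (B0 (Suc i)) 0
    else if i = d then snoc (Suc d) (B0 0) (1 / sqrt 2)
    else snoc (Suc d) W (- (1 + e) / (sqrt 2 * s)))" for i
  define R where "R i = (if i < d then snoc (Suc d) (snoc d (B i) 0) 0
    else if i = d then snoc (Suc d) (snoc d X \<sigma>) 0
    else snoc (Suc d) (\<lambda>_. 0) 1)" for i
  define J :: "(nat \<Rightarrow> real) \<Rightarrow> ((nat \<Rightarrow> real) \<times> real) \<times> real"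
    where "J v = ((restrict v {..<d}, v d), v (Suc d))" for v
  let ?m = "Suc (Suc d)"
  let ?T = "(PiM {..<d} (\<lambda>_. borel) \<Otimes>\<^sub>M borel) \<Otimes>\<^sub>M borel :: (((nat \<Rightarrow> real) \<times> real) \<times> real) measure"
  have J: "J \<in> measurable (PiM {..<?m} (\<lambda>_. borel)) ?T"
    unfolding J_def[abs_def]
    by (intro measurable_Pair measurable_restrict_subset measurable_component_singleton) auto
  have W: "inner_upto m u W = ((1 - e) * inner_upto m u (B0 0) - (\<Sum>j<d. b j * inner_upto m u (B0 (Suc j)))) / s" for m u
    unfolding W_def[abs_def] inner_upto_divide_right inner_upto_diff_scale_right inner_upto_sum_right ..
  have X: "inner_upto m u X = (\<Sum>j<d. x j * inner_upto m u (B j))" for m u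
    unfolding X_def[abs_def] by (rule inner_upto_sum_right)
  have ipB0: "inner_upto (Suc d) (B0 i) (B0 j) = C0 i j" if "i < Suc d" "j < Suc d" for i j
    using B0 that by (simp add: root_of_def)
  have ipB: "inner_upto d (B i) (B j) = C i j" if "i < d" "j < d" for i j
    using B that by (simp add: root_of_def)
  have W1: "inner_upto (Suc d) (B0 (Suc i)) W = 0" if "i < d" for i
    using that c4[OF that] by (simp add: W ipB0 c1)
  have W0: "inner_upto (Suc d) (B0 0) W = (1 + e) / (2 * s)"
  proof -
    have "inner_upto (Suc d) (B0 0) W = ((1 - e) * C0 0 0 - (\<Sum>j<d. b j * C0 0 (Suc j))) / s"
      by (simp add: W ipB0)
    then show ?thesis unfolding c5 by simp
  qed
  \<comment> \<open>\<open>W\<close> is orthogonal to the design rows, so only its product with row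
    0 contributes, and \<open>c5\<close> has fixed that one.\<close>
  have WW: "inner_upto (Suc d) W W = (1 - e) * (1 + e) / (2 * (1 + e))"
  proof -
    have "inner_upto (Suc d) W W = ((1 - e) * inner_upto (Suc d) (B0 0) W - (\<Sum>j<d. b j * inner_upto (Suc d) (B0 (Suc j)) W)) / s"
      using W[of "Suc d" W] by (simp only: inner_upto_commute[of "Suc d" W "B0 _"])
    also have "\<dots> = (1 - e) * (1 + e) / (2 * (s * s))" by (simp add: W1 W0)
    finally show ?thesis unfolding s(2) .
  qed
  have gram: "inner_upto ?m (L i) (L j) = inner_upto ?m (R i) (R j)" if "i < ?m" "j < ?m" for i j
  proof -
    have "i < d \<or> i = d \<or> i = Suc d" "j < d \<or> j = d \<or> j = Suc d" using that by auto
    moreover have g1: "inner_upto ?m (L i) (L j) = inner_upto ?m (R i) (R j)" if "i < d" "j < d" for i j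
      using that by (simp add: L_def R_def inner_upto_snoc_snoc ipB0 ipB c1)
    moreover have g2: "inner_upto ?m (L i) (L d) = inner_upto ?m (R i) (R d)" if "i < d" for i
      using that by (simp add: L_def R_def inner_upto_snoc_snoc ipB0 X ipB c2)
    moreover have g3: "inner_upto ?m (L i) (L (Suc d)) = inner_upto ?m (R i) (R (Suc d))" if "i < d" for i
      using that by (simp add: L_def R_def inner_upto_snoc_snoc W1)
    moreover have g4: "inner_upto ?m (L d) (L d) = inner_upto ?m (R d) (R d)"
      using c3 by (simp add: L_def R_def inner_upto_snoc_snoc ipB0 power2_eq_square X inner_upto_commute[of d X] ipB)
    moreover have g5: "inner_upto ?m (L d) (L (Suc d)) = inner_upto ?m (R d) (R (Suc d))"
      using s by (simp add: L_def R_def inner_upto_snoc_snoc W0 field_simps)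
    moreover have g6: "inner_upto ?m (L (Suc d)) (L (Suc d)) = inner_upto ?m (R (Suc d)) (R (Suc d))"
    proof -
      have "(- (1 + e) / (sqrt 2 * s)) * (- (1 + e) / (sqrt 2 * s)) = (1 + e) * (1 + e) / (2 * (s * s))"
        by (simp add: field_simps)
      then have "inner_upto ?m (L (Suc d)) (L (Suc d)) = (1 - e) * (1 + e) / (2 * (1 + e)) + (1 + e) * (1 + e) / (2 * (1 + e))"
        unfolding s(2) by (simp add: L_def inner_upto_snoc_snoc WW)
      also have "\<dots> = 1"
      proof -
        have "1 + e \<noteq> 0" using e by simp
        moreover have "a * p / (2 * p) = a / 2" if "p \<noteq> 0" for a p :: real using that by simp
        ultimately have "(1 - e) * (1 + e) / (2 * (1 + e)) = (1 - e) / 2" "(1 + e) * (1 + e) / (2 * (1 + e)) = (1 + e) / 2"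
          by blast+
        then show ?thesis by simp
      qed
      finally show ?thesis by (simp add: R_def inner_upto_snoc_snoc)
    qed
    ultimately show ?thesis using inner_upto_commute[of ?m] by metis
  qed
  have "distr (gaussian_vec (Suc d) C0 \<Otimes>\<^sub>M std_gaussian) ?T (split_sample d e b) =
    distr (distr (gauss ?m) (PiM {..<Suc d} (\<lambda>_. borel) \<Otimes>\<^sub>M borel)
      (\<lambda>g. (linear_image (Suc d) (Suc d) B0 (restrict g {..<Suc d}), g (Suc d)))) ?T (split_sample d e b)"
    unfolding gaussian_vec_eq_linear_image[OF B0] distr_gauss_Suc[OF measurable_linear_image] ..
  also have "\<dots> = distr (gauss ?m) ?T (split_sample d e b \<circ>
      (\<lambda>g. (linear_image (Suc d) (Suc d) B0 (restrict g {..<Suc d}), g (Suc d))))"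
    by (rule distr_distr[OF measurable_split_sample measurable_gauss_Suc[OF measurable_linear_image]])
  also have "\<dots> = distr (gauss ?m) ?T (J \<circ> linear_image ?m ?m L)"
  proof (rule arg_cong[where f = "distr (gauss ?m) ?T"], rule ext)
    fix g :: "nat \<Rightarrow> real"
    have "inner_upto (Suc d) W g = ((1 - e) * inner_upto (Suc d) (B0 0) g - (\<Sum>j<d. b j * inner_upto (Suc d) (B0 (Suc j)) g)) / s"
      using W[of "Suc d" g] by (simp add: inner_upto_commute[of _ g])
    moreover have "(y - h / sqrt 2 - S - e * (y + h / sqrt 2)) / s = ((1 - e) * y - S) / s + - (1 + e) / (sqrt 2 * s) * h" for y h S
      using s by (simp add: field_simps)
    ultimately show "(split_sample d e b \<circ> (\<lambda>g. (linear_image (Suc d) (Suc d) B0 (restrict g {..<Suc d}), g (Suc d)))) g =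
      (J \<circ> linear_image ?m ?m L) g"
      by (auto simp: split_sample_def linear_image_eq_inner_upto J_def L_def inner_upto_restrict inner_upto_snoc s_def[symmetric] fun_eq_iff)
  qed
  also have "\<dots> = distr (distr (gauss ?m) (PiM {..<?m} (\<lambda>_. borel)) (linear_image ?m ?m L)) ?T J"
    by (rule distr_distr[OF J measurable_linear_image, symmetric])
  also have "distr (gauss ?m) (PiM {..<?m} (\<lambda>_. borel)) (linear_image ?m ?m L) =
    distr (gauss ?m) (PiM {..<?m} (\<lambda>_. borel)) (linear_image ?m ?m R)"
    using gram by (rule distr_linear_image_eq)
  also have "distr (distr (gauss ?m) (PiM {..<?m} (\<lambda>_. borel)) (linear_image ?m ?m R)) ?T J =
    distr (gauss ?m) ?T (J \<circ> linear_image ?m ?m R)"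
    by (rule distr_distr[OF J measurable_linear_image])
  also have "\<dots> = slr_sample d \<sigma> C x \<Otimes>\<^sub>M std_gaussian"
  proof -
    let ?f = "\<lambda>(a, g). (a, (\<Sum>j<d. a j * x j) + \<sigma> * g)"
    let ?h = "\<lambda>g. (linear_image d d B (restrict g {..<d}), g d)"
    have f: "?f \<in> measurable (PiM {..<d} (\<lambda>_. borel) \<Otimes>\<^sub>M borel) (PiM {..<d} (\<lambda>_. borel) \<Otimes>\<^sub>M borel)"
    proof -
      have [measurable]: "(\<lambda>p. fst p k) \<in> borel_measurable (PiM {..<d} (\<lambda>_. borel :: real measure) \<Otimes>\<^sub>M (borel :: real measure))"
        if "k \<in> {..<d}" for k
        using measurable_compose[OF measurable_fst measurable_component_singleton[of k "{..<d}" "\<lambda>_. borel"]] that by simp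
      show ?thesis unfolding split_beta' by measurable
    qed
    have h: "?h \<in> measurable (gauss (Suc d)) (PiM {..<d} (\<lambda>_. borel) \<Otimes>\<^sub>M borel)"
      by (rule measurable_gauss_Suc[OF measurable_linear_image])
    have "slr_sample d \<sigma> C x = distr (distr (gauss (Suc d)) (PiM {..<d} (\<lambda>_. borel) \<Otimes>\<^sub>M borel) ?h)
      (PiM {..<d} (\<lambda>_. borel) \<Otimes>\<^sub>M borel) ?f"
      unfolding slr_sample_def gaussian_vec_eq_linear_image[OF B] distr_gauss_Suc[OF measurable_linear_image] ..
    also have "\<dots> = distr (gauss (Suc d)) (PiM {..<d} (\<lambda>_. borel) \<Otimes>\<^sub>M borel) (?f \<circ> ?h)"
      by (rule distr_distr[OF f h])
    finally have "slr_sample d \<sigma> C x \<Otimes>\<^sub>M std_gaussian =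
      distr (gauss ?m) ?T (\<lambda>g. ((?f \<circ> ?h) (restrict g {..<Suc d}), g (Suc d)))"
      by (simp only: distr_gauss_Suc[OF measurable_comp[OF h f]])
    also have "(\<lambda>g. ((?f \<circ> ?h) (restrict g {..<Suc d}), g (Suc d))) = J \<circ> linear_image ?m ?m R"
    proof (rule ext)
      fix g :: "nat \<Rightarrow> real"
      have "inner_upto d X g = (\<Sum>j<d. inner_upto d (B j) g * x j)"
        using X[of d g] by (simp add: inner_upto_commute[of _ g] mult.commute)
      then show "((?f \<circ> ?h) (restrict g {..<Suc d}), g (Suc d)) = (J \<circ> linear_image ?m ?m R) g"
        by (auto simp: linear_image_eq_inner_upto J_def R_def inner_upto_restrict inner_upto_snoc fun_eq_iff)
    qed
    finally show ?thesis ..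
  qed
  finally show ?thesis .
qed

section \<open>From one sample to all samples and the tape\<close>

lemma distr_PiM_componentwise:
  assumes "finite I" and M: "prob_space M" and N: "prob_space N"
    and f: "f \<in> measurable M N" and eq: "distr M N f = N"
  shows "distr (PiM I (\<lambda>_. M)) (PiM I (\<lambda>_. N)) (compose I f) = PiM I (\<lambda>_. N)"
  using distr_PiM_finite_prob_space'[of I "\<lambda>_. M" "\<lambda>_. N" f] assms by simp

text \<open>The tape is cut after \<open>n\<close> entries, samples and entries are zipped into
  i.i.d. pairs, \<phi> acts on each pair, and the result is unzipped. The grouping of the target is
  the point: everything the regression program sees, its tape included, is independent of the
  \<open>N\<close>-components used in the test.\<close>

lemma distr_PiM_stream_space:
  fixes K :: "'a measure" and M :: "'b measure" and Q :: "'c measure" and N :: "'d measure" and n :: nat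
  assumes K: "prob_space K" and M: "prob_space M" and Q: "prob_space Q" and N: "prob_space N"
    and \<phi>: "\<phi> \<in> measurable (K \<Otimes>\<^sub>M M) (Q \<Otimes>\<^sub>M N)" and law: "distr (K \<Otimes>\<^sub>M M) (Q \<Otimes>\<^sub>M N) \<phi> = Q \<Otimes>\<^sub>M N"
  defines "\<Psi> \<equiv> \<lambda>(S, r). ((\<lambda>i\<in>{..<n}. fst (\<phi> (S i, r !! i)), sdrop n r), \<lambda>i\<in>{..<n}. snd (\<phi> (S i, r !! i)))"
  shows "\<Psi> \<in> measurable (PiM {..<n} (\<lambda>_. K) \<Otimes>\<^sub>M stream_space M)
      ((PiM {..<n} (\<lambda>_. Q) \<Otimes>\<^sub>M stream_space M) \<Otimes>\<^sub>M PiM {..<n} (\<lambda>_. N))"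
    and "distr (PiM {..<n} (\<lambda>_. K) \<Otimes>\<^sub>M stream_space M)
      ((PiM {..<n} (\<lambda>_. Q) \<Otimes>\<^sub>M stream_space M) \<Otimes>\<^sub>M PiM {..<n} (\<lambda>_. N)) \<Psi> =
      (PiM {..<n} (\<lambda>_. Q) \<Otimes>\<^sub>M stream_space M) \<Otimes>\<^sub>M PiM {..<n} (\<lambda>_. N)"
proof -
  let ?Kn = "PiM {..<n} (\<lambda>_. K)" and ?Mn = "PiM {..<n} (\<lambda>_. M)" and ?Qn = "PiM {..<n} (\<lambda>_. Q)"
    and ?Nn = "PiM {..<n} (\<lambda>_. N)" and ?R = "stream_space M"
  interpret M: prob_space M by (rule M)
  interpret N: prob_space N by (rule N)
  interpret R: prob_space ?R by (rule M.prob_space_stream_space)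
  interpret Mn: prob_space ?Mn by (rule prob_space_PiM) (rule M)
  interpret Nn: prob_space ?Nn by (rule prob_space_PiM) (rule N)
  interpret Qn: prob_space ?Qn by (rule prob_space_PiM) (rule Q)
  interpret KM: pair_prob_space K M using K M by (simp add: pair_prob_space_def pair_sigma_finite_def prob_space_imp_sigma_finite)
  interpret QN: pair_prob_space Q N using Q N by (simp add: pair_prob_space_def pair_sigma_finite_def prob_space_imp_sigma_finite)
  interpret NR: pair_sigma_finite ?Nn ?R ..
  note [measurable] = \<phi>
  have [measurable]: "(\<lambda>p. fst p i) \<in> measurable (?Kn \<Otimes>\<^sub>M X) K" if "i \<in> {..<n}" for i and X :: "'x measure"
    using measurable_compose[OF measurable_fst measurable_component_singleton[of i "{..<n}" "\<lambda>_. K"]] that by simp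
  show meas [measurable]: "\<Psi> \<in> measurable (?Kn \<Otimes>\<^sub>M ?R) ((?Qn \<Otimes>\<^sub>M ?R) \<Otimes>\<^sub>M ?Nn)"
    unfolding \<Psi>_def split_beta' by measurable
  show "distr (?Kn \<Otimes>\<^sub>M ?R) ((?Qn \<Otimes>\<^sub>M ?R) \<Otimes>\<^sub>M ?Nn) \<Psi> = (?Qn \<Otimes>\<^sub>M ?R) \<Otimes>\<^sub>M ?Nn"
  proof (rule measure_eqI_nn_integral)
    fix F :: "(((nat \<Rightarrow> 'c) \<times> 'b stream) \<times> (nat \<Rightarrow> 'd)) \<Rightarrow> ennreal"
    assume F [measurable]: "F \<in> borel_measurable ((?Qn \<Otimes>\<^sub>M ?R) \<Otimes>\<^sub>M ?Nn)"
    define H where "H h = (\<integral>\<^sup>+r. F ((\<lambda>i\<in>{..<n}. fst (h i), r), \<lambda>i\<in>{..<n}. snd (h i)) \<partial>?R)" for h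
    have H [measurable]: "H \<in> borel_measurable (PiM {..<n} (\<lambda>_. Q \<Otimes>\<^sub>M N))"
    proof -
      have [measurable]: "(\<lambda>p. fst p i) \<in> measurable (PiM {..<n} (\<lambda>_. Q \<Otimes>\<^sub>M N) \<Otimes>\<^sub>M ?R) (Q \<Otimes>\<^sub>M N)" if "i \<in> {..<n}" for i
        using measurable_compose[OF measurable_fst measurable_component_singleton[of i "{..<n}" "\<lambda>_. Q \<Otimes>\<^sub>M N"]] that by simp
      have "(\<lambda>(h, r). F ((\<lambda>i\<in>{..<n}. fst (h i), r), \<lambda>i\<in>{..<n}. snd (h i))) \<in> borel_measurable (PiM {..<n} (\<lambda>_. Q \<Otimes>\<^sub>M N) \<Otimes>\<^sub>M ?R)"
        unfolding split_beta' by measurable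
      then show ?thesis unfolding H_def[abs_def] by (rule R.borel_measurable_nn_integral)
    qed
    have comp: "compose {..<n} \<phi> \<in> measurable (PiM {..<n} (\<lambda>_. K \<Otimes>\<^sub>M M)) (PiM {..<n} (\<lambda>_. Q \<Otimes>\<^sub>M N))"
      unfolding compose_def by measurable
    have H\<phi> [measurable]: "(\<lambda>h. H (compose {..<n} \<phi> h)) \<in> borel_measurable (PiM {..<n} (\<lambda>_. K \<Otimes>\<^sub>M M))"
      using measurable_compose[OF comp H] .
    have F\<Psi>: "(\<lambda>p. F (\<Psi> p)) \<in> borel_measurable (?Kn \<Otimes>\<^sub>M ?R)"
      using measurable_compose[OF meas F] .
    have "(\<integral>\<^sup>+x. F x \<partial>distr (?Kn \<Otimes>\<^sub>M ?R) ((?Qn \<Otimes>\<^sub>M ?R) \<Otimes>\<^sub>M ?Nn) \<Psi>) = (\<integral>\<^sup>+p. F (\<Psi> p) \<partial>(?Kn \<Otimes>\<^sub>M ?R))"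
      using F by (intro nn_integral_distr[OF meas]) simp
    also have "\<dots> = (\<integral>\<^sup>+S. \<integral>\<^sup>+r. F (\<Psi> (S, r)) \<partial>?R \<partial>?Kn)"
      by (rule R.nn_integral_fst[OF F\<Psi>, symmetric])
    also have "\<dots> = (\<integral>\<^sup>+S. \<integral>\<^sup>+g. H (compose {..<n} \<phi> (\<lambda>i\<in>{..<n}. (S i, g i))) \<partial>?Mn \<partial>?Kn)"
    proof (rule nn_integral_cong)
      fix S assume S: "S \<in> space ?Kn"
      let ?G = "\<lambda>(g, r). F ((\<lambda>i\<in>{..<n}. fst (\<phi> (S i, g i)), r), \<lambda>i\<in>{..<n}. snd (\<phi> (S i, g i)))"
      have Si [measurable]: "S i \<in> space K" if "i \<in> {..<n}" for i using S that by (auto simp: space_PiM)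
      have [measurable]: "(\<lambda>p. fst p i) \<in> measurable (?Mn \<Otimes>\<^sub>M ?R) M" if "i \<in> {..<n}" for i
        using measurable_compose[OF measurable_fst measurable_component_singleton[of i "{..<n}" "\<lambda>_. M"]] that by simp
      have [measurable]: "(\<lambda>p. \<phi> (S i, fst p i)) \<in> measurable (?Mn \<Otimes>\<^sub>M ?R) (Q \<Otimes>\<^sub>M N)" if "i \<in> {..<n}" for i
        by (rule measurable_compose[OF measurable_Pair[OF measurable_const[OF Si[OF that]]] \<phi>]) (use that in measurable)
      have G: "?G \<in> borel_measurable (?Mn \<Otimes>\<^sub>M ?R)" unfolding split_beta' by measurable
      have "(\<integral>\<^sup>+r. F (\<Psi> (S, r)) \<partial>?R) = (\<integral>\<^sup>+r. ?G (\<lambda>i\<in>{..<n}. r !! i, sdrop n r) \<partial>?R)"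
        by (simp add: \<Psi>_def cong: restrict_cong)
      also have "\<dots> = (\<integral>\<^sup>+g. \<integral>\<^sup>+r. ?G (g, r) \<partial>?R \<partial>?Mn)"
        by (rule nn_integral_stream_space_sdrop[OF M G])
      finally show "(\<integral>\<^sup>+r. F (\<Psi> (S, r)) \<partial>?R) = (\<integral>\<^sup>+g. H (compose {..<n} \<phi> (\<lambda>i\<in>{..<n}. (S i, g i))) \<partial>?Mn)"
        by (simp add: H_def compose_def cong: restrict_cong)
    qed
    also have "\<dots> = (\<integral>\<^sup>+h. H (compose {..<n} \<phi> h) \<partial>PiM {..<n} (\<lambda>_. K \<Otimes>\<^sub>M M))"
      by (rule nn_integral_PiM_pair[OF _ K M H\<phi>, symmetric]) simp
    also have "\<dots> = (\<integral>\<^sup>+h. H h \<partial>distr (PiM {..<n} (\<lambda>_. K \<Otimes>\<^sub>M M)) (PiM {..<n} (\<lambda>_. Q \<Otimes>\<^sub>M N)) (compose {..<n} \<phi>))"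
      using H by (intro nn_integral_distr[OF comp, symmetric]) simp
    also have "distr (PiM {..<n} (\<lambda>_. K \<Otimes>\<^sub>M M)) (PiM {..<n} (\<lambda>_. Q \<Otimes>\<^sub>M N)) (compose {..<n} \<phi>) = PiM {..<n} (\<lambda>_. Q \<Otimes>\<^sub>M N)"
      by (rule distr_PiM_componentwise[OF _ KM.prob_space_axioms QN.prob_space_axioms \<phi> law]) simp
    also have "(\<integral>\<^sup>+h. H h \<partial>PiM {..<n} (\<lambda>_. Q \<Otimes>\<^sub>M N)) = (\<integral>\<^sup>+f. \<integral>\<^sup>+g. H (\<lambda>i\<in>{..<n}. (f i, g i)) \<partial>?Nn \<partial>?Qn)"
      by (rule nn_integral_PiM_pair[OF _ Q N H]) simp
    also have "\<dots> = (\<integral>\<^sup>+f. \<integral>\<^sup>+g. \<integral>\<^sup>+r. F ((f, r), g) \<partial>?R \<partial>?Nn \<partial>?Qn)"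
    proof (intro nn_integral_cong)
      fix f g assume "f \<in> space ?Qn" "g \<in> space ?Nn"
      then have "restrict f {..<n} = f" "restrict g {..<n} = g"
        by (auto simp: space_PiM PiE_def extensional_restrict)
      then show "H (\<lambda>i\<in>{..<n}. (f i, g i)) = (\<integral>\<^sup>+r. F ((f, r), g) \<partial>?R)"
        by (simp add: H_def cong: restrict_cong)
    qed
    \<comment> \<open>The remaining tape is moved next to the regression data, so that the test
      noise stands innermost.\<close>
    also have "\<dots> = (\<integral>\<^sup>+f. \<integral>\<^sup>+r. \<integral>\<^sup>+g. F ((f, r), g) \<partial>?Nn \<partial>?R \<partial>?Qn)"
      by (intro nn_integral_cong NR.Fubini'[symmetric]) measurable
    also have "\<dots> = (\<integral>\<^sup>+p. \<integral>\<^sup>+g. F (p, g) \<partial>?Nn \<partial>(?Qn \<Otimes>\<^sub>M ?R))"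
      by (rule R.nn_integral_fst) measurable
    also have "\<dots> = (\<integral>\<^sup>+x. F x \<partial>((?Qn \<Otimes>\<^sub>M ?R) \<Otimes>\<^sub>M ?Nn))"
      by (rule Nn.nn_integral_fst[OF F])
    finally show "(\<integral>\<^sup>+x. F x \<partial>distr (?Kn \<Otimes>\<^sub>M ?R) ((?Qn \<Otimes>\<^sub>M ?R) \<Otimes>\<^sub>M ?Nn) \<Psi>) = \<dots>" .
  qed simp
qed

section \<open>Chi-square tails\<close>

text \<open>Complete the square: against the standard Gaussian density, the integrand is a multiple of another
  Gaussian density.\<close>

lemma nn_integral_exp_square_le:
  fixes \<alpha> c s :: real
  assumes D: "0 < 1 + 2 * \<alpha> * s\<^sup>2" and \<alpha>: "0 \<le> \<alpha> \<or> c = 0"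
  shows "(\<integral>\<^sup>+w. ennreal (exp (- \<alpha> * (c + s * w)\<^sup>2)) \<partial>std_gaussian) \<le> ennreal (1 / sqrt (1 + 2 * \<alpha> * s\<^sup>2))"
proof -
  define D where "D = 1 + 2 * \<alpha> * s\<^sup>2"
  define \<mu> where "\<mu> = - (2 * \<alpha> * s * c) / D"
  define \<tau> where "\<tau> = 1 / sqrt D"
  have D0: "D > 0" using D by (simp add: D_def)
  have \<tau>: "\<tau>\<^sup>2 = 1 / D" "\<tau> > 0" using D0 by (simp_all add: \<tau>_def power_divide)
  have expo: "- w\<^sup>2 / 2 + - \<alpha> * (c + s * w)\<^sup>2 = - \<alpha> * c\<^sup>2 / D + - (w - \<mu>)\<^sup>2 / (2 * \<tau>\<^sup>2)" for w
  proof -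
    have "D * (w - \<mu>)\<^sup>2 = D * w\<^sup>2 + 4 * \<alpha> * s * c * w + 4 * \<alpha>\<^sup>2 * s\<^sup>2 * c\<^sup>2 / D"
      using D0 by (simp add: \<mu>_def power2_eq_square field_simps)
    moreover have "4 * \<alpha>\<^sup>2 * s\<^sup>2 * c\<^sup>2 / D = 2 * \<alpha> * c\<^sup>2 - 2 * \<alpha> * c\<^sup>2 / D"
    proof -
      have "4 * \<alpha>\<^sup>2 * s\<^sup>2 * c\<^sup>2 = 2 * \<alpha> * c\<^sup>2 * (D - 1)" by (simp add: D_def power2_eq_square algebra_simps)
      then show ?thesis using D0 by (simp add: field_simps)
    qed
    moreover have "D * w\<^sup>2 = w\<^sup>2 + 2 * \<alpha> * s\<^sup>2 * w\<^sup>2" by (simp add: D_def algebra_simps)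
    moreover have "(w - \<mu>)\<^sup>2 / (2 * \<tau>\<^sup>2) = D * (w - \<mu>)\<^sup>2 / 2" using D0 by (simp add: \<tau>)
    ultimately have "(w - \<mu>)\<^sup>2 / (2 * \<tau>\<^sup>2) =
      w\<^sup>2 / 2 + \<alpha> * s\<^sup>2 * w\<^sup>2 + 2 * \<alpha> * s * c * w + \<alpha> * c\<^sup>2 - \<alpha> * c\<^sup>2 / D" by simp
    moreover have "\<alpha> * (c + s * w)\<^sup>2 = \<alpha> * c\<^sup>2 + 2 * \<alpha> * s * c * w + \<alpha> * s\<^sup>2 * w\<^sup>2"
      by (simp add: power2_eq_square algebra_simps)
    ultimately show ?thesis by simp
  qed
  have dens: "std_normal_density w * exp (- \<alpha> * (c + s * w)\<^sup>2) =
    (exp (- \<alpha> * c\<^sup>2 / D) / sqrt D) * normal_density \<mu> \<tau> w" for w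
  proof -
    have "std_normal_density w * exp (- \<alpha> * (c + s * w)\<^sup>2) = exp (- w\<^sup>2 / 2 + - \<alpha> * (c + s * w)\<^sup>2) / sqrt (2 * pi)"
      unfolding std_normal_density_def exp_add by simp
    also have "\<dots> = exp (- \<alpha> * c\<^sup>2 / D) * exp (- (w - \<mu>)\<^sup>2 / (2 * \<tau>\<^sup>2)) / sqrt (2 * pi)"
      unfolding expo exp_add ..
    also have "\<dots> = (exp (- \<alpha> * c\<^sup>2 / D) / sqrt D) * normal_density \<mu> \<tau> w"
      using D0 by (simp add: normal_density_def \<tau>(1) real_sqrt_divide)
    finally show ?thesis .
  qed
  interpret N: prob_space "density lborel (normal_density \<mu> \<tau>)" by (rule prob_space_normal_density) fact
  have one: "(\<integral>\<^sup>+w. ennreal (normal_density \<mu> \<tau> w) \<partial>lborel) = 1"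
    using N.emeasure_space_1 by (simp add: emeasure_density)
  have "(\<integral>\<^sup>+w. ennreal (exp (- \<alpha> * (c + s * w)\<^sup>2)) \<partial>std_gaussian) =
    (\<integral>\<^sup>+w. ennreal (std_normal_density w) * ennreal (exp (- \<alpha> * (c + s * w)\<^sup>2)) \<partial>lborel)"
    by (rule nn_integral_std_gaussian) measurable
  also have "\<dots> = (\<integral>\<^sup>+w. ennreal (exp (- \<alpha> * c\<^sup>2 / D) / sqrt D) * ennreal (normal_density \<mu> \<tau> w) \<partial>lborel)"
  proof (rule nn_integral_cong)
    fix w :: real
    show "ennreal (std_normal_density w) * ennreal (exp (- \<alpha> * (c + s * w)\<^sup>2)) =
      ennreal (exp (- \<alpha> * c\<^sup>2 / D) / sqrt D) * ennreal (normal_density \<mu> \<tau> w)"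
      using D0 dens[of w] by (simp add: ennreal_mult[symmetric])
  qed
  also have "\<dots> = ennreal (exp (- \<alpha> * c\<^sup>2 / D) / sqrt D)"
    by (subst nn_integral_cmult) (simp_all add: one)
  \<comment> \<open>The factor produced by the shift \<open>c\<close> is at most 1 when \<alpha> is
    nonnegative and equal to 1 when \<open>c = 0\<close>; a negative \<alpha> with a shift would
    make it exceed 1.\<close>
  also have "\<dots> \<le> ennreal (1 / sqrt D)"
    using D0 \<alpha> by (intro ennreal_leI divide_right_mono) auto
  finally show ?thesis by (simp add: D_def)
qed

text \<open>The exponential Markov inequality for both tails at once: the sign of \<alpha> decides
  whether the event bounds the sum from above or from below. In the direction of small sums the
  centres \<open>c i\<close> are arbitrary.\<close>

lemma gauss_chernoff:
  fixes \<alpha> s t :: real and c :: "nat \<Rightarrow> real"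
  assumes D: "0 < 1 + 2 * \<alpha> * s\<^sup>2" and \<alpha>: "0 \<le> \<alpha> \<or> (\<forall>i. c i = 0)"
  shows "emeasure (gauss n) {w \<in> space (gauss n). 0 \<le> \<alpha> * (t * real n - (\<Sum>i<n. (c i + s * w i)\<^sup>2))} \<le>
    ennreal ((exp (\<alpha> * t) / sqrt (1 + 2 * \<alpha> * s\<^sup>2)) ^ n)"
proof -
  have factor: "(\<lambda>w. ennreal (exp (- \<alpha> * (c i + s * w)\<^sup>2))) \<in> borel_measurable std_gaussian" for i
    by (subst measurable_cong_sets[OF sets_std_gaussian refl]) measurable
  have [measurable]: "(\<lambda>x. x k) \<in> borel_measurable (gauss n)" if "k \<in> {..<n}" for k
    using measurable_component_singleton[of k "{..<n}" "\<lambda>_. std_gaussian"] that by simp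
  let ?A = "{w \<in> space (gauss n). 0 \<le> \<alpha> * (t * real n - (\<Sum>i<n. (c i + s * w i)\<^sup>2))}"
  have "emeasure (gauss n) ?A = (\<integral>\<^sup>+w. indicator ?A w \<partial>gauss n)"
    by (rule nn_integral_indicator[symmetric]) measurable
  also have "\<dots> \<le> (\<integral>\<^sup>+w. ennreal (exp (\<alpha> * t) ^ n) * (\<Prod>i<n. ennreal (exp (- \<alpha> * (c i + s * w i)\<^sup>2))) \<partial>gauss n)"
  proof (rule nn_integral_mono)
    fix w
    have "ennreal (exp (\<alpha> * t) ^ n) * (\<Prod>i<n. ennreal (exp (- \<alpha> * (c i + s * w i)\<^sup>2))) =
      ennreal (exp (\<alpha> * (t * real n - (\<Sum>i<n. (c i + s * w i)\<^sup>2))))"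
      by (simp add: prod_ennreal ennreal_mult[symmetric] exp_sum[symmetric] exp_of_nat_mult[symmetric] exp_add[symmetric]
          sum_distrib_left sum_negf prod_nonneg algebra_simps)
    then show "indicator ?A w \<le> ennreal (exp (\<alpha> * t) ^ n) * (\<Prod>i<n. ennreal (exp (- \<alpha> * (c i + s * w i)\<^sup>2)))"
      by (simp add: indicator_def)
  qed
  also have "\<dots> = ennreal (exp (\<alpha> * t) ^ n) * (\<integral>\<^sup>+w. (\<Prod>i<n. ennreal (exp (- \<alpha> * (c i + s * w i)\<^sup>2))) \<partial>gauss n)"
    by (rule nn_integral_cmult) measurable
  also have "(\<integral>\<^sup>+w. (\<Prod>i<n. ennreal (exp (- \<alpha> * (c i + s * w i)\<^sup>2))) \<partial>gauss n) =
    (\<Prod>i<n. \<integral>\<^sup>+w. ennreal (exp (- \<alpha> * (c i + s * w)\<^sup>2)) \<partial>std_gaussian)"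
    by (rule std_gaussian_prod.product_nn_integral_prod) (simp, rule factor)
  also have "\<dots> \<le> (\<Prod>i<n. ennreal (1 / sqrt (1 + 2 * \<alpha> * s\<^sup>2)))"
    using D \<alpha> by (intro prod_mono_ennreal nn_integral_exp_square_le) auto
  also have "\<dots> = ennreal ((1 / sqrt (1 + 2 * \<alpha> * s\<^sup>2)) ^ n)"
    using D by (simp add: ennreal_power)
  also have "ennreal (exp (\<alpha> * t) ^ n) * \<dots> = ennreal ((exp (\<alpha> * t) / sqrt (1 + 2 * \<alpha> * s\<^sup>2)) ^ n)"
    using D by (simp add: ennreal_mult[symmetric] power_divide)
  finally show ?thesis by (simp add: mult_left_mono)
qed

text \<open>Squaring clears the root, so a tail bound comes down to one numerical estimate of the
  exponential function.\<close>

lemma power_le_exp_neg: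
  fixes x D :: real
  assumes "0 < D" and le: "exp (2 * x + 2 * \<gamma>) \<le> D"
  shows "(exp x / sqrt D) ^ n \<le> exp (- (\<gamma> * real n))"
proof -
  have "(exp (x + \<gamma>))\<^sup>2 = exp (2 * x + 2 * \<gamma>)" by (simp add: power2_eq_square exp_add[symmetric])
  then have "exp (x + \<gamma>) \<le> sqrt D" using le by (intro real_le_rsqrt) simp
  then have "exp x / sqrt D \<le> exp (- \<gamma>)"
    using assms(1) by (simp add: exp_add exp_minus field_simps)
  then have "(exp x / sqrt D) ^ n \<le> exp (- \<gamma>) ^ n"
    using assms(1) by (intro power_mono) auto
  also have "\<dots> = exp (- (\<gamma> * real n))" by (simp add: exp_of_nat_mult[symmetric] mult.commute)
  finally show ?thesis .
qed

lemma gauss_norm_upper_tail: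
  "emeasure (gauss n) {w \<in> space (gauss n). 103 / 100 * real n \<le> (\<Sum>i<n. (w i)\<^sup>2)} \<le> ennreal (exp (- (1 / 10000 * real n)))"
proof -
  \<comment> \<open>At \<open>\<alpha> = - 1 / 100\<close> the denominator is
    \<open>1 - 2 / 100 = 49 / 50\<close>, and twice the exponent plus twice the rate is
    \<open>- 206 / 10000 + 2 / 10000 = - 51 / 2500\<close>.\<close>
  have "1 + 51 / 2500 + (51 / 2500)\<^sup>2 / 2 \<le> exp (51 / 2500 :: real)"
    by (rule exp_lower_Taylor_quadratic) simp
  moreover have "50 / 49 \<le> 1 + 51 / 2500 + (51 / 2500 :: real)\<^sup>2 / 2" by (simp add: power2_eq_square)
  ultimately have "50 / 49 \<le> exp (51 / 2500 :: real)" by linarith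
  then have "inverse (exp (51 / 2500)) \<le> inverse (50 / 49 :: real)" by (rule le_imp_inverse_le) simp
  then have "exp (2 * (- (1 / 100) * (103 / 100)) + 2 * (1 / 10000)) \<le> (49 / 50 :: real)"
    by (simp add: exp_minus[symmetric])
  then have "(exp (- (1 / 100) * (103 / 100)) / sqrt (49 / 50)) ^ n \<le> exp (- (1 / 10000 * real n))"
    by (intro power_le_exp_neg) auto
  moreover have "{w \<in> space (gauss n). 103 / 100 * real n \<le> (\<Sum>i<n. (w i)\<^sup>2)} =
    {w \<in> space (gauss n). 0 \<le> - (1 / 100) * (103 / 100 * real n - (\<Sum>i<n. (0 + 1 * w i)\<^sup>2))}"
    by auto
  moreover have "1 + 2 * - (1 / 100) * 1\<^sup>2 = (49 / 50 :: real)" by simp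
  ultimately show ?thesis
    using gauss_chernoff[of "- (1 / 100)" 1 "\<lambda>_. 0" n "103 / 100"] order_trans[OF _ ennreal_leI] by (simp only:) simp
qed

text \<open>The centres are free because they will be predictions by an unknown algorithm: shifting
  the noise cannot make small sums of squares likelier than this bound.\<close>

lemma gauss_norm_lower_tail:
  "emeasure (gauss n) {w \<in> space (gauss n). 4 * (\<Sum>i<n. (c i + sqrt (4 / 3) * w i)\<^sup>2) \<le> 5 * real n} \<le>
    ennreal (exp (- (1 / 10000 * real n)))"
proof -
  \<comment> \<open>\<open>\<alpha> = 3 / 200\<close> makes the denominator
    \<open>1 + 2 * \<alpha> * 4 / 3\<close> equal to \<open>26 / 25\<close>; the exponent is
    \<open>3 / 80 + 1 / 5000 = 377 / 10000\<close>.\<close>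
  have "exp (2 * (3 / 200 * (5 / 4)) + 2 * (1 / 10000)) \<le> 1 + 377 / 10000 + (377 / 10000 :: real)\<^sup>2"
    using exp_bound[of "377 / 10000"] by simp
  also have "\<dots> \<le> 26 / 25" by (simp add: power2_eq_square)
  finally have "(exp (3 / 200 * (5 / 4)) / sqrt (26 / 25)) ^ n \<le> exp (- (1 / 10000 * real n))"
    by (intro power_le_exp_neg) auto
  moreover have "{w \<in> space (gauss n). 4 * (\<Sum>i<n. (c i + sqrt (4 / 3) * w i)\<^sup>2) \<le> 5 * real n} =
    {w \<in> space (gauss n). 0 \<le> 3 / 200 * (5 / 4 * real n - (\<Sum>i<n. (c i + sqrt (4 / 3) * w i)\<^sup>2))}"
    by auto
  moreover have "1 + 2 * (3 / 200) * (sqrt (4 / 3))\<^sup>2 = (26 / 25 :: real)" by simp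
  ultimately show ?thesis
    using gauss_chernoff[of "3 / 200" "sqrt (4 / 3)" c n "5 / 4"] order_trans[OF _ ennreal_leI] by (simp only:) simp
qed

section \<open>Success probabilities\<close>

lemma sets_gaussian_vec [simp, measurable_cong]: "sets (gaussian_vec d C) = sets (PiM {..<d} (\<lambda>_. borel))"
  by (simp add: gaussian_vec_def Let_def)

text \<open>Whatever matrix the choice returns, the law is an image of a standard Gaussian vector;
  this makes the statement available for every \<open>C\<close>.\<close>

lemma prob_space_gaussian_vec: "prob_space (gaussian_vec d C)"
proof -
  have G: "prob_space (gauss d)" by (rule prob_space_PiM) (rule prob_space_std_gaussian)
  define B where "B = (SOME B. \<forall>i<d. \<forall>j<d. (\<Sum>l<d. B i l * B j l) = C i j)"
  have "prob_space (distr (gauss d) (PiM {..<d} (\<lambda>_. borel)) (linear_image d d B))"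
    by (rule prob_space.prob_space_distr[OF G]) simp
  then show ?thesis
    unfolding gaussian_vec_def B_def[symmetric] Let_def linear_image_def[abs_def] .
qed

lemma sets_slr_sample [simp, measurable_cong]:
  "sets (slr_sample d \<sigma> C x) = sets (PiM {..<d} (\<lambda>_. borel) \<Otimes>\<^sub>M borel)"
  by (simp add: slr_sample_def)

lemma prob_space_slr_sample: "prob_space (slr_sample d \<sigma> C x)"
proof -
  interpret A: prob_space "gaussian_vec d C" by (rule prob_space_gaussian_vec)
  interpret P: pair_prob_space "gaussian_vec d C" std_gaussian ..
  have [measurable]: "(\<lambda>p. fst p k) \<in> borel_measurable (gaussian_vec d C \<Otimes>\<^sub>M std_gaussian)" if "k \<in> {..<d}" for k
  proof -
    have "(\<lambda>a. a k) \<in> borel_measurable (gaussian_vec d C)"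
      using measurable_component_singleton[of k "{..<d}" "\<lambda>_. borel"] that
      by (subst measurable_cong_sets[OF sets_gaussian_vec refl])
    from measurable_compose[OF measurable_fst this] show ?thesis .
  qed
  have "(\<lambda>(a, g). (a, (\<Sum>j<d. a j * x j) + \<sigma> * g)) \<in>
    measurable (gaussian_vec d C \<Otimes>\<^sub>M std_gaussian) (PiM {..<d} (\<lambda>_. borel) \<Otimes>\<^sub>M borel)"
    unfolding split_beta' by measurable
  then show ?thesis unfolding slr_sample_def by (rule P.prob_space_distr)
qed

lemma sets_random_tape [simp, measurable_cong]: "sets random_tape = sets (stream_space borel)"
  unfolding random_tape_def by (rule sets_stream_space_cong) simp

lemma prob_space_random_tape: "prob_space random_tape"
  unfolding random_tape_def by (rule std_gaussian.prob_space_stream_space)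

lemma measurable_slr_input [measurable]:
  "(\<lambda>(S, r). slr_input \<sigma> d k n S r) \<in>
    measurable (PiM {..<n} (\<lambda>_. PiM {..<d} (\<lambda>_. borel) \<Otimes>\<^sub>M borel) \<Otimes>\<^sub>M stream_space borel) state_space"
proof (rule measurable_state_space)
  let ?M = "PiM {..<n} (\<lambda>_. PiM {..<d} (\<lambda>_. borel :: real measure) \<Otimes>\<^sub>M (borel :: real measure)) \<Otimes>\<^sub>M stream_space (borel :: real measure)"
  have S: "(\<lambda>p. fst p i) \<in> measurable ?M (PiM {..<d} (\<lambda>_. borel) \<Otimes>\<^sub>M borel)" if "i < n" for i
    using measurable_compose[OF measurable_fst measurable_component_singleton[of i "{..<n}" "\<lambda>_. PiM {..<d} (\<lambda>_. borel) \<Otimes>\<^sub>M borel"]] that by simp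
  have A: "(\<lambda>p. fst (fst p i) j) \<in> borel_measurable ?M" if "i < n" "j < d" for i j
    using measurable_compose[OF measurable_compose[OF S[OF that(1)] measurable_fst] measurable_component_singleton[of j "{..<d}" "\<lambda>_. borel"]] that by simp
  have y: "(\<lambda>p. snd (fst p i)) \<in> borel_measurable ?M" if "i < n" for i
    using measurable_compose[OF S[OF that(1)] measurable_snd] .
  show "(\<lambda>p. reals (case p of (S, r) \<Rightarrow> slr_input \<sigma> d k n S r) v i j) \<in> borel_measurable ?M" for v i j
    using A[of i j] y[of i] by (cases "i < n"; cases "j < d") (auto simp: slr_input_def split_beta')
qed (simp_all add: slr_input_def split_beta')

lemma measurable_negspca_input:
  "(\<lambda>(S, r). negspca_input \<theta> d k n S r) \<in>
    measurable (PiM {..<n} (\<lambda>_. PiM {..<Suc d} (\<lambda>_. borel)) \<Otimes>\<^sub>M stream_space borel) state_space"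
proof (rule measurable_state_space)
  let ?M = "PiM {..<n} (\<lambda>_. PiM {..<Suc d} (\<lambda>_. borel :: real measure)) \<Otimes>\<^sub>M stream_space (borel :: real measure)"
  have Z: "(\<lambda>p. fst p i j) \<in> borel_measurable ?M" if "i < n" "j < Suc d" for i j
    using measurable_compose[OF measurable_compose[OF measurable_fst measurable_component_singleton[of i "{..<n}" "\<lambda>_. PiM {..<Suc d} (\<lambda>_. borel)"]]
        measurable_component_singleton[of j "{..<Suc d}" "\<lambda>_. borel"]] that by simp
  show "(\<lambda>p. reals (case p of (S, r) \<Rightarrow> negspca_input \<theta> d k n S r) v i j) \<in> borel_measurable ?M" for v i j
    using Z[of i j] by (cases "i < n"; cases "j < Suc d") (auto simp: negspca_input_def split_beta')
qed (simp_all add: negspca_input_def split_beta')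

text \<open>A non-measurable set would have measure 0, so a lower bound on a success probability
  hinges on this.\<close>

lemma sets_negspca_event:
  "{(S, r) \<in> space (PiM {..<n} (\<lambda>_. PiM {..<Suc d} (\<lambda>_. borel)) \<Otimes>\<^sub>M stream_space borel).
     halts_with c (negspca_input \<theta> d k n S r) (\<lambda>s. negspca_answer s = b)} \<in>
   sets (PiM {..<n} (\<lambda>_. PiM {..<Suc d} (\<lambda>_. borel)) \<Otimes>\<^sub>M stream_space borel)"
proof -
  let ?M = "PiM {..<n} (\<lambda>_. PiM {..<Suc d} (\<lambda>_. borel :: real measure)) \<Otimes>\<^sub>M stream_space (borel :: real measure)"
  have "Measurable.pred (?M \<Otimes>\<^sub>M state_space) (\<lambda>(p, s). negspca_answer s = b)"
    unfolding negspca_answer_def split_beta' by measurable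
  from measurable_halts_with[OF measurable_negspca_input this, of c]
  show ?thesis by (simp add: pred_def split_beta')
qed

text \<open>The planted law is a mixture over the spikes, so a bound that holds for every fixed
  spike survives averaging.\<close>

lemma planted_prob_ge:
  assumes sp: "finite (spikes d k)" "spikes d k \<noteq> {}"
    and E: "E \<in> sets (PiM {..<n} (\<lambda>_. PiM {..<Suc d} (\<lambda>_. borel)) \<Otimes>\<^sub>M stream_space borel)"
    and ge: "\<And>v. v \<in> spikes d k \<Longrightarrow>
      p \<le> measure (PiM {..<n} (\<lambda>_. gaussian_vec (Suc d) (spiked_cov \<theta> v)) \<Otimes>\<^sub>M random_tape) E"
  shows "p \<le> measure (planted_law d k n \<theta> \<Otimes>\<^sub>M random_tape) E"
proof -
  let ?K = "\<lambda>v. PiM {..<n} (\<lambda>_. gaussian_vec (Suc d) (spiked_cov \<theta> v))"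
  let ?B = "PiM {..<n} (\<lambda>_. PiM {..<Suc d} (\<lambda>_. borel :: real measure))"
  let ?p = "measure_pmf (pmf_of_set (spikes d k))"
  interpret R: prob_space random_tape by (rule prob_space_random_tape)
  have K: "prob_space (?K v)" for v by (rule prob_space_PiM) (rule prob_space_gaussian_vec)
  have setsK: "sets (?K v) = sets ?B" for v by (rule sets_PiM_cong) simp_all
  have kernel: "?K \<in> measurable ?p (subprob_algebra ?B)"
    using K setsK by (auto simp: space_subprob_algebra intro: prob_space_imp_subprob_space)
  have pl: "planted_law d k n \<theta> = ?p \<bind> ?K" by (simp add: planted_law_def)
  have sets_pl: "sets (planted_law d k n \<theta>) = sets ?B"
    unfolding pl by (rule sets_bind[where N = ?B]) (use setsK in auto)
  have prob_pl: "prob_space (planted_law d k n \<theta>)"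
    unfolding pl using kernel K by (intro prob_space.prob_space_bind[where S = ?B] measure_pmf.prob_space_axioms) auto
  interpret PL: prob_space "planted_law d k n \<theta>" by (rule prob_pl)
  interpret PR: pair_prob_space "planted_law d k n \<theta>" random_tape ..
  have E1: "E \<in> sets (planted_law d k n \<theta> \<Otimes>\<^sub>M random_tape)" "E \<in> sets (?K v \<Otimes>\<^sub>M random_tape)" "E \<in> sets (?B \<Otimes>\<^sub>M random_tape)" for v
    using E by (simp_all cong: sets_pair_measure_cong add: sets_pl setsK)
  have "emeasure (planted_law d k n \<theta> \<Otimes>\<^sub>M random_tape) E = (\<integral>\<^sup>+S. emeasure random_tape (Pair S -` E) \<partial>planted_law d k n \<theta>)"
    by (rule R.emeasure_pair_measure_alt[OF E1(1)])
  also have "\<dots> = (\<integral>\<^sup>+v. \<integral>\<^sup>+S. emeasure random_tape (Pair S -` E) \<partial>?K v \<partial>?p)"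
    unfolding pl by (rule nn_integral_bind[OF R.measurable_emeasure_Pair[OF E1(3)] kernel])
  also have "\<dots> = (\<integral>\<^sup>+v. emeasure (?K v \<Otimes>\<^sub>M random_tape) E \<partial>?p)"
    by (intro nn_integral_cong R.emeasure_pair_measure_alt[symmetric] E1)
  also have "\<dots> \<ge> (\<integral>\<^sup>+v. ennreal p \<partial>?p)"
  proof (rule nn_integral_mono_AE, rule AE_pmfI)
    fix v assume "v \<in> set_pmf (pmf_of_set (spikes d k))"
    then have v: "v \<in> spikes d k" using sp by simp
    interpret K: prob_space "?K v" by (rule K)
    interpret KR: pair_prob_space "?K v" random_tape ..
    show "ennreal p \<le> emeasure (?K v \<Otimes>\<^sub>M random_tape) E"
      using ge[OF v] by (simp add: KR.emeasure_eq_measure ennreal_leI)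
  qed
  also have "(\<integral>\<^sup>+v. ennreal p \<partial>?p) = ennreal p" by simp
  finally show ?thesis by (simp add: PR.emeasure_eq_measure)
qed


section \<open>Transfer of events along the split\<close>

definition split_input ::
  "nat \<Rightarrow> nat \<Rightarrow> real \<Rightarrow> (nat \<Rightarrow> real) \<Rightarrow> pca_samples \<times> real stream \<Rightarrow> (slr_samples \<times> real stream) \<times> (nat \<Rightarrow> real)" where
  "split_input d n e b = (\<lambda>(S, r).
     ((\<lambda>i\<in>{..<n}. fst (split_sample d e b (S i, r !! i)), sdrop n r),
      \<lambda>i\<in>{..<n}. snd (split_sample d e b (S i, r !! i))))"

lemma split_input_law:
  fixes n :: nat
  assumes "distr (gaussian_vec (Suc d) C0 \<Otimes>\<^sub>M std_gaussian)
      ((PiM {..<d} (\<lambda>_. borel) \<Otimes>\<^sub>M borel) \<Otimes>\<^sub>M borel) (split_sample d e b) =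
    slr_sample d \<sigma> C x \<Otimes>\<^sub>M std_gaussian"
  defines "KR \<equiv> PiM {..<n} (\<lambda>_. gaussian_vec (Suc d) C0) \<Otimes>\<^sub>M random_tape"
    and "T \<equiv> (slr_law d n \<sigma> C x \<Otimes>\<^sub>M random_tape) \<Otimes>\<^sub>M gauss n"
  shows "split_input d n e b \<in> measurable KR T" "distr KR T (split_input d n e b) = T"
proof -
  let ?T = "(PiM {..<d} (\<lambda>_. borel :: real measure) \<Otimes>\<^sub>M (borel :: real measure)) \<Otimes>\<^sub>M (borel :: real measure)"
  have sets: "sets (slr_sample d \<sigma> C x \<Otimes>\<^sub>M std_gaussian) = sets ?T"
    by (rule sets_pair_measure_cong) simp_all
  have "sets (gaussian_vec (Suc d) C0 \<Otimes>\<^sub>M std_gaussian) = sets (PiM {..<Suc d} (\<lambda>_. borel :: real measure) \<Otimes>\<^sub>M (borel :: real measure))"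
    by (rule sets_pair_measure_cong) simp_all
  then have \<phi>: "split_sample d e b \<in> measurable (gaussian_vec (Suc d) C0 \<Otimes>\<^sub>M std_gaussian) (slr_sample d \<sigma> C x \<Otimes>\<^sub>M std_gaussian)"
    using measurable_split_sample by (simp only: measurable_cong_sets[OF _ sets])
  have law: "distr (gaussian_vec (Suc d) C0 \<Otimes>\<^sub>M std_gaussian) (slr_sample d \<sigma> C x \<Otimes>\<^sub>M std_gaussian) (split_sample d e b) =
    slr_sample d \<sigma> C x \<Otimes>\<^sub>M std_gaussian"
    using assms(1) by (subst distr_cong[OF refl sets refl]) simp
  note main = distr_PiM_stream_space[OF prob_space_gaussian_vec prob_space_std_gaussian prob_space_slr_sample
      prob_space_std_gaussian \<phi> law, of n]
  show "split_input d n e b \<in> measurable KR T" "distr KR T (split_input d n e b) = T"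
    using main unfolding split_input_def KR_def T_def slr_law_def random_tape_def by simp_all
qed

text \<open>The split preserves probabilities, so it suffices to find an event in the independent
  coordinates whose preimage forces the right answer.\<close>

lemma measure_ge_of_split_input:
  assumes law: "distr (gaussian_vec (Suc d) C0 \<Otimes>\<^sub>M std_gaussian)
      ((PiM {..<d} (\<lambda>_. borel) \<Otimes>\<^sub>M borel) \<Otimes>\<^sub>M borel) (split_sample d e b) =
    slr_sample d \<sigma> C x \<Otimes>\<^sub>M std_gaussian"
    and E: "E \<in> sets (PiM {..<n} (\<lambda>_. PiM {..<Suc d} (\<lambda>_. borel)) \<Otimes>\<^sub>M stream_space borel)"
    and G: "G \<in> sets ((slr_law d n \<sigma> C x \<Otimes>\<^sub>M random_tape) \<Otimes>\<^sub>M gauss n)"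
    and sub: "\<And>S r. split_input d n e b (S, r) \<in> G \<Longrightarrow>
      (S, r) \<in> space (PiM {..<n} (\<lambda>_. PiM {..<Suc d} (\<lambda>_. borel)) \<Otimes>\<^sub>M stream_space borel) \<Longrightarrow> (S, r) \<in> E"
  shows "measure ((slr_law d n \<sigma> C x \<Otimes>\<^sub>M random_tape) \<Otimes>\<^sub>M gauss n) G \<le>
    measure (PiM {..<n} (\<lambda>_. gaussian_vec (Suc d) C0) \<Otimes>\<^sub>M random_tape) E"
proof -
  let ?KR = "PiM {..<n} (\<lambda>_. gaussian_vec (Suc d) C0) \<Otimes>\<^sub>M random_tape"
  let ?T = "(slr_law d n \<sigma> C x \<Otimes>\<^sub>M random_tape) \<Otimes>\<^sub>M gauss n"
  note split = split_input_law[OF law, of n]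
  interpret K: prob_space "PiM {..<n} (\<lambda>_. gaussian_vec (Suc d) C0)" by (rule prob_space_PiM) (rule prob_space_gaussian_vec)
  interpret R: prob_space random_tape by (rule prob_space_random_tape)
  interpret KR: pair_prob_space "PiM {..<n} (\<lambda>_. gaussian_vec (Suc d) C0)" random_tape ..
  have sets: "sets ?KR = sets (PiM {..<n} (\<lambda>_. PiM {..<Suc d} (\<lambda>_. borel :: real measure)) \<Otimes>\<^sub>M stream_space (borel :: real measure))"
    by (intro sets_pair_measure_cong sets_PiM_cong) simp_all
  have "measure ?T G = measure (distr ?KR ?T (split_input d n e b)) G" by (simp only: split(2))
  also have "\<dots> = measure ?KR (split_input d n e b -` G \<inter> space ?KR)"
    by (rule measure_distr[OF split(1) G])
  also have "\<dots> \<le> measure ?KR E"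
    using E sub by (intro KR.finite_measure_mono) (auto simp: sets sets_eq_imp_space_eq[OF sets])
  finally show ?thesis .
qed

text \<open>Split data are restricted functions while \<open>regression_samples\<close> is total;
  the input state reads both only below \<open>n\<close> and \<open>d\<close>, so the program cannot
  tell them apart.\<close>

lemma slr_input_cong:
  assumes "\<And>i j. i < n \<Longrightarrow> j < d \<Longrightarrow> fst (S i) j = fst (S' i) j" "\<And>i. i < n \<Longrightarrow> snd (S i) = snd (S' i)"
  shows "slr_input \<sigma> d k n S r = slr_input \<sigma> d k n S' r"
  using assms by (auto simp: slr_input_def fun_eq_iff)

lemma prob_space_slr_law: "prob_space (slr_law d n \<sigma> C x)"
  unfolding slr_law_def by (rule prob_space_PiM) (rule prob_space_slr_sample)

lemma sets_slr_law [simp, measurable_cong]: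
  "sets (slr_law d n \<sigma> C x) = sets (PiM {..<n} (\<lambda>_. PiM {..<d} (\<lambda>_. borel) \<Otimes>\<^sub>M borel))"
  unfolding slr_law_def by (rule sets_PiM_cong) simp_all

lemma measurable_slr_law_design [measurable]:
  "i < n \<Longrightarrow> j < d \<Longrightarrow> (\<lambda>S. fst (S i) j) \<in> borel_measurable (slr_law d n \<sigma> C x)"
  using measurable_compose[OF measurable_compose[OF measurable_component_singleton[of i "{..<n}" "\<lambda>_. PiM {..<d} (\<lambda>_. borel :: real measure) \<Otimes>\<^sub>M (borel :: real measure)"] measurable_fst]
      measurable_component_singleton[of j "{..<d}" "\<lambda>_. borel"]]
  by (subst measurable_cong_sets[OF sets_slr_law refl]) simp

lemma measurable_slr_law_response [measurable]:
  "i < n \<Longrightarrow> (\<lambda>S. snd (S i)) \<in> borel_measurable (slr_law d n \<sigma> C x)"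
  using measurable_compose[OF measurable_component_singleton[of i "{..<n}" "\<lambda>_. PiM {..<d} (\<lambda>_. borel :: real measure) \<Otimes>\<^sub>M (borel :: real measure)"] measurable_snd]
  by (subst measurable_cong_sets[OF sets_slr_law refl]) simp

lemma measurable_slr_input_law:
  "(\<lambda>p. slr_input s d k n (fst p) (snd p)) \<in> measurable (slr_law d n \<sigma> C x \<Otimes>\<^sub>M random_tape) state_space"
proof -
  have "sets (slr_law d n \<sigma> C x \<Otimes>\<^sub>M random_tape) =
    sets (PiM {..<n} (\<lambda>_. PiM {..<d} (\<lambda>_. borel :: real measure) \<Otimes>\<^sub>M (borel :: real measure)) \<Otimes>\<^sub>M stream_space (borel :: real measure))"
    by (rule sets_pair_measure_cong) simp_all
  from measurable_cong_sets[OF this refl, of state_space] measurable_slr_input[of s d k n]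
  show ?thesis by (simp add: split_beta')
qed

lemma sum_square_le:
  fixes p w :: "nat \<Rightarrow> real"
  shows "(\<Sum>i<n. (w i - p i)\<^sup>2) \<le> 11 / 10 * (\<Sum>i<n. (w i)\<^sup>2) + 11 * (\<Sum>i<n. (p i)\<^sup>2)"
proof -
  have "(a - b)\<^sup>2 \<le> 11 / 10 * a\<^sup>2 + 11 * b\<^sup>2" for a b :: real
  proof -
    \<comment> \<open>This square is exactly the difference of the two sides.\<close>
    have "0 \<le> (a + 10 * b)\<^sup>2 / 10" by simp
    then show ?thesis by (simp add: power2_eq_square algebra_simps)
  qed
  then have "(\<Sum>i<n. (w i - p i)\<^sup>2) \<le> (\<Sum>i<n. 11 / 10 * (w i)\<^sup>2 + 11 * (p i)\<^sup>2)" by (intro sum_mono) blast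
  then show ?thesis by (simp add: sum.distrib sum_distrib_left)
qed

section \<open>Spikes and the two covariance computations\<close>

lemma finite_spikes: "finite (spikes d k)"
proof -
  have "spikes d k \<subseteq> PiE {..<d + 1} (\<lambda>_. {1 / sqrt (real k + 1), - 1 / sqrt (real k + 1), 0})"
  proof
    fix v assume v: "v \<in> spikes d k"
    have "v i \<in> {1 / sqrt (real k + 1), - 1 / sqrt (real k + 1), 0}" if "i < d + 1" for i
    proof (cases "i = 0")
      case True
      then show ?thesis using v by (simp add: spikes_def)
    next
      case False
      then have "i \<in> {1..d}" using that by auto
      then show ?thesis using v unfolding spikes_def by blast
    qed
    then show "v \<in> PiE {..<d + 1} (\<lambda>_. {1 / sqrt (real k + 1), - 1 / sqrt (real k + 1), 0})"
      using v unfolding PiE_def spikes_def by blast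
  qed
  then show ?thesis by (rule finite_subset) (intro finite_PiE; simp)
qed

text \<open>The uniform distribution on the spikes is meaningful only for a finite nonempty set;
  this is where \<open>k \<le> d\<close> enters.\<close>

lemma spikes_nonempty:
  assumes "k \<le> d"
  shows "spikes d k \<noteq> {}"
proof -
  define v where "v = (\<lambda>i\<in>{..<d + 1}. if i = 0 then - 1 / sqrt (real k + 1) else if i \<le> k then 1 / sqrt (real k + 1) else 0)"
  have "sqrt (real k + 1) \<noteq> 0" by (simp add: add_eq_0_iff)
  then have "{i \<in> {1..d}. v i \<noteq> 0} = {1..k}" using assms by (auto simp: v_def)
  then have "v \<in> spikes d k" by (auto simp: spikes_def v_def)
  then show ?thesis by blast
qed

lemma spike_facts:
  assumes v: "v \<in> spikes d k"
  shows "v 0 = - 1 / sqrt (real k + 1)"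
    and "inner_upto d (\<lambda>j. v (Suc j)) (\<lambda>j. v (Suc j)) = real k / (real k + 1)"
    and "inner_upto (Suc d) v v = 1"
    and "card {j. j < d \<and> v (Suc j) \<noteq> 0} = k"
proof -
  show v0: "v 0 = - 1 / sqrt (real k + 1)" using v by (simp add: spikes_def)
  have "{i \<in> {1..d}. v i \<noteq> 0} = Suc ` {j. j < d \<and> v (Suc j) \<noteq> 0}"
    by (auto simp: image_iff) (metis Suc_le_lessD Suc_pred less_Suc_eq_le One_nat_def)
  then show c: "card {j. j < d \<and> v (Suc j) \<noteq> 0} = k"
    using v by (simp add: spikes_def card_image)
  have sq: "v (Suc j) * v (Suc j) = (if v (Suc j) \<noteq> 0 then 1 / (real k + 1) else 0)" if "j < d" for j
  proof -
    have "v (Suc j) \<in> {1 / sqrt (real k + 1), - 1 / sqrt (real k + 1), 0}" using v that by (auto simp: spikes_def)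
    then show ?thesis by auto
  qed
  have "inner_upto d (\<lambda>j. v (Suc j)) (\<lambda>j. v (Suc j)) = (\<Sum>j<d. if v (Suc j) \<noteq> 0 then 1 / (real k + 1) else 0)"
    unfolding inner_upto_def by (rule sum.cong[OF refl]) (use sq in simp)
  also have "\<dots> = (\<Sum>j\<in>{j. j < d \<and> v (Suc j) \<noteq> 0}. 1 / (real k + 1))"
    by (rule sum.mono_neutral_cong_right) auto
  finally show q: "inner_upto d (\<lambda>j. v (Suc j)) (\<lambda>j. v (Suc j)) = real k / (real k + 1)" using c by simp
  have "inner_upto (Suc d) v v = v 0 * v 0 + inner_upto d (\<lambda>j. v (Suc j)) (\<lambda>j. v (Suc j))"
    unfolding inner_upto_def by (rule sum.lessThan_Suc_shift)
  also have "\<dots> = 1" unfolding q v0 by (simp add: field_simps)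
  finally show "inner_upto (Suc d) v v = 1" .
qed

text \<open>Conditionally on the other coordinates, the first coordinate of a planted sample has mean \<open>\<langle>a, x\<rangle>\<close> and
  variance \<open>1 / 2\<close>; adding and subtracting \<open>h / sqrt 2\<close> yields two independent noises of variance \<open>1\<close>.\<close>

lemma planted_split_law:
  assumes v: "v \<in> spikes d k"
  defines "\<theta> \<equiv> (real k + 1) / (real k + 2)" and "x \<equiv> \<lambda>j. sqrt (real k + 1) / 2 * v (Suc j)"
  shows "psd_matrix d (spiked_cov \<theta> (\<lambda>j. v (Suc j)))" (is ?psd)
    and "sparse d k x" (is ?sparse)
    and "distr (gaussian_vec (Suc d) (spiked_cov \<theta> v) \<Otimes>\<^sub>M std_gaussian)
      ((PiM {..<d} (\<lambda>_. borel) \<Otimes>\<^sub>M borel) \<Otimes>\<^sub>M borel) (split_sample d 0 x) =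
    slr_sample d 1 (spiked_cov \<theta> (\<lambda>j. v (Suc j))) x \<Otimes>\<^sub>M std_gaussian" (is ?law)
proof -
  define m where "m = real k + 1"
  define r where "r = sqrt m"
  define u where "u j = v (Suc j)" for j
  have m: "m > 0" "real k = m - 1" by (simp_all add: m_def)
  have r: "r > 0" "r * r = m" using m by (simp_all add: r_def)
  have \<theta>: "\<theta> = m / (m + 1)" "0 \<le> \<theta>" "\<theta> \<le> 1" by (simp_all add: \<theta>_def m_def)
  have q: "inner_upto d u u = (m - 1) / m" using spike_facts(2)[OF v] by (simp add: u_def[abs_def] m_def)
  \<comment> \<open>The regression vector solves
    \<open>(Id - \<theta> u u^T) x = (\<theta> / r) u\<close>. On multiples of \<open>u\<close> the
    matrix acts as \<open>1 - \<theta> * (m - 1) / m = 2 / (m + 1)\<close>, and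
    \<open>\<theta> * (m + 1) / (2 * r) = r / 2\<close>.\<close>
  have x: "x j = r / 2 * u j" for j by (simp add: x_def r_def m_def u_def)
  have v0: "v 0 = - (1 / r)" using spike_facts(1)[OF v] by (simp add: r_def m_def)
  have "0 \<le> (m - 1) / m" "(m - 1) / m \<le> 1" by (simp_all add: m_def)
  then have "\<theta> * inner_upto d u u \<le> 1" unfolding q by (rule mult_le_one[OF \<theta>(3)])
  then obtain B where B: "root_of d (spiked_cov \<theta> u) B" using ex_root_spiked_cov \<theta>(2) by blast
  have "\<theta> * inner_upto (Suc d) v v \<le> 1" using spike_facts(3)[OF v] \<theta>(3) by simp
  then obtain B0 where B0: "root_of (Suc d) (spiked_cov \<theta> v) B0" using ex_root_spiked_cov \<theta>(2) by blast
  show ?psd using psd_matrix_of_root[OF B] by (simp add: u_def[abs_def])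
  have "{j. j < d \<and> x j \<noteq> 0} = {j. j < d \<and> v (Suc j) \<noteq> 0}" using r by (auto simp: x u_def)
  then show ?sparse using spike_facts(4)[OF v] by (simp add: sparse_def)
  have xu: "(\<Sum>j<d. x j * u j) = r / 2 * ((m - 1) / m)"
    unfolding q[symmetric] inner_upto_def x by (simp add: sum_distrib_left mult.assoc)
  have m1: "m + 1 \<noteq> 0" using m(1) by simp
  have \<theta>q: "\<theta> * ((m - 1) / m) = (m - 1) / (m + 1)" and \<theta>m: "\<theta> / m = 1 / (m + 1)"
    using m(1) by (simp_all add: \<theta>(1))
  have key: "r / 2 - \<theta> * (r / 2 * ((m - 1) / m)) = \<theta> / r"
  proof -
    have "r * (r / 2 - \<theta> * (r / 2 * ((m - 1) / m))) = (r * r) / 2 * (1 - \<theta> * ((m - 1) / m))"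
      by (simp add: algebra_simps)
    also have "\<dots> = \<theta>"
    proof -
      have "1 - (m - 1) / (m + 1) = 2 / (m + 1)" using m1 by (simp add: field_simps)
      then show ?thesis unfolding \<theta>q by (simp add: r(2) \<theta>(1))
    qed
    finally show ?thesis using r(1) by (simp add: field_simps)
  qed
  \<comment> \<open>The conditional variance of the first coordinate, and the identity that singles
    out this \<theta>: the value 1/2 matches the variance of \<open>h / sqrt 2\<close>.\<close>
  have half: "1 - \<theta> / m - \<theta> * ((m - 1) / m) / 2 = 1 / 2"
  proof -
    have "(m - 1) / (m + 1) = 1 - 2 * (1 / (m + 1))" using m1 by (simp add: field_simps)
    then show ?thesis unfolding \<theta>q \<theta>m by argo
  qed
  have xC: "(\<Sum>j<d. x j * spiked_cov \<theta> u i j) = \<theta> / r * u i" if "i < d" for i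
  proof -
    have "(\<Sum>j<d. x j * spiked_cov \<theta> u i j) = inner_upto d (id_cov i) x - \<theta> * u i * (\<Sum>j<d. x j * u j)"
      by (simp add: spiked_cov_def inner_upto_def sum_subtractf sum_distrib_left algebra_simps)
    also have "\<dots> = (r / 2 - \<theta> * (r / 2 * ((m - 1) / m))) * u i"
      using that by (simp only: inner_upto_id_cov xu) (simp add: x algebra_simps)
    finally show ?thesis unfolding key .
  qed
  have xx: "(\<Sum>i<d. x i * (\<theta> / r * u i)) = \<theta> * ((m - 1) / m) / 2"
  proof -
    have "(\<Sum>i<d. x i * (\<theta> / r * u i)) = \<theta> / r * (\<Sum>i<d. x i * u i)"
      by (simp add: sum_distrib_left algebra_simps)
    then show ?thesis unfolding xu using r(1) by simp
  qed
  have C0: "spiked_cov \<theta> v (Suc i) 0 = \<theta> / r * u i" "spiked_cov \<theta> v 0 (Suc i) = \<theta> / r * u i" for i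
    by (simp_all add: spiked_cov_def id_cov_def v0 u_def)
  have C00: "spiked_cov \<theta> v 0 0 = 1 - \<theta> / m"
    using r by (simp add: spiked_cov_def id_cov_def v0 field_simps)
  have "distr (gaussian_vec (Suc d) (spiked_cov \<theta> v) \<Otimes>\<^sub>M std_gaussian)
      ((PiM {..<d} (\<lambda>_. borel) \<Otimes>\<^sub>M borel) \<Otimes>\<^sub>M borel) (split_sample d 0 x) =
    slr_sample d 1 (spiked_cov \<theta> u) x \<Otimes>\<^sub>M std_gaussian"
  proof (rule split_sample_law[OF B0 B])
    show "spiked_cov \<theta> v (Suc i) (Suc j) = spiked_cov \<theta> u i j" for i j
      by (simp add: spiked_cov_def id_cov_def u_def)
    show "spiked_cov \<theta> v (Suc i) 0 = (\<Sum>j<d. x j * spiked_cov \<theta> u i j)" if "i < d" for i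
      using xC[OF that] by (simp add: C0)
    then show "(1 - 0) * spiked_cov \<theta> v (Suc i) 0 = (\<Sum>j<d. x j * spiked_cov \<theta> u i j)" if "i < d" for i
      using that by simp
    have "(\<Sum>i<d. x i * (\<Sum>j<d. x j * spiked_cov \<theta> u i j)) = \<theta> * ((m - 1) / m) / 2"
      unfolding xx[symmetric] by (rule sum.cong[OF refl]) (simp only: xC lessThan_iff)
    then show "spiked_cov \<theta> v 0 0 + 1 / 2 = (\<Sum>i<d. x i * (\<Sum>j<d. x j * spiked_cov \<theta> u i j)) + 1\<^sup>2"
      using half unfolding C00 by simp
    show "(1 - 0) * spiked_cov \<theta> v 0 0 - (\<Sum>j<d. x j * spiked_cov \<theta> v 0 (Suc j)) = (1 + 0) / 2"
      unfolding C0 C00 xx using half by simp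
  qed simp
  then show ?law by (simp add: u_def[abs_def])
qed

text \<open>The two responses have variance 3/2 and covariance 1/2, which gives the coefficient 1/3
  and the residual variance \<open>3 / 2 - 1 / 6 = 4 / 3\<close>, equal to \<open>1 + e\<close>.
  Seen as regression data, the null sample is pure noise of variance 3/2 with signal zero.\<close>

lemma null_split_law:
  "distr (gaussian_vec (Suc d) id_cov \<Otimes>\<^sub>M std_gaussian)
      ((PiM {..<d} (\<lambda>_. borel) \<Otimes>\<^sub>M borel) \<Otimes>\<^sub>M borel) (split_sample d (1 / 3) (\<lambda>_. 0)) =
    slr_sample d (sqrt (3 / 2)) id_cov (\<lambda>_. 0) \<Otimes>\<^sub>M std_gaussian"
  by (rule split_sample_law[OF root_of_id_cov root_of_id_cov]) (simp_all add: id_cov_def)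


section \<open>Success under each hypothesis\<close>

text \<open>Solves the definition of the split for the second response: the residual is a multiple
  of the independent Gaussian plus terms determined by the regression data and the tested vector,
  apart from the choice of \<open>b\<close>.\<close>

lemma residual_regression:
  assumes "i < n" "0 \<le> e"
  shows "residual d S r y i =
    sqrt (1 + e) * snd (split_input d n e b (S, r)) i + e * (S i 0 + r !! i / sqrt 2) +
      (\<Sum>j<d. b j * S i (Suc j)) - (\<Sum>j<d. S i (Suc j) * y j)"
  using assms by (simp add: residual_def split_input_def split_sample_def)

lemma planted_success:
  assumes v: "v \<in> spikes d k" and \<delta>: "0 \<le> \<delta>" "\<delta> \<le> 1"
    and solves: "solves_slr d k n 1 (1 / 100) (1 - \<delta>) alg"
  defines "\<theta> \<equiv> (real k + 1) / (real k + 2)"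
    and "E \<equiv> {(S, r) \<in> space (PiM {..<n} (\<lambda>_. PiM {..<Suc d} (\<lambda>_. borel)) \<Otimes>\<^sub>M stream_space borel).
     halts_with (reduction alg) (negspca_input ((real k + 1) / (real k + 2)) d k n S r) (\<lambda>s. negspca_answer s = 1)}"
  shows "1 - \<delta> - exp (- (1 / 10000 * real n)) \<le>
    measure (PiM {..<n} (\<lambda>_. gaussian_vec (Suc d) (spiked_cov \<theta> v)) \<Otimes>\<^sub>M random_tape) E"
proof -
  define x where "x j = sqrt (real k + 1) / 2 * v (Suc j)" for j
  define C where "C = spiked_cov \<theta> (\<lambda>j. v (Suc j))"
  note split = planted_split_law[OF v, folded \<theta>_def x_def[abs_def] C_def]
  let ?L = "slr_law d n 1 C x" and ?\<gamma> = "exp (- (1 / 10000 * real n))"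
  interpret L: prob_space ?L by (rule prob_space_slr_law)
  interpret R: prob_space random_tape by (rule prob_space_random_tape)
  interpret LR: pair_prob_space ?L random_tape ..
  have G: "prob_space (gauss n)" by (rule prob_space_PiM) (rule prob_space_std_gaussian)
  interpret T: pair_prob_space "?L \<Otimes>\<^sub>M random_tape" "gauss n" ..
  let ?good = "\<lambda>p. halts_with alg (slr_input 1 d k n (fst p) (snd p))
    (\<lambda>s. prediction_error d n (fst p) (slr_output s) x \<le> 1 / 100)"
  define A where "A = {p \<in> space (?L \<Otimes>\<^sub>M random_tape). ?good p}"
  define W where "W = {w \<in> space (gauss n). 103 / 100 * real n \<le> (\<Sum>i<n. (w i)\<^sup>2)}"
  have A: "A \<in> sets (?L \<Otimes>\<^sub>M random_tape)"
  proof -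
    have [measurable]: "(\<lambda>q. fst (fst (fst q) i) j) \<in> borel_measurable ((?L \<Otimes>\<^sub>M random_tape) \<Otimes>\<^sub>M state_space)"
      if "i \<in> {..<n}" "j \<in> {..<d}" for i j
      using measurable_compose[OF measurable_compose[OF measurable_fst measurable_fst] measurable_slr_law_design[of i n j d 1 C x]] that by simp
    have "Measurable.pred ((?L \<Otimes>\<^sub>M random_tape) \<Otimes>\<^sub>M state_space)
      (\<lambda>(p, s). prediction_error d n (fst p) (slr_output s) x \<le> 1 / 100)"
      unfolding prediction_error_def slr_output_def split_beta' by measurable
    from measurable_halts_with[OF measurable_slr_input_law this, of alg]
    show ?thesis unfolding A_def pred_def .
  qed
  have W: "W \<in> sets (gauss n)"
  proof -
    have [measurable]: "(\<lambda>w. w i) \<in> borel_measurable (gauss n)" if "i \<in> {..<n}" for i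
      using measurable_component_singleton[of i "{..<n}" "\<lambda>_. std_gaussian"] that by simp
    show ?thesis unfolding W_def by measurable
  qed
  have "1 - \<delta> \<le> LR.prob A"
    using solves split(1,2) unfolding solves_slr_def A_def by (simp add: split_beta')
  moreover have "1 - ?\<gamma> \<le> measure (gauss n) (space (gauss n) - W)"
    using gauss_norm_upper_tail[of n] W unfolding W_def[symmetric]
    by (simp add: prob_space.prob_compl[OF G] finite_measure.emeasure_eq_measure[OF prob_space.finite_measure[OF G]])
  \<comment> \<open>Accuracy of the regression and size of the test noise are independent events, so
    their probabilities multiply.\<close>
  ultimately have "(1 - \<delta>) * (1 - ?\<gamma>) \<le> LR.prob A * measure (gauss n) (space (gauss n) - W)"
    using \<delta> by (intro mult_mono) auto
  also have "\<dots> = T.prob (A \<times> (space (gauss n) - W))"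
    using A W by (simp add: measure_def sigma_finite_measure.emeasure_pair_measure_Times[OF prob_space_imp_sigma_finite[OF G]] enn2real_mult)
  also have "\<dots> \<le> measure (PiM {..<n} (\<lambda>_. gaussian_vec (Suc d) (spiked_cov \<theta> v)) \<Otimes>\<^sub>M random_tape) E"
  proof (rule measure_ge_of_split_input[OF split(3)])
    show "E \<in> sets (PiM {..<n} (\<lambda>_. PiM {..<Suc d} (\<lambda>_. borel)) \<Otimes>\<^sub>M stream_space borel)"
      unfolding E_def by (rule sets_negspca_event)
    show "A \<times> (space (gauss n) - W) \<in> sets ((?L \<Otimes>\<^sub>M random_tape) \<Otimes>\<^sub>M gauss n)"
      using A W by (intro pair_measureI) auto
    fix S r assume mem: "split_input d n 0 x (S, r) \<in> A \<times> (space (gauss n) - W)"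
      and sp: "(S, r) \<in> space (PiM {..<n} (\<lambda>_. PiM {..<Suc d} (\<lambda>_. borel :: real measure)) \<Otimes>\<^sub>M stream_space (borel :: real measure))"
    define S' where "S' = fst (fst (split_input d n 0 x (S, r)))"
    define w where "w = snd (split_input d n 0 x (S, r))"
    have r': "snd (fst (split_input d n 0 x (S, r))) = sdrop n r" by (simp add: split_input_def)
    have S': "fst (S' i) j = S i (Suc j)" if "i < n" "j < d" for i j
      using that by (simp add: S'_def split_input_def split_sample_def)
    have inp: "slr_input 1 d k n S' (sdrop n r) = slr_input 1 d k n (regression_samples S r) (sdrop n r)"
      by (rule slr_input_cong) (simp_all add: S'_def split_input_def split_sample_def regression_samples_def)
    have w: "(\<Sum>i<n. (w i)\<^sup>2) < 103 / 100 * real n"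
      using mem by (auto simp: W_def w_def mem_Times_iff)
    \<comment> \<open>The strict bound on the noise excludes \<open>n = 0\<close>, where the factor
      \<open>1 / n\<close> in the prediction error would be 0 by convention.\<close>
    then have n: "real n > 0" using sum_nonneg[of "{..<n}" "\<lambda>i. (w i)\<^sup>2"] by (cases n) auto
    obtain t u where u: "exec alg (slr_input 1 d k n (regression_samples S r) (sdrop n r)) t u"
      "prediction_error d n S' (slr_output u) x \<le> 1 / 100"
      using mem unfolding A_def halts_with_def by (auto simp: mem_Times_iff S'_def[symmetric] r' inp)
    define p where "p i = (\<Sum>j<d. S i (Suc j) * slr_output u j) - (\<Sum>j<d. S i (Suc j) * x j)" for i
    have "prediction_error d n S' (slr_output u) x = 1 / real n * (\<Sum>i<n. (p i)\<^sup>2)"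
      unfolding prediction_error_def p_def by (simp add: S')
    then have p: "(\<Sum>i<n. (p i)\<^sup>2) \<le> real n / 100" using u(2) n by (simp add: pos_divide_le_eq)
    have "residual d S r (slr_output u) i = w i - p i" if "i < n" for i
      using residual_regression[of i n 0 d S r "slr_output u" x] that by (simp add: w_def p_def mult.commute)
    then have "(\<Sum>i<n. (residual d S r (slr_output u) i)\<^sup>2) = (\<Sum>i<n. (w i - p i)\<^sup>2)" by simp
    also have "\<dots> \<le> 11 / 10 * (\<Sum>i<n. (w i)\<^sup>2) + 11 * (\<Sum>i<n. (p i)\<^sup>2)" by (rule sum_square_le)
    also have "\<dots> \<le> 5 / 4 * real n" using w p n by linarith
    finally have small: "\<not> 5 * real n < 4 * (\<Sum>i<n. (residual d S r (slr_output u) i)\<^sup>2)" by simp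
    show "(S, r) \<in> E"
      using exec_reduction[OF u(1), of "(real k + 1) / (real k + 2)"] small sp
      unfolding E_def halts_with_def by auto
  qed
  finally have "(1 - \<delta>) * (1 - ?\<gamma>) \<le> measure (PiM {..<n} (\<lambda>_. gaussian_vec (Suc d) (spiked_cov \<theta> v)) \<Otimes>\<^sub>M random_tape) E" .
  moreover have "1 - \<delta> - ?\<gamma> \<le> (1 - \<delta>) * (1 - ?\<gamma>)" using \<delta> by (simp add: algebra_simps)
  ultimately show ?thesis by linarith
qed

text \<open>The program is told \<open>sigma = 1\<close> while the noise has variance 3/2, so its
  guarantee does not apply. Halting on every input suffices: given the regression data and tape, the
  output is fixed and merely shifts the centres of the independent test noise.\<close>

lemma null_success:
  fixes \<theta> :: real
  assumes halts: "\<And>S r. \<exists>t u. exec alg (slr_input 1 d k n S r) t u"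
  defines "E \<equiv> {(S, r) \<in> space (PiM {..<n} (\<lambda>_. PiM {..<Suc d} (\<lambda>_. borel)) \<Otimes>\<^sub>M stream_space borel).
     halts_with (reduction alg) (negspca_input \<theta> d k n S r) (\<lambda>s. negspca_answer s = 0)}"
  shows "1 - exp (- (1 / 10000 * real n)) \<le>
    measure (PiM {..<n} (\<lambda>_. gaussian_vec (Suc d) id_cov) \<Otimes>\<^sub>M random_tape) E"
proof -
  let ?L = "slr_law d n (sqrt (3 / 2)) id_cov (\<lambda>_. 0)" and ?\<gamma> = "exp (- (1 / 10000 * real n))"
  interpret L: prob_space ?L by (rule prob_space_slr_law)
  interpret R: prob_space random_tape by (rule prob_space_random_tape)
  interpret LR: pair_prob_space ?L random_tape ..
  have G: "prob_space (gauss n)" by (rule prob_space_PiM) (rule prob_space_std_gaussian)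
  interpret T: pair_prob_space "?L \<Otimes>\<^sub>M random_tape" "gauss n" ..
  let ?T = "(?L \<Otimes>\<^sub>M random_tape) \<Otimes>\<^sub>M gauss n"
  define out where "out p = slr_output (final alg (slr_input 1 d k n (fst p) (snd p)))" for p
  \<comment> \<open>The known part of the residual: a third of the first response, which is the best
    prediction of the second one, minus the prediction by the program.\<close>
  define c where "c p i = snd (fst p i) / 3 - (\<Sum>j<d. fst (fst p i) j * out p j)" for p :: "slr_samples \<times> real stream" and i
  define B where "B = {q \<in> space ?T. 4 * (\<Sum>i<n. (c (fst q) i + sqrt (4 / 3) * snd q i)\<^sup>2) \<le> 5 * real n}"
  have out [measurable]: "(\<lambda>p. out p j) \<in> borel_measurable (?L \<Otimes>\<^sub>M random_tape)" for j
    unfolding out_def slr_output_def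
    by (rule measurable_compose[OF measurable_compose[OF measurable_slr_input_law measurable_final] measurable_reals])
  have [measurable]: "(\<lambda>p. fst (fst p i) j) \<in> borel_measurable (?L \<Otimes>\<^sub>M random_tape)" if "i \<in> {..<n}" "j \<in> {..<d}" for i j
    using measurable_compose[OF measurable_fst measurable_slr_law_design[of i n j d]] that by simp
  have [measurable]: "(\<lambda>p. snd (fst p i)) \<in> borel_measurable (?L \<Otimes>\<^sub>M random_tape)" if "i \<in> {..<n}" for i
    using measurable_compose[OF measurable_fst measurable_slr_law_response[of i n]] that by simp
  have c: "(\<lambda>p. c p i) \<in> borel_measurable (?L \<Otimes>\<^sub>M random_tape)" if "i \<in> {..<n}" for i
    using that unfolding c_def by measurable
  have B: "B \<in> sets ?T"
  proof -
    have [measurable]: "(\<lambda>q. c (fst q) i) \<in> borel_measurable ?T" if "i \<in> {..<n}" for i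
      by (rule measurable_compose[OF measurable_fst c[OF that]])
    have [measurable]: "(\<lambda>q. snd q i) \<in> borel_measurable ?T" if "i \<in> {..<n}" for i
      using measurable_compose[OF measurable_snd measurable_component_singleton[of i "{..<n}" "\<lambda>_. std_gaussian"]] that by simp
    show ?thesis unfolding B_def by measurable
  qed
  have "emeasure ?T B = (\<integral>\<^sup>+p. emeasure (gauss n) (Pair p -` B) \<partial>(?L \<Otimes>\<^sub>M random_tape))"
    by (rule sigma_finite_measure.emeasure_pair_measure_alt[OF prob_space_imp_sigma_finite[OF G] B])
  also have "\<dots> \<le> (\<integral>\<^sup>+p. ennreal ?\<gamma> \<partial>(?L \<Otimes>\<^sub>M random_tape))"
  proof (rule nn_integral_mono)
    \<comment> \<open>For fixed data and tape the centres \<open>c p\<close> are constants, so the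
      tail bound with arbitrary centres applies to each section.\<close>
    fix p assume "p \<in> space (?L \<Otimes>\<^sub>M random_tape)"
    then have "Pair p -` B = {w \<in> space (gauss n). 4 * (\<Sum>i<n. (c p i + sqrt (4 / 3) * w i)\<^sup>2) \<le> 5 * real n}"
      by (auto simp: B_def space_pair_measure)
    then show "emeasure (gauss n) (Pair p -` B) \<le> ennreal ?\<gamma>"
      using gauss_norm_lower_tail[of n "c p"] by simp
  qed
  also have "\<dots> = ennreal ?\<gamma>" by (simp add: LR.emeasure_space_1)
  finally have "T.prob B \<le> ?\<gamma>" by (simp add: T.emeasure_eq_measure)
  then have "1 - ?\<gamma> \<le> T.prob (space ?T - B)" using B by (simp add: T.prob_compl)
  also have "\<dots> \<le> measure (PiM {..<n} (\<lambda>_. gaussian_vec (Suc d) id_cov) \<Otimes>\<^sub>M random_tape) E"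
  proof (rule measure_ge_of_split_input[OF null_split_law])
    show "E \<in> sets (PiM {..<n} (\<lambda>_. PiM {..<Suc d} (\<lambda>_. borel)) \<Otimes>\<^sub>M stream_space borel)"
      unfolding E_def by (rule sets_negspca_event)
    show "space ?T - B \<in> sets ?T" using B by (rule sets.compl_sets)
    fix S r assume mem: "split_input d n (1 / 3) (\<lambda>_. 0) (S, r) \<in> space ?T - B"
      and sp: "(S, r) \<in> space (PiM {..<n} (\<lambda>_. PiM {..<Suc d} (\<lambda>_. borel :: real measure)) \<Otimes>\<^sub>M stream_space (borel :: real measure))"
    define q where "q = split_input d n (1 / 3) (\<lambda>_. 0) (S, r)"
    define s0 where "s0 = slr_input 1 d k n (regression_samples S r) (sdrop n r)"
    have inp: "slr_input 1 d k n (fst (fst q)) (snd (fst q)) = s0"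
    proof -
      have "snd (fst q) = sdrop n r" by (simp add: q_def split_input_def)
      moreover have "slr_input 1 d k n (fst (fst q)) (sdrop n r) = s0" unfolding s0_def
        by (rule slr_input_cong) (simp_all add: q_def split_input_def split_sample_def regression_samples_def)
      ultimately show ?thesis by simp
    qed
    obtain t where t: "exec alg s0 t (final alg s0)"
      using halts[of "regression_samples S r" "sdrop n r"] exec_final unfolding s0_def by blast
    have "residual d S r (slr_output (final alg s0)) i = c (fst q) i + sqrt (4 / 3) * snd q i" if "i < n" for i
    proof -
      have "snd (fst (fst q) i) = S i 0 + r !! i / sqrt 2" "\<And>j. j < d \<Longrightarrow> fst (fst (fst q) i) j = S i (Suc j)"
        using that by (simp_all add: q_def split_input_def split_sample_def)
      then show ?thesis
        using residual_regression[of i n "1 / 3" d S r "slr_output (final alg s0)" "\<lambda>_. 0"] that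
        by (simp add: c_def out_def inp q_def[symmetric])
    qed
    then have "(\<Sum>i<n. (residual d S r (slr_output (final alg s0)) i)\<^sup>2) = (\<Sum>i<n. (c (fst q) i + sqrt (4 / 3) * snd q i)\<^sup>2)" by simp
    then have large: "5 * real n < 4 * (\<Sum>i<n. (residual d S r (slr_output (final alg s0)) i)\<^sup>2)"
      using mem unfolding q_def[symmetric] B_def by auto
    show "(S, r) \<in> E"
      using exec_reduction[OF t[unfolded s0_def], of \<theta>] large sp
      unfolding E_def halts_with_def s0_def by auto
  qed
  finally show ?thesis .
qed

text \<open>The reduction loses only \<delta>; this weakens its bound to the required form.\<close>

lemma le_sqrt_double:
  assumes "0 \<le> \<delta>" "\<delta> \<le> (1 :: real)"
  shows "\<delta> \<le> sqrt (2 * \<delta>)"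
proof (rule real_le_rsqrt)
  have "\<delta> * \<delta> \<le> 1 * \<delta>" using assms by (intro mult_right_mono)
  then show "\<delta>\<^sup>2 \<le> 2 * \<delta>" using assms by (simp add: power2_eq_square)
qed

lemma solves_negspca_reduction:
  assumes "k \<le> d" "0 \<le> \<delta>" "\<delta> \<le> 1"
    and halts: "\<And>S r. \<exists>t u. exec alg (slr_input 1 d k n S r) t u"
    and solves: "solves_slr d k n 1 (1 / 100) (1 - \<delta>) alg"
  shows "solves_negspca d k n ((real k + 1) / (real k + 2))
    (1 - sqrt (2 * \<delta>) - exp (- (1 / 10000 * real n))) (reduction alg)"
proof -
  let ?\<theta> = "(real k + 1) / (real k + 2)"
  let ?M = "PiM {..<n} (\<lambda>_. PiM {..<Suc d} (\<lambda>_. borel :: real measure)) \<Otimes>\<^sub>M stream_space (borel :: real measure)"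
  let ?E = "\<lambda>b. {(S, r) \<in> space ?M. halts_with (reduction alg) (negspca_input ?\<theta> d k n S r) (\<lambda>s. negspca_answer s = b)}"
  let ?p = "1 - sqrt (2 * \<delta>) - exp (- (1 / 10000 * real n))"
  note d = le_sqrt_double[OF assms(2,3)]
  have planted: "?p \<le> measure (planted_law d k n ?\<theta> \<Otimes>\<^sub>M random_tape) (?E 1)"
    using planted_success[OF _ assms(2,3) solves] d
    by (intro planted_prob_ge finite_spikes spikes_nonempty assms sets_negspca_event) force
  have null: "?p \<le> measure (null_law d n \<Otimes>\<^sub>M random_tape) (?E 0)"
    using null_success[OF halts, of ?\<theta>] d assms(2) unfolding null_law_def by simp
  have sets: "sets (planted_law d k n ?\<theta>) = sets (PiM {..<n} (\<lambda>_. PiM {..<Suc d} (\<lambda>_. borel :: real measure)))"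
    "sets (null_law d n) = sets (PiM {..<n} (\<lambda>_. PiM {..<Suc d} (\<lambda>_. borel :: real measure)))"
    unfolding planted_law_def null_law_def
    by (rule sets_bind) (auto intro!: sets_PiM_cong)
  have space: "space (planted_law d k n ?\<theta> \<Otimes>\<^sub>M random_tape) = space ?M" "space (null_law d n \<Otimes>\<^sub>M random_tape) = space ?M"
    by (rule sets_eq_imp_space_eq, rule sets_pair_measure_cong, simp_all add: sets)+
  show ?thesis
    unfolding solves_negspca_def space using planted null by (simp add: split_beta')
qed

theorem theorem3p1:
  shows "\<exists>\<gamma>>0. \<forall>(params :: (nat \<times> nat \<times> nat) set) (\<delta> :: nat \<Rightarrow> nat \<Rightarrow> nat \<Rightarrow> real).
    (\<forall>(d, k, n) \<in> params. k \<le> d \<and> 0 \<le> \<delta> d k n \<and> \<delta> d k n \<le> 1) \<longrightarrow>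
    (\<exists>alg. efficient params (slr_input 1) alg \<and>
       (\<forall>(d, k, n) \<in> params. solves_slr d k n 1 (1 / 100) (1 - \<delta> d k n) alg)) \<longrightarrow>
    (\<exists>alg. efficient params (\<lambda>d k. negspca_input ((real k + 1) / (real k + 2)) d k) alg \<and>
       (\<forall>(d, k, n) \<in> params.
          solves_negspca d k n ((real k + 1) / (real k + 2))
            (1 - sqrt (2 * \<delta> d k n) - exp (- (\<gamma> * real n))) alg))"
\<comment> \<open>The rate shared by both tail bounds. It depends on neither the parameters nor
  \<delta>, so the constant hidden in the exponent is absolute.\<close>
proof (intro exI[of _ "1 / 10000"] conjI allI impI)
  fix params :: "(nat \<times> nat \<times> nat) set" and \<delta> :: "nat \<Rightarrow> nat \<Rightarrow> nat \<Rightarrow> real"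
  assume range: "\<forall>(d, k, n) \<in> params. k \<le> d \<and> 0 \<le> \<delta> d k n \<and> \<delta> d k n \<le> 1"
    and "\<exists>alg. efficient params (slr_input 1) alg \<and>
       (\<forall>(d, k, n) \<in> params. solves_slr d k n 1 (1 / 100) (1 - \<delta> d k n) alg)"
  then obtain alg where eff: "efficient params (slr_input 1) alg"
    and solves: "\<forall>(d, k, n) \<in> params. solves_slr d k n 1 (1 / 100) (1 - \<delta> d k n) alg" by blast
  have "solves_negspca d k n ((real k + 1) / (real k + 2))
      (1 - sqrt (2 * \<delta> d k n) - exp (- (1 / 10000 * real n))) (reduction alg)" if "(d, k, n) \<in> params" for d k n
  proof (rule solves_negspca_reduction)
    \<comment> \<open>Efficiency includes halting on every input, also on those that no regression
      model with unit noise would produce.\<close>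
    show "\<exists>t u. exec alg (slr_input 1 d k n S r) t u" for S r
      using eff that unfolding efficient_def by blast
  qed (use that range solves in auto)
  then show "\<exists>alg. efficient params (\<lambda>d k. negspca_input ((real k + 1) / (real k + 2)) d k) alg \<and>
       (\<forall>(d, k, n) \<in> params.
          solves_negspca d k n ((real k + 1) / (real k + 2))
            (1 - sqrt (2 * \<delta> d k n) - exp (- (1 / 10000 * real n))) alg)"
    using efficient_reduction[OF eff] by (intro exI[of _ "reduction alg"]) auto
qed simp

end
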